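(* Let $G$ be a finite abelian group such that $\exp(G)$ is wide and such that the $p$-components of $G$ are all cyclic, except possibly the $P^{+}(\exp(G))$-component. Then $\mathsf{k}(G)=\mathsf{k}^{*}(G)$.
   Context: Groups are finite abelian, written additively; $C_m$ is the cyclic group of order $m$; $\exp(G)$ is the exponent of $G$; $P^{+}(n)$ is the largest prime dividing $n$; $\mathbb{N}=\mathbb{Z}_{\ge 0}$; $G^{\bullet}=G\setminus\{0\}$. The $p$-component of $G$ is its Sylow $p$-subgroup. An indexed sequence over $G$ is an element of the free abelian monoid (written multiplicatively, identity $1$) on $G^{\bullet}\times\mathbb{N}$; all indexed sequences are assumed squarefree, i.e. every pair $(g,n)$ occurs with multiplicity at most one, so an indexed sequence is a finite set of labelled nonzero elements of $G$ (the same $g$ may occur with several labels). For an indexed sequence $S$, $\overline{v}_g(S)$ is the number of terms of $S$ with first coordinate $g$, and $\overline{\sigma}(S)=\sum_{g\in G^\bullet}\overline{v}_g(S)\,g\in G$. A subsequence $T$ of $S$ (written $T\mid S$) is a divisor in the monoid. $S$ is zero-sum free if there is no $T\mid S$, $T\neq 1$, with $\overline{\sigma}(T)=0$. The cross number of $S$ is $\mathsf{k}(S)=\sum_{g\in G^\bullet}\overline{v}_g(S)/\mathrm{ord}(g)$. The little cross number of $G$ is $$\mathsf{k}(G)=\max\{\mathsf{k}(S): S \text{ a zero-sum free indexed sequence over } G\}.$$ Writing $G\cong\bigoplus_{i=1}^{r}C_{p_i^{\alpha_i}}$ as a direct sum of cyclic groups of prime power order ($p_i$ not necessarily distinct), define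 $\mathsf{k}^{*}(G)=\sum_{i=1}^{r}\bigl(1-p_i^{-\alpha_i}\bigr)$. A prime $p$ is wide with respect to a positive integer $n$, written $p\prec n$, if $p\nmid n$ and, with prime factorization $n=q_1^{\alpha_1}\cdots q_r^{\alpha_r}$, $$\frac{p}{p-1}\ge\prod_{j=1}^{r}\frac{q_j^{\alpha_j+1}-1}{q_j^{\alpha_j+1}-q_j^{\alpha_j}},$$ the empty product being $1$. A positive integer $n=q_1^{\alpha_1}\cdots q_r^{\alpha_r}$ with primes $q_1<q_2<\cdots<q_r$ is wide if $q_i\prec\prod_{j=i+1}^{r}q_j^{\alpha_j}$ for each $i$ with $1\le i\le r-1$. *)

theory Defs
  imports
    "HOL-Algebra.Multiplicative_Group"
    "HOL-Algebra.Product_Groups"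
    "HOL-Computational_Algebra.Primes"
begin

text \<open>
  Groups are records in the multiplicative notation of HOL-Algebra: the paper's
  \<open>0\<close>, \<open>g + h\<close> and \<open>n g\<close> are \<open>\<one>\<close>, \<open>g \<otimes> h\<close> and \<open>g [^] n\<close>.
\<close>

definition group_exp :: "('a, 'b) monoid_scheme \<Rightarrow> nat" where
  "group_exp G = (LEAST n. n > 0 \<and> (\<forall>x\<in>carrier G. x [^]\<^bsub>G\<^esub> n = \<one>\<^bsub>G\<^esub>))"

definition is_p_component :: "('a, 'b) monoid_scheme \<Rightarrow> nat \<Rightarrow> 'a set \<Rightarrow> bool" where
  "is_p_component G p P \<longleftrightarrow>
     prime p \<and> subgroup P G \<and> card P = p ^ multiplicity p (card (carrier G))"

text \<open>For \<open>n = 1\<close> the value is unspecified.\<close>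

definition largest_prime :: "nat \<Rightarrow> nat" where
  "largest_prime n = Max (prime_factors n)"

text \<open>
  A squarefree element of the free abelian monoid on \<open>G\<^sup>\<bullet> \<times> \<nat>\<close> is represented by the finite
  set of pairs occurring in it. Subsequences are subsets, and the identity \<open>1\<close> is \<open>{}\<close>.
\<close>

definition indexed_seq :: "('a, 'b) monoid_scheme \<Rightarrow> ('a \<times> nat) set \<Rightarrow> bool" where
  "indexed_seq G S \<longleftrightarrow> finite S \<and> S \<subseteq> (carrier G - {\<one>\<^bsub>G\<^esub>}) \<times> UNIV"

definition seq_mult :: "('a \<times> nat) set \<Rightarrow> 'a \<Rightarrow> nat" where
  "seq_mult S g = card {t \<in> S. fst t = g}"

definition seq_sum :: "('a, 'b) monoid_scheme \<Rightarrow> ('a \<times> nat) set \<Rightarrow> 'a" where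
  "seq_sum G S = (\<Otimes>\<^bsub>G\<^esub>g\<in>carrier G - {\<one>\<^bsub>G\<^esub>}. g [^]\<^bsub>G\<^esub> seq_mult S g)"

definition zero_sum_free :: "('a, 'b) monoid_scheme \<Rightarrow> ('a \<times> nat) set \<Rightarrow> bool" where
  "zero_sum_free G S \<longleftrightarrow> \<not> (\<exists>T. T \<subseteq> S \<and> T \<noteq> {} \<and> seq_sum G T = \<one>\<^bsub>G\<^esub>)"

definition cross_number :: "('a, 'b) monoid_scheme \<Rightarrow> ('a \<times> nat) set \<Rightarrow> real" where
  "cross_number G S =
     (\<Sum>g\<in>carrier G - {\<one>\<^bsub>G\<^esub>}. real (seq_mult S g) / real (group.ord G g))"

definition little_cross_number :: "('a, 'b) monoid_scheme \<Rightarrow> real" where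
  "little_cross_number G = Max {cross_number G S | S. indexed_seq G S \<and> zero_sum_free G S}"

text \<open>
  The value does not depend on the chosen decomposition into cyclic groups of prime power
  order, since these orders are determined by \<open>G\<close> up to permutation.
\<close>

definition k_star :: "('a, 'b) monoid_scheme \<Rightarrow> real" where
  "k_star G = (THE x. \<exists>(r :: nat) (p :: nat \<Rightarrow> nat) (\<alpha> :: nat \<Rightarrow> nat).
     (\<forall>i<r. prime (p i) \<and> \<alpha> i \<ge> 1) \<and>
     G \<cong> product_group {..<r} (\<lambda>i. integer_mod_group (p i ^ \<alpha> i)) \<and>
     x = (\<Sum>i<r. 1 - 1 / real (p i) ^ \<alpha> i))"

definition wide_wrt :: "nat \<Rightarrow> nat \<Rightarrow> bool" where
  "wide_wrt p n \<longleftrightarrow>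
     prime p \<and> n > 0 \<and> \<not> p dvd n \<and>
     real p / (real p - 1) \<ge>
       (\<Prod>q\<in>prime_factors n.
          (real q ^ (multiplicity q n + 1) - 1) /
          (real q ^ (multiplicity q n + 1) - real q ^ multiplicity q n))"

definition wide :: "nat \<Rightarrow> bool" where
  "wide n \<longleftrightarrow>
     n > 0 \<and>
     (\<forall>p\<in>prime_factors n. p \<noteq> largest_prime n \<longrightarrow>
        wide_wrt p (\<Prod>q\<in>{q \<in> prime_factors n. p < q}. q ^ multiplicity q n))"

end

theory Submission
  imports Defs
    "HOL-Library.Multiset"
    "HOL-Computational_Algebra.Polynomial"
    "HOL-Number_Theory.Cong"
    "HOL-Algebra.Sylow"
begin

text \<open>
  The lower bound comes from the obvious sequence: each generator of a decomposition into cyclic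
  groups of prime power order \<open>n\<^sub>i\<close>, taken \<open>n\<^sub>i - 1\<close> times. The work is in the upper
  bound. Only the multiset of first coordinates of an indexed sequence matters, so everything is done
  with multisets \<open>M\<close>, their products, and their cross number \<open>cr M\<close>.

  For elements of \<open>p\<close>-power order the bound is proved by counting degrees, with weights. Give an
  integer function \<open>f\<close> on \<open>G\<close> degree at most \<open>d\<close> modulo \<open>p\<close> if its iterated differences
  along elements of \<open>p\<close>-power order vanish modulo \<open>p\<close> as soon as the cross number of these elements
  exceeds \<open>d\<close>. Degrees add under products. The indicator function of one coordinate being \<open>0\<close>
  modulo \<open>p\<^sup>a\<close> has degree at most \<open>1 - p\<^sup>-\<^sup>a\<close>, since \<open>(X - 1)^(p\<^sup>a) = X^(p\<^sup>a) - 1\<close> modulo \<open>p\<close>. So the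
  indicator of the neutral element has degree at most the claimed bound; but its iterated difference
  along a zero-sum free \<open>M\<close> is \<open>\<plusminus>1\<close> at the neutral element, whence \<open>cr M\<close> cannot exceed that degree
  (\<open>cross_number_p_group_le\<close>). A prime with cyclic component is therefore \<open>thin\<close>: zero-sum free
  multisets of elements of \<open>p\<close>-power order have cross number below \<open>1\<close>.

  In general one inducts on a number \<open>e\<close> that all orders divide. Let \<open>p\<close> be the least prime of
  \<open>e = p\<^sup>a n\<close>. Weigh each element by the reciprocal of the \<open>p\<close>-part of its order. When \<open>p\<close> is thin, any
  multiset of weight at least \<open>1\<close> contains a nonempty block of weight at most \<open>1\<close> whose product has
  order prime to \<open>p\<close> (\<open>exists_p_free_block\<close>). Replacing blocks by their products keeps \<open>M\<close> zero-sum
  free and moves cross number into orders dividing \<open>n\<close>, where induction applies. What has to be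
  controlled is the loss: it may be at most \<open>\<kappa> = 1 - p\<^sup>-\<^sup>a\<close>. If \<open>q\<close> is the next prime of \<open>e\<close>, the
  \<open>p\<close>-free parts of the orders are arranged in chains \<open>f, f q, f q\<^sup>2, \<dots>\<close> with \<open>f\<close> a divisor of \<open>e\<close>
  having only primes above \<open>q\<close>. Blocks are extracted going up a chain, and a block taken at level
  \<open>f q\<^sup>i\<close> returns at least \<open>1 / (f q\<^sup>i)\<close>; by summation by parts a whole chain loses at most \<open>\<kappa> / f\<close>
  (\<open>chain_bound\<close>). Wideness of \<open>e\<close> says that \<open>\<Sum> 1 / f \<le> q / (q - 1)\<close>.

  The total \<open>\<kappa> q / (q - 1)\<close> is still slightly too much, and the gain must come from the chain
  \<open>f = 1\<close>, whose lowest level consists of elements of \<open>p\<close>-power order. If its weight is at most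
  \<open>\<kappa> - 1 / p\<close>, the gain on that chain suffices whenever \<open>q \<ge> p + 2\<close>. This weight bound holds
  once no block can be merged without decreasing the cross number (\<open>dense\<close>) and there are fewer than
  \<open>p - 1\<close> elements of order \<open>p\<close> (\<open>mass_layer_one_le\<close>); with \<open>p - 1\<close> such elements, the map \<open>x \<mapsto> x\<^sup>p\<close>
  keeps the remaining elements zero-sum free, and the bounds for \<open>e / p\<close> and for \<open>n\<close> combine
  convexly (\<open>full_level_bound\<close>). There remain \<open>p = 2\<close> and \<open>q = 3\<close>, where too little is gained in
  general and the following prime, which is \<open>5\<close> or \<open>7\<close> in the critical case, has to be examined as well
  (\<open>two_three_bound\<close>).
\<close>

section \<open>Zero-sum free multisets\<close>

locale fin_comm_group = comm_group G for G (structure) +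
  assumes fin: "finite (carrier G)"
begin

definition mprod :: "'a multiset \<Rightarrow> 'a" where
  "mprod M = (\<Otimes>g\<in>carrier G. g [^] count M g)"

definition zsf :: "'a multiset \<Rightarrow> bool" where
  "zsf M \<longleftrightarrow> set_mset M \<subseteq> carrier G \<and> (\<forall>T. T \<subseteq># M \<longrightarrow> T \<noteq> {#} \<longrightarrow> mprod T \<noteq> \<one>)"

definition cr :: "'a multiset \<Rightarrow> real" where
  "cr M = (\<Sum>x\<in>#M. 1 / real (ord x))"

text \<open>
  The \<open>p\<close>-part of the order replaces the order in the cross number, so that \<open>mass p\<close> does not
  change when all elements are raised to a power prime to \<open>p\<close>.
\<close>

definition mass :: "nat \<Rightarrow> 'a multiset \<Rightarrow> real" where
  "mass p M = (\<Sum>x\<in>#M. 1 / real (p ^ multiplicity p (ord x)))"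

lemma ord_pos: "x \<in> carrier G \<Longrightarrow> 0 < ord x"
  using ord_ge_1[OF fin] by force

lemma pow_one_iff: "x \<in> carrier G \<Longrightarrow> x [^] (n::nat) = \<one> \<longleftrightarrow> ord x dvd n"
  using pow_eq_id by blast

lemma mprod_closed [simp]: "mprod M \<in> carrier G"
  unfolding mprod_def by (rule finprod_closed) auto

lemma mprod_empty [simp]: "mprod {#} = \<one>"
  unfolding mprod_def by (rule finprod_one_eqI) auto

lemma mprod_union [simp]: "mprod (M + N) = mprod M \<otimes> mprod N"
proof -
  have "mprod (M + N) = (\<Otimes>g\<in>carrier G. g [^] count M g \<otimes> g [^] count N g)"
    unfolding mprod_def by (rule finprod_cong') (auto simp: nat_pow_mult)
  also have "\<dots> = mprod M \<otimes> mprod N"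
    unfolding mprod_def by (rule finprod_multf) auto
  finally show ?thesis .
qed

lemma mprod_single [simp]: "x \<in> carrier G \<Longrightarrow> mprod {#x#} = x"
proof -
  assume x: "x \<in> carrier G"
  have "mprod {#x#} = (\<Otimes>g\<in>carrier G. if x = g then g else \<one>)"
    unfolding mprod_def by (rule finprod_cong') auto
  also have "\<dots> = x" by (rule finprod_singleton) (use x fin in auto)
  finally show ?thesis .
qed

lemma mprod_add [simp]: "x \<in> carrier G \<Longrightarrow> mprod (add_mset x M) = x \<otimes> mprod M"
  using mprod_union[of "{#x#}" M] by simp

lemma mprod_pow:
  "set_mset M \<subseteq> carrier G \<Longrightarrow> mprod (image_mset (\<lambda>x. x [^] (k::nat)) M) = mprod M [^] k"
  by (induction M) (auto simp: nat_pow_distrib)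

lemma ord_mprod_dvd:
  assumes "set_mset M \<subseteq> carrier G" "\<And>x. x \<in># M \<Longrightarrow> ord x dvd n"
  shows "ord (mprod M) dvd n"
proof -
  have "mprod (image_mset (\<lambda>x. x [^] n) M) = mprod (image_mset (\<lambda>x. \<one>) M)"
    using assms pow_one_iff by (intro arg_cong[where f=mprod] image_mset_cong) auto
  also have "\<dots> = \<one>" by (induction M) auto
  finally show ?thesis using mprod_pow[OF assms(1)] pow_one_iff by simp
qed

lemma cr_simps [simp]: "cr {#} = 0" "cr (M + N) = cr M + cr N" "cr (add_mset x M) = 1 / real (ord x) + cr M"
  by (auto simp: cr_def)

lemma mass_simps [simp]: "mass p {#} = 0" "mass p (M + N) = mass p M + mass p N"
  "mass p (add_mset x M) = 1 / real (p ^ multiplicity p (ord x)) + mass p M"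
  by (auto simp: mass_def)

lemma mass_nonneg: "0 \<le> mass p M"
  by (induction M) auto

lemma mass_mono: "N \<subseteq># M \<Longrightarrow> mass p N \<le> mass p M"
  using mass_nonneg[of p] by (metis add_le_cancel_left add.right_neutral mass_simps(2) mset_subset_eq_exists_conv)

lemma zsf_carrier: "zsf M \<Longrightarrow> set_mset M \<subseteq> carrier G"
  by (simp add: zsf_def)

lemma zsf_sub: "zsf M \<Longrightarrow> N \<subseteq># M \<Longrightarrow> zsf N"
  unfolding zsf_def by (meson set_mset_mono subset_mset.order_trans subset_trans)

lemma zsf_mprod: "zsf M \<Longrightarrow> T \<subseteq># M \<Longrightarrow> T \<noteq> {#} \<Longrightarrow> mprod T \<noteq> \<one>"
  by (simp add: zsf_def)

lemma zsf_ne_one: "zsf M \<Longrightarrow> x \<in># M \<Longrightarrow> x \<noteq> \<one>"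
  using zsf_mprod[of M "{#x#}"] zsf_carrier[of M] by auto

text \<open>
  A subproduct of the merged multiset is a subproduct of the original one: expand \<open>mprod E\<close> back into
  \<open>E\<close> where it is used.
\<close>

lemma zsf_merge:
  assumes z: "zsf (E + R)" and E: "E \<noteq> {#}"
  shows "zsf (add_mset (mprod E) R)"
  unfolding zsf_def
proof (intro conjI allI impI)
  show "set_mset (add_mset (mprod E) R) \<subseteq> carrier G"
    using zsf_carrier[OF z] by simp
  fix T assume T: "T \<subseteq># add_mset (mprod E) R" "T \<noteq> {#}"
  show "mprod T \<noteq> \<one>"
  proof (cases "T \<subseteq># R")
    case True
    then have "T \<subseteq># E + R" by (simp add: subset_mset.add_increasing)
    then show ?thesis using z T(2) zsf_mprod by blast
  next
    case False
    then have "mprod E \<in># T"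
      using T(1) by (metis add_mset_remove_trivial insert_noteq_member
          mset_subset_eq_insertD mset_subset_eq_multiset_union_diff_commute diff_single_trivial subset_eq_diff_conv diff_empty add_mset_add_single)
    then obtain T' where T': "T = add_mset (mprod E) T'" by (metis multi_member_split)
    then have "T' \<subseteq># R" using T(1) by simp
    then have "E + T' \<subseteq># E + R" by simp
    then have "mprod (E + T') \<noteq> \<one>" using z E by (intro zsf_mprod[OF z]) auto
    then show ?thesis using T' by simp
  qed
qed

lemma zsf_pow:
  assumes c: "set_mset M \<subseteq> carrier G"
    and T: "\<And>T. T \<subseteq># M \<Longrightarrow> T \<noteq> {#} \<Longrightarrow> mprod T [^] (k::nat) \<noteq> \<one>"
  shows "zsf (image_mset (\<lambda>x. x [^] k) M)"
  unfolding zsf_def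
proof (intro conjI allI impI)
  show "set_mset (image_mset (\<lambda>x. x [^] k) M) \<subseteq> carrier G" using c by auto
  fix U assume "U \<subseteq># image_mset (\<lambda>x. x [^] k) M" "U \<noteq> {#}"
  then obtain T' where T': "T' \<subseteq># M" "U = image_mset (\<lambda>x. x [^] k) T'"
    by (metis image_mset_eq_plusD mset_subset_eq_add_left subset_mset.add_diff_inverse)
  then show "mprod U \<noteq> \<one>"
    using T[of T'] \<open>U \<noteq> {#}\<close> mprod_pow[of T' k] c by (metis image_mset_is_empty_iff set_mset_mono subset_trans)
qed

end

section \<open>Elements of prime power order\<close>

lemma prime_dvd_freshman:
  fixes a b :: "'r :: comm_ring_1"
  assumes "prime p"
  shows "of_nat p dvd (a + b) ^ p - (a ^ p + b ^ p)"
proof -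
  have p: "p > 0" using assms prime_gt_0_nat by simp
  have "(a + b) ^ p = (\<Sum>k\<le>p. of_nat (p choose k) * a ^ k * b ^ (p - k))"
    by (rule binomial_ring)
  also have "{..p} = insert 0 (insert p {0<..<p})" using p by auto
  also have "(\<Sum>k\<in>insert 0 (insert p {0<..<p}). of_nat (p choose k) * a ^ k * b ^ (p - k)) =
      b ^ p + (a ^ p + (\<Sum>k\<in>{0<..<p}. of_nat (p choose k) * a ^ k * b ^ (p - k)))"
    using p by (subst sum.insert; simp)+
  finally have "(a + b) ^ p - (a ^ p + b ^ p) =
      (\<Sum>k\<in>{0<..<p}. of_nat (p choose k) * a ^ k * b ^ (p - k))" by simp
  also have "of_nat p dvd \<dots>"
  proof (rule dvd_sum)
    fix k assume k: "k \<in> {0<..<p}"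
    then have "p dvd (p choose k)" using assms by (intro dvd_choose_prime) auto
    then obtain m where "p choose k = p * m" by (elim dvdE)
    then show "of_nat p dvd of_nat (p choose k) * a ^ k * b ^ (p - k)" by (simp add: mult.assoc)
  qed
  finally show ?thesis .
qed

lemma dvd_diff_power:
  fixes a b c :: "'r :: comm_ring_1"
  assumes "c dvd a - b"
  shows "c dvd a ^ n - b ^ n"
proof (induction n)
  case (Suc n)
  have "a ^ Suc n - b ^ Suc n = a * (a ^ n - b ^ n) + (a - b) * b ^ n" by (simp add: algebra_simps)
  then show ?case using Suc assms by (metis dvd_add dvd_mult dvd_mult2)
qed auto

text \<open>
  \<open>(x - 1)^(p\<^sup>s) = x^(p\<^sup>s) - 1\<close> modulo \<open>p\<close> in any commutative ring, by iterating the Frobenius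
  congruence. The ring will be that of integer polynomials, so \<open>p\<close> need not be zero in it.
\<close>

lemma prime_dvd_frobenius:
  fixes x :: "'r :: comm_ring_1"
  assumes p: "prime p"
  shows "of_nat p dvd (x - 1) ^ (p ^ s) - (x ^ (p ^ s) - 1)"
proof (induction s)
  case (Suc s)
  let ?y = "x ^ (p ^ s)"
  have 1: "of_nat p dvd ((x - 1) ^ (p ^ s)) ^ p - (?y - 1) ^ p"
    by (rule dvd_diff_power[OF Suc])
  have 2: "of_nat p dvd (?y - 1) ^ p - (?y ^ p + (- 1) ^ p)"
    using prime_dvd_freshman[OF p, of ?y "- 1"] by simp
  have 3: "of_nat p dvd ((- 1) ^ p + 1 :: 'r)"
  proof (cases "p = 2")
    case False
    then have "odd p" using p primes_dvd_imp_eq two_is_prime_nat by blast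
    then show ?thesis by simp
  qed auto
  have "(x - 1) ^ (p ^ Suc s) - (x ^ (p ^ Suc s) - 1) =
     (((x - 1) ^ (p ^ s)) ^ p - (?y - 1) ^ p) + ((?y - 1) ^ p - (?y ^ p + (- 1) ^ p)) + ((- 1) ^ p + 1)"
    by (simp add: power_mult[symmetric] mult.commute)
  then show ?case using 1 2 3 by (simp only: dvd_add)
qed auto

text \<open>
  Polynomials act on functions of \<open>nat\<close> with \<open>X\<close> as the shift \<open>m \<mapsto> m + 1\<close>. A difference
  \<open>F (m + c) - F m\<close> becomes multiplication by \<open>X\<^sup>c - 1\<close>, and iterated differences become products.
\<close>

definition act :: "(nat \<Rightarrow> int) \<Rightarrow> int poly \<Rightarrow> nat \<Rightarrow> int" where
  "act F P m = (\<Sum>k\<le>degree P. coeff P k * F (m + k))"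

lemma act_eq: "degree P \<le> N \<Longrightarrow> act F P m = (\<Sum>k\<le>N. coeff P k * F (m + k))"
  unfolding act_def by (rule sum.mono_neutral_left) (auto simp: coeff_eq_0)

lemma act_add: "act F (P + Q) m = act F P m + act F Q m"
  using act_eq[of P "max (degree P) (degree Q)" F m] act_eq[of Q "max (degree P) (degree Q)" F m]
    act_eq[of "P + Q" "max (degree P) (degree Q)" F m]
  by (simp add: degree_add_le sum.distrib algebra_simps)

lemma act_smult: "act F (smult a P) m = a * act F P m"
  using act_eq[of "smult a P" "degree P" F m]
  by (simp add: act_def degree_smult_le sum_distrib_left algebra_simps)

lemma act_shift: "act F (pCons 0 P) m = act F P (Suc m)"
proof -
  have "act F (pCons 0 P) m = (\<Sum>k\<le>Suc (degree P). coeff (pCons 0 P) k * F (m + k))"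
    by (rule act_eq) (rule degree_pCons_le)
  also have "\<dots> = (\<Sum>k\<le>degree P. coeff P k * F (Suc m + k))"
    by (subst sum.atMost_Suc_shift) simp
  finally show ?thesis by (simp add: act_def)
qed

lemma act_monom: "act F (P * monom 1 c) m = act F P (m + c)"
proof (induction c arbitrary: m)
  case 0
  then show ?case by (simp add: monom_0)
next
  case (Suc c)
  have "P * monom 1 (Suc c) = pCons 0 (P * monom 1 c)" by (simp add: monom_Suc)
  then show ?case using Suc by (simp add: act_shift)
qed

lemma act_diff: "act F (P - Q) m = act F P m - act F Q m"
  using act_add[of F "P - Q" Q m] by simp

lemma act_one: "act F 1 m = F m"
  by (simp add: act_def)

text \<open>
  For a fixed \<open>F\<close> these polynomials form an ideal containing \<open>p\<close>.
\<close>

definition kills :: "nat \<Rightarrow> (nat \<Rightarrow> int) \<Rightarrow> int poly \<Rightarrow> bool" where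
  "kills p F P \<longleftrightarrow> (\<forall>m. int p dvd act F P m)"

lemma kills_add: "kills p F P \<Longrightarrow> kills p F Q \<Longrightarrow> kills p F (P + Q)"
  by (simp add: kills_def act_add)

lemma kills_mult: "kills p F P \<Longrightarrow> kills p F (Q * P)"
proof (induction Q)
  case 0
  then show ?case by (simp add: kills_def act_def)
next
  case (pCons a Q)
  have "pCons a Q * P = smult a P + pCons 0 (Q * P)" by simp
  then show ?case using pCons by (auto simp: kills_def act_add act_smult act_shift)
qed

lemma kills_of_nat: "kills p F (of_nat p * P)"
proof -
  have "of_nat p * P = smult (int p) P" by (simp add: of_nat_poly)
  then show ?thesis by (simp add: kills_def act_smult)
qed

lemma dvd_if_mod_double: "n mod q = (n + n) mod q \<Longrightarrow> q dvd (n::nat)"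
  using mod_eq_dvd_iff_nat[of n "n + n" q] by simp

text \<open>
  \<open>X^c - 1\<close> is a multiple of \<open>X^(p\<^sup>s) - 1\<close>, which is \<open>(X - 1)^(p\<^sup>s)\<close> modulo \<open>p\<close>.
\<close>

lemma monom_minus_one_factor:
  assumes "prime p" "p ^ s dvd c"
  shows "\<exists>Q R. monom (1::int) c - 1 = (monom 1 1 - 1) ^ (p ^ s) * Q + of_nat p * R"
proof -
  obtain u where u: "c = p ^ s * u" using assms(2) by (elim dvdE)
  let ?X = "monom (1::int) 1"
  have X: "monom (1::int) k = ?X ^ k" for k
    by (simp add: monom_power)
  have 1: "monom (1::int) c = (?X ^ (p ^ s)) ^ u"
    unfolding u X[of "p ^ s * u"] power_mult ..
  have 2: "(?X ^ (p ^ s)) ^ u - 1 = (?X ^ (p ^ s) - 1) * (\<Sum>i<u. (?X ^ (p ^ s)) ^ i)"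
    by (rule power_diff_1_eq)
  define W where "W = (\<Sum>i<u. (?X ^ (p ^ s)) ^ i)"
  obtain R where "(?X - 1) ^ (p ^ s) - (?X ^ (p ^ s) - 1) = of_nat p * R"
    using prime_dvd_frobenius[OF assms(1), of ?X s] by (elim dvdE)
  then have 3: "?X ^ (p ^ s) - 1 = (?X - 1) ^ (p ^ s) - of_nat p * R" by (simp only: diff_eq_eq eq_diff_eq add.commute)
  have "monom (1::int) c - 1 = ((?X - 1) ^ (p ^ s) - of_nat p * R) * W"
    unfolding 1 2 3 W_def ..
  also have "\<dots> = (?X - 1) ^ (p ^ s) * W + of_nat p * (- R * W)"
  proof -
    have "(a - b * r) * w = a * w + b * (- r * w)" for a b r w :: "int poly"
      by (simp add: algebra_simps)
    then show ?thesis .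
  qed
  finally have "monom (1::int) c - 1 = (?X - 1) ^ (p ^ s) * W + of_nat p * (- R * W)" .
  then show ?thesis by blast
qed

context fin_comm_group begin

text \<open>
  Iterated differences along the elements of a list, in multiplicative notation.
\<close>

fun diffs :: "'a list \<Rightarrow> ('a \<Rightarrow> int) \<Rightarrow> 'a \<Rightarrow> int" where
  "diffs [] f = f"
| "diffs (g # gs) f = diffs gs (\<lambda>x. f (x \<otimes> g) - f x)"

lemma diffs_append: "diffs (gs @ hs) f = diffs hs (diffs gs f)"
  by (induction gs arbitrary: f) auto

lemma diffs_cong:
  assumes "set gs \<subseteq> carrier G" "\<And>x. x \<in> carrier G \<Longrightarrow> f x = h x" "x \<in> carrier G"
  shows "diffs gs f x = diffs gs h x"
  using assms
proof (induction gs arbitrary: f h)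
  case (Cons g gs)
  show ?case unfolding diffs.simps by (rule Cons.IH) (use Cons.prems in auto)
qed auto

lemma diffs_add: "diffs gs (\<lambda>x. f x + h x) x = diffs gs f x + diffs gs h x"
proof (induction gs arbitrary: f h)
  case (Cons g gs)
  have "(\<lambda>x. f (x \<otimes> g) + h (x \<otimes> g) - (f x + h x)) =
      (\<lambda>x. (f (x \<otimes> g) - f x) + (h (x \<otimes> g) - h x))" by auto
  then show ?case using Cons by simp
qed auto

definition p_list :: "nat \<Rightarrow> 'a list \<Rightarrow> bool" where
  "p_list p gs \<longleftrightarrow> (\<forall>g\<in>set gs. g \<in> carrier G \<and> (\<exists>k. ord g = p ^ k))"

text \<open>
  A weighted version of polynomial degree modulo \<open>p\<close>: each difference along \<open>g\<close> lowers the degree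
  not by \<open>1\<close> but by \<open>1 / ord g\<close>.
\<close>

definition deg_le :: "nat \<Rightarrow> ('a \<Rightarrow> int) \<Rightarrow> real \<Rightarrow> bool" where
  "deg_le p f d \<longleftrightarrow> (\<forall>gs x. p_list p gs \<longrightarrow> cr (mset gs) > d \<longrightarrow> x \<in> carrier G \<longrightarrow> int p dvd diffs gs f x)"

text \<open>
  Leibniz rule: a difference of \<open>f h\<close> is \<open>(\<Delta>f) h + f (\<Delta>h) + (\<Delta>f) (\<Delta>h)\<close>, so after all
  differences are taken, each term has its differences distributed over the two factors, and one of
  the factors has received more than its degree. The lists \<open>as\<close> and \<open>bs\<close> collect those already
  assigned to \<open>f\<close> and to \<open>h\<close>.
\<close>

lemma deg_le_mult_aux:
  assumes f: "deg_le p f d" and h: "deg_le p h e"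
  shows "p_list p gs \<Longrightarrow> p_list p as \<Longrightarrow> p_list p bs \<Longrightarrow>
    cr (mset as) + cr (mset bs) + cr (mset gs) > d + e \<Longrightarrow> x \<in> carrier G \<Longrightarrow>
    int p dvd diffs gs (\<lambda>x. diffs as f x * diffs bs h x) x"
proof (induction gs arbitrary: as bs)
  case Nil
  then consider "cr (mset as) > d" | "cr (mset bs) > e" by (auto simp: not_less) argo
  then show ?case
  proof cases
    case 1
    then show ?thesis using f Nil unfolding deg_le_def by auto
  next
    case 2
    then show ?thesis using h Nil unfolding deg_le_def by auto
  qed
next
  case (Cons g gs)
  have e: "diffs (as @ [g]) f y = diffs as f (y \<otimes> g) - diffs as f y"
    "diffs (bs @ [g]) h y = diffs bs h (y \<otimes> g) - diffs bs h y" for y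
    by (simp_all add: diffs_append)
  have eq: "(\<lambda>y. diffs as f (y \<otimes> g) * diffs bs h (y \<otimes> g) - diffs as f y * diffs bs h y) =
    (\<lambda>y. diffs (as @ [g]) f y * diffs bs h y +
      (diffs as f y * diffs (bs @ [g]) h y + diffs (as @ [g]) f y * diffs (bs @ [g]) h y))"
    by (rule ext) (simp only: e, simp add: algebra_simps)
  have p: "p_list p gs" "p_list p (as @ [g])" "p_list p (bs @ [g])"
    using Cons.prems by (auto simp: p_list_def)
  have nn: "1 / real (ord g) \<ge> 0" by simp
  have "int p dvd diffs gs (\<lambda>x. diffs (as @ [g]) f x * diffs bs h x) x"
    by (rule Cons.IH) (use Cons.prems p in auto)
  moreover have "int p dvd diffs gs (\<lambda>x. diffs as f x * diffs (bs @ [g]) h x) x"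
    by (rule Cons.IH) (use Cons.prems p in auto)
  moreover have "int p dvd diffs gs (\<lambda>x. diffs (as @ [g]) f x * diffs (bs @ [g]) h x) x"
  proof (rule Cons.IH)
    show "d + e < cr (mset (as @ [g])) + cr (mset (bs @ [g])) + cr (mset gs)"
    proof -
      have "cr (mset (as @ [g])) + cr (mset (bs @ [g])) + cr (mset gs) =
          cr (mset as) + cr (mset bs) + cr (mset (g # gs)) + 1 / real (ord g)" by simp
      then show ?thesis using Cons.prems(4) nn by linarith
    qed
  qed (use Cons.prems p in auto)
  ultimately show ?case
    by (simp only: diffs.simps eq diffs_add dvd_add)
qed

lemma deg_le_mult:
  assumes "deg_le p f d" "deg_le p h e"
  shows "deg_le p (\<lambda>x. f x * h x) (d + e)"
  unfolding deg_le_def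
  using deg_le_mult_aux[OF assms, of _ "[]" "[]"] by (auto simp: p_list_def)

lemma deg_le_one: "deg_le p (\<lambda>x. 1) 0"
proof -
  have z: "diffs gs (\<lambda>x. 0) x = 0" for gs x by (induction gs) auto
  have "int p dvd diffs gs (\<lambda>x. 1) x" if "cr (mset gs) > 0" for gs x
    using that by (cases gs) (auto simp: z)
  then show ?thesis unfolding deg_le_def by blast
qed

lemma deg_le_prod:
  assumes "finite J" "\<And>j. j \<in> J \<Longrightarrow> deg_le p (f j) (d j)"
  shows "deg_le p (\<lambda>x. \<Prod>j\<in>J. f j x) (\<Sum>j\<in>J. d j)"
  using assms
proof (induction J)
  case empty
  then show ?case using deg_le_one by simp
next
  case (insert j J)
  then show ?case using deg_le_mult[of p "f j" "d j"] by simp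
qed

text \<open>
  Expanding the iterated difference gives a signed sum of values \<open>f (x \<otimes> mprod T)\<close>; all terms with
  \<open>T\<close> nonempty vanish.
\<close>

lemma diffs_zsf:
  assumes "set gs \<subseteq> carrier G" "x \<in> carrier G"
    and "\<And>T. T \<subseteq># mset gs \<Longrightarrow> T \<noteq> {#} \<Longrightarrow> f (x \<otimes> mprod T) = 0"
  shows "diffs gs f x = (- 1) ^ length gs * f x"
  using assms
proof (induction gs arbitrary: f)
  case (Cons g gs)
  have "f (x \<otimes> g) = 0" using Cons.prems(3)[of "{#g#}"] Cons.prems(1) by simp
  moreover have "diffs gs (\<lambda>y. f (y \<otimes> g) - f y) x = (- 1) ^ length gs * (f (x \<otimes> g) - f x)"
  proof (rule Cons.IH)
    fix T assume T: "T \<subseteq># mset gs" "T \<noteq> {#}"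
    have 1: "f (x \<otimes> mprod (add_mset g T)) = 0"
      by (rule Cons.prems(3)) (use T in auto)
    have 2: "f (x \<otimes> mprod T) = 0"
      by (rule Cons.prems(3)) (use T in \<open>auto intro: subset_mset.order_trans\<close>)
    have "x \<otimes> mprod T \<otimes> g = x \<otimes> mprod (add_mset g T)"
      using Cons.prems(1,2) by (simp add: m_ac)
    then show "f (x \<otimes> mprod T \<otimes> g) - f (x \<otimes> mprod T) = 0" using 1 2 by simp
  qed (use Cons.prems in auto)
  ultimately show ?case by simp
qed auto

lemma diffs_act:
  assumes per: "\<And>m m'. m mod q = m' mod q \<Longrightarrow> F m = F m'"
    and hom: "\<And>x y. x \<in> carrier G \<Longrightarrow> y \<in> carrier G \<Longrightarrow> \<pi> (x \<otimes> y) mod q = (\<pi> x + \<pi> y) mod (q::nat)"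
    and "set gs \<subseteq> carrier G" "x \<in> carrier G"
  shows "diffs gs (\<lambda>x. act F P (\<pi> x)) x = act F (P * (\<Prod>g\<leftarrow>gs. monom 1 (\<pi> g) - 1)) (\<pi> x)"
  using assms(3,4)
proof (induction gs arbitrary: P)
  case (Cons g gs)
  have per': "act F P m = act F P m'" if "m mod q = m' mod q" for m m'
  proof -
    have "F (m + k) = F (m' + k)" for k
      by (rule per, rule mod_add_cong[OF that refl])
    then show ?thesis by (simp add: act_def)
  qed
  have "act F P (\<pi> (y \<otimes> g)) - act F P (\<pi> y) = act F (P * (monom 1 (\<pi> g) - 1)) (\<pi> y)"
    if "y \<in> carrier G" for y
  proof -
    have "act F P (\<pi> (y \<otimes> g)) = act F P (\<pi> y + \<pi> g)"
      by (rule per', rule hom) (use that Cons.prems in auto)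
    then show ?thesis by (simp add: right_diff_distrib act_diff act_monom)
  qed
  then have "diffs (g # gs) (\<lambda>x. act F P (\<pi> x)) x =
      diffs gs (\<lambda>x. act F (P * (monom 1 (\<pi> g) - 1)) (\<pi> x)) x"
    unfolding diffs.simps using Cons.prems by (intro diffs_cong) auto
  also have "\<dots> = act F (P * (monom 1 (\<pi> g) - 1) * (\<Prod>g\<leftarrow>gs. monom 1 (\<pi> g) - 1)) (\<pi> x)"
    by (rule Cons.IH) (use Cons.prems in auto)
  finally show ?case by (simp only: list.map prod_list.Cons mult.assoc)
qed simp

text \<open>
  As a polynomial operator, the difference along \<open>g\<close> of order \<open>p\<^sup>k\<close> is divisible by
  \<open>(X - 1)^(p^(a - k))\<close> modulo \<open>p\<close>, because \<open>p^(a - k)\<close> divides the coordinate of \<open>g\<close>; and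
  \<open>p^(a - k) \<ge> p\<^sup>a / ord g\<close>. Cross number above \<open>1 - p\<^sup>-\<^sup>a\<close> thus forces a factor
  \<open>(X - 1)^(p\<^sup>a) = X^(p\<^sup>a) - 1\<close>, which kills functions of period \<open>p\<^sup>a\<close>.
\<close>

lemma deg_le_coordinate:
  assumes p: "prime p"
    and hom: "\<And>x y. x \<in> carrier G \<Longrightarrow> y \<in> carrier G \<Longrightarrow>
        \<pi> (x \<otimes> y) mod p ^ a = (\<pi> x + \<pi> y) mod p ^ a"
  shows "deg_le p (\<lambda>x. of_bool (p ^ a dvd \<pi> x)) (1 - 1 / real (p ^ a))"
  unfolding deg_le_def
proof (intro allI impI)
  fix gs x assume gs: "p_list p gs" and c: "cr (mset gs) > 1 - 1 / real (p ^ a)" and x: "x \<in> carrier G"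
  define F :: "nat \<Rightarrow> int" where "F m = of_bool (p ^ a dvd m)" for m
  have p0: "p > 0" using p prime_gt_0_nat by simp
  have per: "F m = F m'" if "m mod p ^ a = m' mod p ^ a" for m m'
    using that by (simp add: F_def mod_eq_0_iff_dvd[symmetric])
  let ?X = "monom (1::int) 1"
  have one: "p ^ a dvd \<pi> \<one>"
    using hom[OF one_closed one_closed] by (intro dvd_if_mod_double) (simp only: l_one one_closed)
  have pw: "\<pi> (g [^] n) mod p ^ a = n * \<pi> g mod p ^ a" if "g \<in> carrier G" for g and n :: nat
  proof (induction n)
    case 0
    then show ?case using one by simp
  next
    case (Suc n)
    have "\<pi> (g [^] Suc n) mod p ^ a = (\<pi> (g [^] n) + \<pi> g) mod p ^ a" using hom that by simp
    also have "\<dots> = (n * \<pi> g + \<pi> g) mod p ^ a" using Suc by (metis mod_add_left_eq)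
    finally show ?case by (simp add: add.commute)
  qed
  (* N adds up the exponents p^(a - k) of X - 1; as p^(a - k) is at least p^a / ord g, it dominates p^a times the cross number *)
  have fac: "\<exists>N Q R. (\<Prod>g\<leftarrow>gs. monom 1 (\<pi> g) - 1) = (?X - 1) ^ N * Q + of_nat p * R \<and>
      real N \<ge> real (p ^ a) * cr (mset gs)"
    using gs
  proof (induction gs)
    case Nil
    show ?case by (rule exI[of _ 0], rule exI[of _ 1], rule exI[of _ 0]) auto
  next
    case (Cons g gs)
    then obtain k where g: "g \<in> carrier G" "ord g = p ^ k" by (auto simp: p_list_def)
    have "p ^ k * \<pi> g mod p ^ a = \<pi> \<one> mod p ^ a"
      using pw[OF g(1), of "ord g"] unfolding pow_ord_eq_1[OF g(1)] unfolding g(2) by (rule sym)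
    then have "p ^ a dvd p ^ k * \<pi> g"
      using one dvd_eq_mod_eq_0 by metis
    then have "p ^ (a - k) dvd \<pi> g"
    proof (cases "k \<le> a")
      case True
      then have "p ^ a = p ^ k * p ^ (a - k)" by (simp add: power_add[symmetric])
      then show ?thesis using \<open>p ^ a dvd p ^ k * \<pi> g\<close> p0 by simp
    qed auto
    then obtain Q R where QR: "monom (1::int) (\<pi> g) - 1 = (?X - 1) ^ (p ^ (a - k)) * Q + of_nat p * R"
      using monom_minus_one_factor[OF p] by blast
    have w: "real (p ^ (a - k)) \<ge> real (p ^ a) * (1 / real (ord g))"
    proof -
      have "p ^ a \<le> p ^ (a - k) * p ^ k"
        unfolding power_add[symmetric] using p0 by (intro power_increasing) auto
      then have "real (p ^ a) \<le> real (p ^ (a - k)) * real (p ^ k)" by (metis of_nat_le_iff of_nat_mult)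
      moreover have "real (p ^ k) > 0" using p0 by simp
      ultimately have "real (p ^ a) / real (p ^ k) \<le> real (p ^ (a - k))"
        by (simp only: pos_divide_le_eq)
      then show ?thesis unfolding g(2) by (simp only: times_divide_eq_right mult_1_right)
    qed
    obtain N Q' R' where IH: "(\<Prod>g\<leftarrow>gs. monom 1 (\<pi> g) - 1) = (?X - 1) ^ N * Q' + of_nat p * R'"
      "real N \<ge> real (p ^ a) * cr (mset gs)"
      using Cons by (auto simp: p_list_def)
    have "(\<Prod>g\<leftarrow>g # gs. monom 1 (\<pi> g) - 1) =
        (?X - 1) ^ (p ^ (a - k) + N) * (Q * Q')
        + of_nat p * (R * ((?X - 1) ^ N * Q' + of_nat p * R') + (?X - 1) ^ (p ^ (a - k)) * Q * R')"
    proof -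
      have "(A * Q + b * R) * (B * Q' + b * R') = A * B * (Q * Q') + b * (R * (B * Q' + b * R') + A * Q * R')"
        for A B b :: "int poly" by (simp add: algebra_simps)
      then show ?thesis by (simp only: list.map prod_list.Cons IH(1) QR power_add)
    qed
    moreover have "real (p ^ (a - k) + N) \<ge> real (p ^ a) * cr (mset (g # gs))"
      using w IH(2) by (simp add: distrib_left del: of_nat_power)
    ultimately show ?case by blast
  qed
  then obtain N Q R where NQR: "(\<Prod>g\<leftarrow>gs. monom 1 (\<pi> g) - 1) = (?X - 1) ^ N * Q + of_nat p * R"
    and N: "real N \<ge> real (p ^ a) * cr (mset gs)" by blast
  have "real (p ^ a) * cr (mset gs) > real (p ^ a) * (1 - 1 / real (p ^ a))"
    using c p0 by (intro mult_strict_left_mono) auto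
  moreover have "real (p ^ a) * (1 - 1 / real (p ^ a)) = real (p ^ a) - 1"
    using p0 by (simp add: field_simps)
  ultimately have "real N > real (p ^ a) - 1" using N by linarith
  then have Np: "N \<ge> p ^ a" by linarith
  obtain R' where R': "(?X - 1) ^ (p ^ a) - (?X ^ (p ^ a) - 1) = of_nat p * R'"
    using prime_dvd_frobenius[OF p, of ?X a] by (elim dvdE)
  have k1: "kills p F (monom 1 (p ^ a) - 1)"
  proof -
    have "act F (monom 1 (p ^ a) - 1) m = F (m + p ^ a) - F m" for m
      using act_monom[of F 1 "p ^ a" m] act_diff[of F "monom 1 (p ^ a)" 1 m] by (simp only: mult_1_left act_one)
    moreover have "F (m + p ^ a) = F m" for m by (rule per) simp
    ultimately show ?thesis unfolding kills_def by (simp only: diff_self dvd_0_right simp_thms)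
  qed
  have "(?X - 1) ^ (p ^ a) = (monom 1 (p ^ a) - 1) + of_nat p * R'"
  proof -
    have "u = v + w" if "u - v = w" for u v w :: "int poly" using that by (simp add: algebra_simps)
    moreover have "?X ^ (p ^ a) = monom 1 (p ^ a)" by (simp add: monom_power)
    ultimately show ?thesis using R' by metis
  qed
  then have k2: "kills p F ((?X - 1) ^ (p ^ a))" using kills_add[OF k1 kills_of_nat] by simp
  have "(?X - 1) ^ N * Q = ((?X - 1) ^ (N - p ^ a) * Q) * (?X - 1) ^ (p ^ a)"
  proof -
    have "(?X - 1) ^ N = (?X - 1) ^ (N - p ^ a) * (?X - 1) ^ (p ^ a)"
      unfolding power_add[symmetric] using Np by (intro arg_cong[where f="\<lambda>n. (?X - 1) ^ n"]) simp
    then show ?thesis by (simp only: mult.assoc mult.commute mult.left_commute)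
  qed
  then have "kills p F ((?X - 1) ^ N * Q)" using kills_mult[OF k2] by metis
  then have "kills p F (\<Prod>g\<leftarrow>gs. monom 1 (\<pi> g) - 1)"
    unfolding NQR by (intro kills_add kills_of_nat)
  then have "int p dvd act F (1 * (\<Prod>g\<leftarrow>gs. monom 1 (\<pi> g) - 1)) (\<pi> x)"
    by (simp add: kills_def)
  also have "act F (1 * (\<Prod>g\<leftarrow>gs. monom 1 (\<pi> g) - 1)) (\<pi> x) = diffs gs (\<lambda>x. act F 1 (\<pi> x)) x"
    by (rule diffs_act[symmetric, OF per hom]) (use gs x in \<open>auto simp: p_list_def\<close>)
  also have "(\<lambda>x. act F 1 (\<pi> x)) = (\<lambda>x. of_bool (p ^ a dvd \<pi> x))"
    by (auto simp: act_one F_def)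
  finally show "int p dvd diffs gs (\<lambda>x. of_bool (p ^ a dvd \<pi> x)) x" .
qed

text \<open>
  The indicator of the neutral element is the product over \<open>j\<close> of the indicators of \<open>p ^ a j\<close>
  dividing the coordinate \<open>\<pi> j\<close>; its degree is at most the sum of theirs. If \<open>cr M\<close> were larger,
  the difference along \<open>M\<close> at the neutral element would be divisible by \<open>p\<close>, but it is \<open>\<plusminus>1\<close>
  when \<open>M\<close> is zero-sum free.
\<close>

theorem cross_number_p_group_le:
  assumes p: "prime p" and J: "finite J"
    and hom: "\<And>j x y. j \<in> J \<Longrightarrow> x \<in> carrier G \<Longrightarrow> y \<in> carrier G \<Longrightarrow>
        \<pi> j (x \<otimes> y) mod p ^ a j = (\<pi> j x + \<pi> j y) mod p ^ a j"
    and inj: "\<And>x k. x \<in> carrier G \<Longrightarrow> ord x = p ^ k \<Longrightarrow> (\<And>j. j \<in> J \<Longrightarrow> p ^ a j dvd \<pi> j x) \<Longrightarrow> x = \<one>"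
    and M: "zsf M" "\<And>x. x \<in># M \<Longrightarrow> \<exists>k. ord x = p ^ k"
  shows "cr M \<le> (\<Sum>j\<in>J. 1 - 1 / real (p ^ a j))"
proof (rule ccontr)
  assume "\<not> ?thesis"
  then have gt: "cr M > (\<Sum>j\<in>J. 1 - 1 / real (p ^ a j))" by simp
  define f :: "'a \<Rightarrow> int" where "f x = (\<Prod>j\<in>J. of_bool (p ^ a j dvd \<pi> j x))" for x
  have deg: "deg_le p f (\<Sum>j\<in>J. 1 - 1 / real (p ^ a j))"
    unfolding f_def using J p hom by (intro deg_le_prod deg_le_coordinate) auto
  obtain gs where gs: "mset gs = M" using ex_mset by blast
  have c: "set gs \<subseteq> carrier G" using zsf_carrier[OF M(1)] gs by auto
  have pl: "p_list p gs" using c M(2) gs by (auto simp: p_list_def)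
  have div: "int p dvd diffs gs f \<one>" using deg pl gt gs unfolding deg_le_def by auto
  have one: "f \<one> = 1"
  proof -
    have "p ^ a j dvd \<pi> j \<one>" if "j \<in> J" for j
      using hom[OF that one_closed one_closed] by (intro dvd_if_mod_double) (simp only: l_one one_closed)
    then show ?thesis by (simp add: f_def)
  qed
  have "diffs gs f \<one> = (- 1) ^ length gs * f \<one>"
  proof (rule diffs_zsf[OF c])
    fix T assume T: "T \<subseteq># mset gs" "T \<noteq> {#}"
    have ne: "mprod T \<noteq> \<one>" using zsf_mprod[OF M(1)] T gs by simp
    have "\<exists>k. \<forall>x\<in>#M. ord x dvd p ^ k"
    proof -
      obtain k where k: "\<And>x. x \<in># M \<Longrightarrow> ord x = p ^ k x" using M(2) by metis
      have "ord x dvd p ^ Max (k ` set_mset M)" if "x \<in># M" for x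
        using k[OF that] that by (simp add: le_imp_power_dvd)
      then show ?thesis by blast
    qed
    then obtain k where k: "\<And>x. x \<in># M \<Longrightarrow> ord x dvd p ^ k" by blast
    have "\<And>x. x \<in># T \<Longrightarrow> x \<in># M" using T gs by (auto dest: mset_subset_eqD)
    then have "ord (mprod T) dvd p ^ k"
      using k zsf_carrier[OF M(1)] by (intro ord_mprod_dvd) auto
    then obtain k' where "ord (mprod T) = p ^ k'" using p divides_primepow_nat by blast
    then have "\<exists>j\<in>J. \<not> p ^ a j dvd \<pi> j (mprod T)" using inj ne mprod_closed by blast
    then show "f (\<one> \<otimes> mprod T) = 0" using J by (auto simp: f_def)
  qed auto
  then have "int p dvd (- 1) ^ length gs" using div one by simp
  then have "int p dvd 1" by (metis dvd_mult_right minus_one_mult_self dvd_mult)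
  then show False using p by (metis int_dvd_int_iff nat_dvd_1_iff_1 not_prime_1 of_nat_1)
qed

end

section \<open>Extracting blocks whose products have order prime to p\<close>

lemma multiplicity_power_times:
  fixes p m :: nat
  shows "prime p \<Longrightarrow> \<not> p dvd m \<Longrightarrow> multiplicity p (p ^ j * m) = j"
  by (rule multiplicity_eqI) (auto simp: power_Suc2 prime_gt_0_nat simp del: power_Suc)

lemma multiplicity_le_if_dvd:
  fixes p m x :: nat
  assumes "prime p" "\<not> p dvd m" "x dvd p ^ a * m" "m > 0"
  shows "multiplicity p x \<le> a"
  using dvd_imp_multiplicity_le[OF assms(3), of p] multiplicity_power_times[OF assms(1,2), of a] assms
  by (simp add: prime_gt_0_nat)

context fin_comm_group begin

text \<open>
  \<open>Red X R Q\<close>: disjoint nonempty blocks have been cut out of \<open>X\<close>, leaving \<open>R\<close>, and \<open>Q\<close> is the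
  multiset of their products.
\<close>

inductive Red :: "'a multiset \<Rightarrow> 'a multiset \<Rightarrow> 'a multiset \<Rightarrow> bool" where
  Red_refl: "Red X X {#}"
| Red_step: "Red X (E + R) Q \<Longrightarrow> E \<noteq> {#} \<Longrightarrow> Red X R (add_mset (mprod E) Q)"

lemma Red_zsf: "Red X R Q \<Longrightarrow> zsf (X + Y) \<Longrightarrow> zsf (R + Q + Y)"
proof (induction rule: Red.induct)
  case (Red_step X E R Q)
  then have "zsf (E + (R + Q + Y))" by (simp add: add.assoc)
  then have "zsf (add_mset (mprod E) (R + Q + Y))" using Red_step.hyps(2) by (rule zsf_merge)
  then show ?case by simp
qed simp

lemma Red_add: "Red X R Q \<Longrightarrow> Red (X + Z) (R + Z) Q"
proof (induction rule: Red.induct)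
  case (Red_refl X)
  show ?case by (rule Red.Red_refl)
next
  case (Red_step X E R Q)
  have "Red (X + Z) (E + (R + Z)) Q" using Red_step.IH by (simp add: add.assoc)
  then show ?case using Red_step.hyps(2) by (rule Red.Red_step)
qed

lemma Red_trans: "Red R R' Q' \<Longrightarrow> Red X R Q \<Longrightarrow> Red X R' (Q + Q')"
proof (induction rule: Red.induct)
  case (Red_step Y E R' Q')
  have "Red X R' (add_mset (mprod E) (Q + Q'))"
    by (rule Red.Red_step[OF Red_step.IH[OF Red_step.prems] Red_step.hyps(2)])
  then show ?case by simp
qed simp

lemma Red_union:
  assumes "Red X R Q" "Red X' R' Q'"
  shows "Red (X + X') (R + R') (Q + Q')"
proof -
  have 1: "Red (X + X') (R + X') Q" by (rule Red_add[OF assms(1)])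
  have "Red (X' + R) (R' + R) Q'" by (rule Red_add[OF assms(2)])
  then have "Red (R + X') (R + R') Q'" by (simp add: add.commute)
  then show ?thesis using 1 by (rule Red_trans)
qed

lemma Red_subset: "Red X R Q \<Longrightarrow> R \<subseteq># X"
proof (induction rule: Red.induct)
  case (Red_step X E R Q)
  then show ?case by (metis mset_subset_eq_add_right subset_mset.order_trans)
qed simp

text \<open>
  The consequence of cyclicity of the \<open>p\<close>-component on which the extraction of blocks rests.
\<close>

definition thin :: "nat \<Rightarrow> bool" where
  "thin p \<longleftrightarrow> (\<forall>M. zsf M \<longrightarrow> (\<forall>x\<in>#M. \<exists>k. ord x = p ^ k) \<longrightarrow> cr M < 1)"

lemma mass_integral:
  assumes "p > 0" "\<And>x. x \<in># X \<Longrightarrow> multiplicity p (ord x) \<le> a"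
  shows "\<exists>N::nat. mass p X * real (p ^ a) = real N"
  using assms(2)
proof (induction X)
  case empty
  show ?case by (rule exI[of _ 0]) simp
next
  case (add x X)
  then obtain N where N: "mass p X * real (p ^ a) = real N" by auto
  let ?j = "multiplicity p (ord x)"
  have "?j \<le> a" using add.prems by simp
  then have "p ^ a = p ^ (a - ?j) * p ^ ?j" by (simp add: power_add[symmetric])
  then have "1 / real (p ^ ?j) * real (p ^ a) = real (p ^ (a - ?j))"
    using assms(1) by simp
  then have "mass p (add_mset x X) * real (p ^ a) = real (p ^ (a - ?j) + N)"
    using N by (simp add: distrib_right del: of_nat_power)
  then show ?case by blast
qed

text \<open>
  The mass is a multiple of \<open>p\<^sup>-\<^sup>a\<close>.
\<close>

lemma mass_lt_one_le:
  assumes "p > 0" "\<And>x. x \<in># X \<Longrightarrow> multiplicity p (ord x) \<le> a" "mass p X < 1"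
  shows "mass p X \<le> 1 - 1 / real (p ^ a)"
proof -
  obtain N where N: "mass p X * real (p ^ a) = real N" using mass_integral[OF assms(1,2)] by blast
  have pa: "real (p ^ a) > 0" using assms(1) by simp
  have "real N < real (p ^ a)" using N assms(3) pa by (metis mult_1 mult_strict_right_mono)
  then have "N + 1 \<le> p ^ a" unfolding of_nat_less_iff by simp
  then have "real (N + 1) \<le> real (p ^ a)" by (simp only: of_nat_le_iff)
  then have "real N \<le> real (p ^ a) - 1" by linarith
  then have "mass p X * real (p ^ a) \<le> (1 - 1 / real (p ^ a)) * real (p ^ a)"
  proof -
    have "(1 - 1 / c) * c = c - 1" if "c > 0" for c :: real using that by (simp add: left_diff_distrib)
    then show ?thesis using N pa \<open>real N \<le> real (p ^ a) - 1\<close> by metis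
  qed
  then show ?thesis using pa by (rule mult_right_le_imp_le)
qed

text \<open>
  Raising to the power \<open>n\<close> kills exactly the part of the order prime to \<open>p\<close>.
\<close>

lemma ord_pow_cofactor:
  assumes p: "prime p" and x: "x \<in> carrier G" and n: "ord x dvd p ^ m * n" "\<not> p dvd n"
  shows "ord (x [^] n) = p ^ multiplicity p (ord x)"
proof -
  let ?v = "multiplicity p (ord x)"
  obtain d where d: "ord x = p ^ ?v * d" "\<not> p dvd d"
    using multiplicity_decompose'[of "ord x" p] ord_pos[OF x] p not_prime_1
    by (metis (no_types, lifting) less_numeral_extra(3) nat_dvd_1_iff_1)
  have cop: "coprime d (p ^ k)" for k
    using d(2) p by (meson coprime_commute coprime_power_left_iff prime_imp_coprime)
  have "d dvd p ^ m * n" using n(1) d(1) by (metis dvd_mult_right)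
  then have dn: "d dvd n" using cop by (simp add: coprime_dvd_mult_right_iff)
  have "ord (x [^] n) dvd p ^ ?v"
  proof -
    have "(x [^] n) [^] (p ^ ?v) = x [^] (n * p ^ ?v)" using x by (simp add: nat_pow_pow)
    moreover have "ord x dvd n * p ^ ?v" using d(1) dn by (metis mult.commute mult_dvd_mono dvd_refl)
    ultimately show ?thesis using x pow_one_iff by (metis nat_pow_closed)
  qed
  moreover have "p ^ ?v dvd ord (x [^] n)"
  proof -
    have "x [^] (n * ord (x [^] n)) = \<one>" using x by (metis nat_pow_pow pow_ord_eq_1 nat_pow_closed)
    then have "ord x dvd n * ord (x [^] n)" using x pow_one_iff by blast
    then have "p ^ ?v dvd n * ord (x [^] n)" using d(1) by (metis dvd_mult_left)
    moreover have "coprime (p ^ ?v) n"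
      using n(2) p by (simp add: coprime_power_left_iff prime_imp_coprime)
    ultimately show ?thesis by (simp add: coprime_dvd_mult_right_iff)
  qed
  ultimately show ?thesis by (rule dvd_antisym)
qed

text \<open>
  Take a minimal \<open>Y \<subseteq># X\<close> with mass at least \<open>1\<close>. Then its mass is exactly \<open>1\<close>: removing an element of
  largest \<open>p\<close>-part \<open>p\<^sup>k\<close> leaves less than \<open>1\<close>, and everything is a multiple of \<open>p\<^sup>-\<^sup>k\<close>. The power map
  by the \<open>p\<close>-free part of the group order turns \<open>Y\<close> into elements of \<open>p\<close>-power order with cross
  number \<open>1\<close>, which are not zero-sum free as \<open>p\<close> is thin.
\<close>

lemma exists_p_free_block:
  assumes p: "prime p" and thin: "thin p" and X: "set_mset X \<subseteq> carrier G" and m: "mass p X \<ge> 1"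
  shows "\<exists>E. E \<subseteq># X \<and> E \<noteq> {#} \<and> mass p E \<le> 1 \<and> \<not> p dvd ord (mprod E)"
proof -
  have p0: "p > 0" using p prime_gt_0_nat by simp
  obtain Y where Y: "Y \<subseteq># X" "mass p Y \<ge> 1"
    and min: "\<And>Z. Z \<subseteq># X \<Longrightarrow> mass p Z \<ge> 1 \<Longrightarrow> size Y \<le> size Z"
    using ex_has_least_nat[of "\<lambda>Y. Y \<subseteq># X \<and> mass p Y \<ge> 1" X size] m by blast
  have Yc: "set_mset Y \<subseteq> carrier G" using X Y(1) by (meson set_mset_mono subset_trans)
  have "Y \<noteq> {#}" using Y(2) by auto
  have "mass p Y \<le> 1"
  proof -
    let ?k = "Max ((\<lambda>x. multiplicity p (ord x)) ` set_mset Y)"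
    have "?k \<in> (\<lambda>x. multiplicity p (ord x)) ` set_mset Y"
      using \<open>Y \<noteq> {#}\<close> by (intro Max_in) auto
    then obtain x where x: "x \<in># Y" "multiplicity p (ord x) = ?k" by auto
    obtain Z where Z: "Y = add_mset x Z" using x(1) by (metis multi_member_split)
    have "\<not> mass p Z \<ge> 1"
    proof
      assume "mass p Z \<ge> 1"
      moreover have "Z \<subseteq># X"
        using Y(1) unfolding Z by (meson mset_subset_eq_add_mset_cancel mset_subset_eq_insertD subset_mset.less_imp_le)
      ultimately show False using min[of Z] Z by simp
    qed
    obtain N where N: "mass p Y * real (p ^ ?k) = real N"
      using mass_integral[OF p0, of Y ?k] by auto
    have pk: "real (p ^ ?k) > 0" using p0 by simp
    have "mass p Y = 1 / real (p ^ ?k) + mass p Z" using Z x(2) by simp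
    moreover have "(1 / c + z) * c = 1 + z * c" if "c > 0" for c z :: real
      using that by (simp add: distrib_right)
    ultimately have "real N = 1 + mass p Z * real (p ^ ?k)" using N pk by metis
    moreover have "mass p Z * real (p ^ ?k) < 1 * real (p ^ ?k)"
      using \<open>\<not> mass p Z \<ge> 1\<close> pk by (intro mult_strict_right_mono) auto
    ultimately have "real N < real (p ^ ?k) + 1" by simp
    then have "N \<le> p ^ ?k" by linarith
    then have "mass p Y * real (p ^ ?k) \<le> 1 * real (p ^ ?k)" using N by (simp only: mult_1 of_nat_le_iff)
    then show ?thesis using pk by (rule mult_right_le_imp_le)
  qed
  define n where "n = Coset.order G div p ^ multiplicity p (Coset.order G)"
  have o0: "Coset.order G > 0" using fin order_gt_0_iff_finite by blast
  have n: "Coset.order G = p ^ multiplicity p (Coset.order G) * n" "\<not> p dvd n"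
  proof -
    show "Coset.order G = p ^ multiplicity p (Coset.order G) * n"
      unfolding n_def by (simp add: multiplicity_dvd)
    show "\<not> p dvd n" unfolding n_def using o0 p by (intro multiplicity_decompose) auto
  qed
  have od: "ord (x [^] n) = p ^ multiplicity p (ord x)" if "x \<in># Y" for x
    using that Yc p n ord_dvd_group_order[of x] by (intro ord_pow_cofactor[where m="multiplicity p (Coset.order G)"]) auto
  (* n is the part of the group order prime to p *)
  let ?I = "image_mset (\<lambda>x. x [^] n) Y"
  have "cr ?I = mass p Y"
    unfolding cr_def mass_def by (simp add: image_mset.compositionality o_def od cong: image_mset_cong)
  then have "\<not> cr ?I < 1" using Y(2) by simp
  then have "\<not> zsf ?I" using thin od unfolding thin_def by (metis (no_types, lifting) imageE set_image_mset)
  then obtain E where E: "E \<subseteq># Y" "E \<noteq> {#}" "mprod E [^] n = \<one>"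
    using zsf_pow[OF Yc, of n] by blast
  have "ord (mprod E) dvd n" using E(3) pow_one_iff by simp
  then have "\<not> p dvd ord (mprod E)" using n(2) dvd_trans by blast
  moreover have "mass p E \<le> 1" using mass_mono[OF E(1), of p] \<open>mass p Y \<le> 1\<close> by simp
  ultimately show ?thesis using E Y(1) subset_mset.order_trans by blast
qed

text \<open>
  Iteration of \<open>exists_p_free_block\<close>. Each block has mass at most \<open>1\<close>, so the number of blocks is at
  least the mass removed.
\<close>

lemma extract_blocks:
  assumes p: "prime p" and thin: "thin p" and X: "set_mset X \<subseteq> carrier G"
    and D: "\<And>x. x \<in># X \<Longrightarrow> ord x dvd p ^ a * D"
  shows "\<exists>R Q. Red X R Q \<and> mass p R < 1 \<and> mass p X \<le> mass p R + real (size Q) \<and>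
           (\<forall>y\<in>#Q. y \<in> carrier G \<and> \<not> p dvd ord y \<and> ord y dvd D)"
  using X D
proof (induction "size X" arbitrary: X rule: less_induct)
  case less
  show ?case
  proof (cases "mass p X < 1")
    case True
    then show ?thesis using Red_refl[of X] by (intro exI[of _ X] exI[of _ "{#}"]) auto
  next
    case False
    then obtain E where E: "E \<subseteq># X" "E \<noteq> {#}" "mass p E \<le> 1" "\<not> p dvd ord (mprod E)"
      using exists_p_free_block[OF p thin less.prems(1)] by auto
    then obtain X' where X': "X = E + X'" by (metis subset_mset.le_iff_add)
    have "size X' < size X" using X' E(2) by (simp add: nonempty_has_size)
    moreover have "set_mset X' \<subseteq> carrier G" "\<And>x. x \<in># X' \<Longrightarrow> ord x dvd p ^ a * D"
      using less.prems X' by auto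
    ultimately obtain R Q where R: "Red X' R Q" "mass p R < 1" "mass p X' \<le> mass p R + real (size Q)"
      "\<forall>y\<in>#Q. y \<in> carrier G \<and> \<not> p dvd ord y \<and> ord y dvd D"
      using less.hyps by blast
    have "Red X X' {#mprod E#}" using Red_step[OF Red_refl[of X, unfolded X'] E(2)] X' by simp
    then have red: "Red X R (add_mset (mprod E) Q)" using Red_trans[OF R(1)] by fastforce
    have "ord (mprod E) dvd p ^ a * D" using less.prems X' by (intro ord_mprod_dvd) auto
    moreover have "coprime (ord (mprod E)) (p ^ a)"
      using E(4) p by (metis coprime_commute coprime_power_left_iff prime_imp_coprime)
    ultimately have "ord (mprod E) dvd D" by (simp add: coprime_dvd_mult_right_iff)
    then show ?thesis using red R E X'
      by (intro exI[of _ R] exI[of _ "add_mset (mprod E) Q"]) auto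
  qed
qed

text \<open>
  Extraction along the levels \<open>D, D q, \<dots>, D q\<^sup>k\<close>, from below: before level \<open>i\<close> is added,
  everything of lower level has been reduced to mass below \<open>1\<close>, hence at most \<open>\<kappa>\<close>. Let \<open>r\<^sub>i\<close> be the
  mass so far minus the number of blocks so far. Adding level \<open>i\<close> brings cross number
  \<open>(mass added) / (D q\<^sup>i)\<close>, and each block returns at least \<open>1 / (D q\<^sup>i)\<close>, measured by the weight
  \<open>\<omega>\<close>; so the net loss at the level is at most \<open>(r\<^sub>i - r\<^sub>i\<^sub>-\<^sub>1) / (D q\<^sup>i)\<close>. Since \<open>r\<^sub>i \<le> \<kappa>\<close>
  and the weights \<open>1 / (D q\<^sup>i)\<close> decrease, summation by parts gives the bound. Allowing an initial
  reduction \<open>(R0, Q0)\<close> of lower layers \<open>X\<close> makes it possible to start with layers that do not form a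
  chain, and a general \<open>\<omega>\<close> in place of \<open>1 / ord\<close> leaves room for a stricter accounting.
\<close>

lemma chain_bound:
  fixes p a D q :: nat
  defines "\<kappa> \<equiv> 1 - 1 / real (p ^ a)"
  assumes p: "prime p" and thin: "thin p" and q: "q > 0" "\<not> p dvd q" and D: "D > 0" "\<not> p dvd D"
    and X: "set_mset X \<subseteq> carrier G" "\<And>x. x \<in># X \<Longrightarrow> ord x dvd p ^ a * D"
    and R0: "Red X R0 Q0" "mass p R0 < 1" "mass p X \<le> mass p R0 + real (size Q0)"
    and B: "set_mset B \<subseteq> carrier G" "\<And>x. x \<in># B \<Longrightarrow> \<exists>i\<le>k. \<exists>j\<le>a. ord x = p ^ j * (D * q ^ i)"
    and \<omega>: "\<And>y i. y \<in> carrier G \<Longrightarrow> i \<le> k \<Longrightarrow> ord y dvd D * q ^ i \<Longrightarrow> 1 / real (D * q ^ i) \<le> \<omega> y"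
  shows "\<exists>R Q. Red (X + B) R (Q0 + Q) \<and> mass p R < 1 \<and>
      mass p (X + B) \<le> mass p R + real (size (Q0 + Q)) \<and>
      (\<forall>y\<in>#Q. y \<in> carrier G \<and> \<not> p dvd ord y \<and> ord y dvd D * q ^ k) \<and>
      cr B - (\<Sum>y\<in>#Q. \<omega> y) \<le> (\<kappa> - (mass p X - real (size Q0))) / real D
         - (\<kappa> - (mass p (X + B) - real (size (Q0 + Q)))) / real (D * q ^ k)"
  using B \<omega>
proof (induction k arbitrary: B)
  have p0: "p > 0" using p prime_gt_0_nat by simp
  have step: "\<exists>R' Q'. Red (Y + C) R' (Q1 + Q') \<and> mass p R' < 1 \<and>
      mass p (Y + C) \<le> mass p R' + real (size (Q1 + Q')) \<and>
      (\<forall>y\<in>#Q'. y \<in> carrier G \<and> \<not> p dvd ord y \<and> ord y dvd D') \<and>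
      cr C - (\<Sum>y\<in>#Q'. \<omega> y) \<le> ((mass p (Y + C) - real (size (Q1 + Q'))) - (mass p Y - real (size Q1))) / real D'"
    if D': "D' > 0" "\<not> p dvd D'" and Y: "set_mset Y \<subseteq> carrier G" "\<And>x. x \<in># Y \<Longrightarrow> ord x dvd p ^ a * D'"
    and R1: "Red Y R1 Q1" "mass p Y \<le> mass p R1 + real (size Q1)"
    and C: "set_mset C \<subseteq> carrier G" "\<And>x. x \<in># C \<Longrightarrow> \<exists>j\<le>a. ord x = p ^ j * D'"
    and w: "\<And>y. y \<in> carrier G \<Longrightarrow> ord y dvd D' \<Longrightarrow> 1 / real D' \<le> \<omega> y"
    for Y C R1 Q1 D'
  proof -
    have Cd: "ord x dvd p ^ a * D'" if "x \<in># C" for x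
      using C(2)[OF that] by (auto intro: mult_dvd_mono le_imp_power_dvd)
    have "R1 \<subseteq># Y" using R1(1) Red_subset by blast
    then have sub: "set_mset (R1 + C) \<subseteq> carrier G" "\<And>x. x \<in># R1 + C \<Longrightarrow> ord x dvd p ^ a * D'"
      using Y C(1) Cd by (auto dest: mset_subset_eqD)
    obtain R' Q' where R': "Red (R1 + C) R' Q'" "mass p R' < 1"
      "mass p (R1 + C) \<le> mass p R' + real (size Q')"
      "\<forall>y\<in>#Q'. y \<in> carrier G \<and> \<not> p dvd ord y \<and> ord y dvd D'"
      using extract_blocks[OF p thin sub] by blast
    have red: "Red (Y + C) R' (Q1 + Q')" by (rule Red_trans[OF R'(1) Red_add[OF R1(1)]])
    have crC: "cr C = mass p C / real D'"
    proof -
      have "1 / real (ord x) = 1 / real (p ^ multiplicity p (ord x)) / real D'" if "x \<in># C" for x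
        using C(2)[OF that] multiplicity_power_times[OF p D'(2)] by auto
      then have "cr C = (\<Sum>x\<in>#C. 1 / real (p ^ multiplicity p (ord x)) / real D')"
        unfolding cr_def by (intro arg_cong[where f=sum_mset] image_mset_cong) auto
      also have "\<dots> = mass p C / real D'"
        unfolding mass_def divide_inverse by (simp add: sum_mset_distrib_right)
      finally show ?thesis .
    qed
    have "real (size Q') / real D' = (\<Sum>y\<in>#Q'. 1 / real D')" by (simp add: sum_mset_constant)
    also have "\<dots> \<le> (\<Sum>y\<in>#Q'. \<omega> y)" using R'(4) w by (intro sum_mset_mono) auto
    finally have "real (size Q') / real D' \<le> (\<Sum>y\<in>#Q'. \<omega> y)" .
    then have "cr C - (\<Sum>y\<in>#Q'. \<omega> y) \<le> (mass p C - real (size Q')) / real D'"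
      using crC by (simp add: diff_divide_distrib)
    moreover have "mass p C - real (size Q') = (mass p (Y + C) - real (size (Q1 + Q'))) - (mass p Y - real (size Q1))"
      by simp
    moreover have "mass p (Y + C) \<le> mass p R' + real (size (Q1 + Q'))"
      using R'(3) R1(2) by simp
    ultimately show ?thesis using red R'(2,4) by metis
  qed
  {
    case 0
    have "\<exists>R Q. Red (X + B) R (Q0 + Q) \<and> mass p R < 1 \<and>
      mass p (X + B) \<le> mass p R + real (size (Q0 + Q)) \<and>
      (\<forall>y\<in>#Q. y \<in> carrier G \<and> \<not> p dvd ord y \<and> ord y dvd D) \<and>
      cr B - (\<Sum>y\<in>#Q. \<omega> y) \<le> ((mass p (X + B) - real (size (Q0 + Q))) - (mass p X - real (size Q0))) / real D"
      using 0(1,2) 0(3)[of _ 0] by (intro step[OF D X R0(1,3)]) auto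
    then obtain R Q where RQ: "Red (X + B) R (Q0 + Q)" "mass p R < 1"
      "mass p (X + B) \<le> mass p R + real (size (Q0 + Q))"
      "\<forall>y\<in>#Q. y \<in> carrier G \<and> \<not> p dvd ord y \<and> ord y dvd D"
      "cr B - (\<Sum>y\<in>#Q. \<omega> y) \<le> ((mass p (X + B) - real (size (Q0 + Q))) - (mass p X - real (size Q0))) / real D"
      by blast
    have "(u - v) / real D = (\<kappa> - v) / real D - (\<kappa> - u) / real (D * q ^ 0)" for u v
      by (simp add: diff_divide_distrib)
    then have "cr B - (\<Sum>y\<in>#Q. \<omega> y) \<le> (\<kappa> - (mass p X - real (size Q0))) / real D
         - (\<kappa> - (mass p (X + B) - real (size (Q0 + Q)))) / real (D * q ^ 0)"
      using RQ(5) by metis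
    then show ?case using RQ(1-4) by (intro exI[of _ R] exI[of _ Q]) (simp only: simp_thms power_0 mult_1_right)
  next
    case (Suc k)
    let ?top = "\<lambda>x. \<exists>j\<le>a. ord x = p ^ j * (D * q ^ Suc k)"
    define C where "C = filter_mset ?top B"
    define B' where "B' = filter_mset (\<lambda>x. \<not> ?top x) B"
    have BC: "B = B' + C" unfolding B'_def C_def by (subst add.commute) (rule multiset_partition)
    have B'2: "\<exists>i\<le>k. \<exists>j\<le>a. ord x = p ^ j * (D * q ^ i)" if "x \<in># B'" for x
    proof -
      have "x \<in># B" "\<not> ?top x" using that by (auto simp: B'_def)
      then show ?thesis using Suc.prems(2)[of x] by (metis le_Suc_eq)
    qed
    have "\<exists>R Q. Red (X + B') R (Q0 + Q) \<and> mass p R < 1 \<and>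
      mass p (X + B') \<le> mass p R + real (size (Q0 + Q)) \<and>
      (\<forall>y\<in>#Q. y \<in> carrier G \<and> \<not> p dvd ord y \<and> ord y dvd D * q ^ k) \<and>
      cr B' - (\<Sum>y\<in>#Q. \<omega> y) \<le> (\<kappa> - (mass p X - real (size Q0))) / real D
         - (\<kappa> - (mass p (X + B') - real (size (Q0 + Q)))) / real (D * q ^ k)"
    proof (rule Suc.IH)
      show "set_mset B' \<subseteq> carrier G" using Suc.prems(1) BC by auto
      fix y i assume "y \<in> carrier G" "i \<le> k" "ord y dvd D * q ^ i"
      then show "1 / real (D * q ^ i) \<le> \<omega> y" using Suc.prems(3)[of y i] by simp
    qed (use B'2 in auto)
    then obtain R Q where RQ: "Red (X + B') R (Q0 + Q)" "mass p R < 1"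
      "mass p (X + B') \<le> mass p R + real (size (Q0 + Q))"
      "\<forall>y\<in>#Q. y \<in> carrier G \<and> \<not> p dvd ord y \<and> ord y dvd D * q ^ k"
      "cr B' - (\<Sum>y\<in>#Q. \<omega> y) \<le> (\<kappa> - (mass p X - real (size Q0))) / real D
         - (\<kappa> - (mass p (X + B') - real (size (Q0 + Q)))) / real (D * q ^ k)"
      by blast
    let ?D' = "D * q ^ Suc k"
    have D': "?D' > 0" "\<not> p dvd ?D'"
      using D q p prime_dvd_mult_iff[of p] prime_dvd_power[of p q] by auto
    have Dk: "D * q ^ i > 0" "\<not> p dvd D * q ^ i" for i
      using D q p prime_dvd_mult_iff[of p] prime_dvd_power[of p q] by auto
    have Xd: "ord x dvd p ^ a * ?D'" if "x \<in># X + B'" for x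
    proof -
      consider "x \<in># X" | "x \<in># B'" using \<open>x \<in># X + B'\<close> by auto
      then show ?thesis
      proof cases
        case 1
        then show ?thesis using X(2)[of x] by (metis dvd_mult2 mult.assoc)
      next
        case 2
        then obtain i j where "i \<le> k" "j \<le> a" "ord x = p ^ j * (D * q ^ i)" using B'2 by blast
        then show ?thesis by (auto intro!: mult_dvd_mono le_imp_power_dvd simp del: power_Suc)
      qed
    qed
    have Cc: "set_mset C \<subseteq> carrier G" "\<And>x. x \<in># C \<Longrightarrow> ?top x"
      using Suc.prems(1) by (auto simp: C_def)
    have XB: "set_mset (X + B') \<subseteq> carrier G" using X(1) Suc.prems(1) BC by auto
    obtain R' Q' where RQ': "Red (X + B' + C) R' (Q0 + Q + Q')" "mass p R' < 1"
      "mass p (X + B' + C) \<le> mass p R' + real (size (Q0 + Q + Q'))"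
      "\<forall>y\<in>#Q'. y \<in> carrier G \<and> \<not> p dvd ord y \<and> ord y dvd ?D'"
      "cr C - (\<Sum>y\<in>#Q'. \<omega> y) \<le> ((mass p (X + B' + C) - real (size (Q0 + Q + Q'))) - (mass p (X + B') - real (size (Q0 + Q)))) / real ?D'"
      using step[OF D' XB Xd RQ(1,3) Cc Suc.prems(3)[of _ "Suc k"]] by blast
    define r r' w w' where "r = mass p (X + B') - real (size (Q0 + Q))"
      and "r' = mass p (X + B' + C) - real (size (Q0 + Q + Q'))"
      and "w = 1 / real (D * q ^ k)" and "w' = 1 / real ?D'"
    have "r \<le> \<kappa>"
    proof -
      have "mass p R \<le> \<kappa>" unfolding \<kappa>_def
      proof (rule mass_lt_one_le[OF p0 _ RQ(2)])
        fix x assume "x \<in># R"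
        then have "x \<in># X + B'" using Red_subset[OF RQ(1)] by (rule mset_subset_eqD[rotated])
        then show "multiplicity p (ord x) \<le> a"
          using Xd D' p by (intro multiplicity_le_if_dvd[of p ?D']) auto
      qed
      then show ?thesis using RQ(3) by (simp add: r_def)
    qed
    moreover have "w' \<le> w"
    proof -
      have "D * q ^ k \<le> ?D'" using q by simp
      then have "real (D * q ^ k) \<le> real ?D'" by (simp only: of_nat_le_iff)
      moreover have "real (D * q ^ k) > 0" using Dk by (simp only: of_nat_0_less_iff)
      ultimately show ?thesis unfolding w_def w'_def by (intro divide_left_mono) auto
    qed
    ultimately have key: "0 \<le> (\<kappa> - r) * (w - w')" by simp
    have "cr B - (\<Sum>y\<in>#Q + Q'. \<omega> y) = (cr B' - (\<Sum>y\<in>#Q. \<omega> y)) + (cr C - (\<Sum>y\<in>#Q'. \<omega> y))"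
      using BC by simp
    also have "\<dots> \<le> ((\<kappa> - (mass p X - real (size Q0))) / real D - (\<kappa> - r) * w) + (r' - r) * w'"
      using RQ(5) RQ'(5) by (simp only: r_def r'_def w_def w'_def times_divide_eq_right mult_1_right)
    also have "\<dots> \<le> (\<kappa> - (mass p X - real (size Q0))) / real D - (\<kappa> - r') * w'"
      using key by (simp add: algebra_simps)
    finally have fin: "cr B - (\<Sum>y\<in>#Q + Q'. \<omega> y) \<le> (\<kappa> - (mass p X - real (size Q0))) / real D - (\<kappa> - r') * w'" .
    have dvd: "D * q ^ k dvd ?D'" by simp
    have XBC: "X + B' + C = X + B" "Q0 + Q + Q' = Q0 + (Q + Q')" by (simp_all add: BC)
    have "\<forall>y\<in>#Q + Q'. y \<in> carrier G \<and> \<not> p dvd ord y \<and> ord y dvd ?D'"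
      using RQ(4) RQ'(4) dvd_trans[OF _ dvd] by auto
    then show ?case
      using RQ'(1-3) fin unfolding r'_def w'_def XBC
      by (intro exI[of _ R'] exI[of _ "Q + Q'"]) (simp only: simp_thms times_divide_eq_right mult_1_right)
  }
qed

end

section \<open>Reciprocal sums of divisors and wide numbers\<close>

text \<open>
  The divisors of \<open>e\<close> whose prime factors all exceed \<open>r\<close>.
\<close>

definition rough :: "nat \<Rightarrow> nat \<Rightarrow> nat set" where
  "rough r e = {d. d dvd e \<and> (\<forall>s. prime s \<longrightarrow> s dvd d \<longrightarrow> r < s)}"

definition hsum :: "nat \<Rightarrow> nat \<Rightarrow> real" where
  "hsum r e = (\<Sum>d\<in>rough r e. 1 / real d)"

lemma finite_rough [simp]: "e > 0 \<Longrightarrow> finite (rough r e)"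
  unfolding rough_def by (rule finite_subset[of _ "{d. d dvd e}"]) auto

lemma one_in_rough [simp]: "1 \<in> rough r e" "Suc 0 \<in> rough r e"
  by (auto simp: rough_def)

lemma rough_pos: "e > 0 \<Longrightarrow> d \<in> rough r e \<Longrightarrow> 0 < d"
  by (auto simp: rough_def intro: dvd_pos_nat)

lemma hsum_mono: "e > 0 \<Longrightarrow> e' dvd e \<Longrightarrow> hsum r e' \<le> hsum r e"
  unfolding hsum_def by (rule sum_mono2) (auto simp: rough_def intro: dvd_trans)

lemma hsum_ge_one: "e > 0 \<Longrightarrow> 1 \<le> hsum r e"
  unfolding hsum_def using member_le_sum[of 1 "rough r e" "\<lambda>d. 1 / real d"] by simp

lemma rough_split:
  assumes q: "prime q" "r < q" and e: "e > 0"
    and least: "\<And>s. prime s \<Longrightarrow> s dvd e \<Longrightarrow> r < s \<Longrightarrow> q \<le> s"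
    and d: "d \<in> rough r e"
  shows "\<exists>i\<le>multiplicity q e. \<exists>f\<in>rough q e. d = q ^ i * f"
proof -
  have d': "d dvd e" "\<And>s. prime s \<Longrightarrow> s dvd d \<Longrightarrow> r < s" using d by (auto simp: rough_def)
  have "d \<noteq> 0" using d' e by auto
  then obtain f where f: "d = q ^ multiplicity q d * f" "\<not> q dvd f"
    using multiplicity_decompose'[of d q] q(1) not_prime_1
    by (metis (no_types, lifting) nat_dvd_1_iff_1)
  have "f dvd e" using f(1) d'(1) by (metis dvd_mult_right)
  moreover have "q < s" if "prime s" "s dvd f" for s
  proof -
    have "s dvd d" using f(1) that(2) by (metis dvd_mult)
    then have "q \<le> s" using least d' that(1) dvd_trans by blast
    moreover have "s \<noteq> q" using f(2) that(2) by auto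
    ultimately show ?thesis by simp
  qed
  moreover have "multiplicity q d \<le> multiplicity q e"
    using d'(1) e by (intro dvd_imp_multiplicity_le) auto
  ultimately show ?thesis using f(1) by (auto simp: rough_def)
qed

lemma rough_not_dvd: "prime q \<Longrightarrow> f \<in> rough q e \<Longrightarrow> \<not> q dvd f"
  by (auto simp: rough_def)

lemma rough_join:
  assumes q: "prime q" "r < q" and i: "i \<le> multiplicity q e" and f: "f \<in> rough q e"
  shows "q ^ i * f \<in> rough r e"
proof -
  have "q ^ i dvd e" using i by (rule multiplicity_dvd')
  moreover have "coprime (q ^ i) f"
    using rough_not_dvd[OF q(1) f] q(1) by (simp add: coprime_power_left_iff prime_imp_coprime)
  ultimately have "q ^ i * f dvd e" using f by (intro divides_mult) (auto simp: rough_def)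
  moreover have "r < s" if "prime s" "s dvd q ^ i * f" for s
  proof -
    consider "s dvd q ^ i" | "s dvd f"
      using \<open>s dvd q ^ i * f\<close> prime_dvd_mult_iff[OF \<open>prime s\<close>] by blast
    then show ?thesis
    proof cases
      case 1
      then have "s = q" using that(1) q(1) prime_dvd_power primes_dvd_imp_eq by blast
      then show ?thesis using q(2) by simp
    next
      case 2
      then have "q < s" using \<open>prime s\<close> f by (simp add: rough_def)
      then show ?thesis using q(2) by simp
    qed
  qed
  ultimately show ?thesis by (auto simp: rough_def)
qed

lemma rough_factor_inj:
  assumes q: "prime q" and f: "\<not> q dvd f" "\<not> q dvd f'" and eq: "q ^ i * f = q ^ i' * f'"
  shows "i = i' \<and> f = (f' :: nat)"
proof -
  have "i = i'" using multiplicity_power_times[OF q f(1), of i] multiplicity_power_times[OF q f(2), of i'] eq by simp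
  then show ?thesis using eq q by (simp add: prime_gt_0_nat)
qed

text \<open>
  Split each divisor into a power of the next prime \<open>q\<close> and a divisor with primes above \<open>q\<close>.
\<close>

lemma hsum_rec:
  assumes q: "prime q" "r < q" and e: "e > 0"
    and least: "\<And>s. prime s \<Longrightarrow> s dvd e \<Longrightarrow> r < s \<Longrightarrow> q \<le> s"
  shows "hsum r e = (\<Sum>i\<le>multiplicity q e. 1 / real q ^ i) * hsum q e"
proof -
  let ?A = "{..multiplicity q e} \<times> rough q e"
  have "bij_betw (\<lambda>(i, f). q ^ i * f) ?A (rough r e)"
    unfolding bij_betw_def
  proof
    show "inj_on (\<lambda>(i, f). q ^ i * f) ?A"
    proof (rule inj_onI, clarify)
      fix i f i' f' assume "f \<in> rough q e" "f' \<in> rough q e" "q ^ i * f = q ^ i' * f'"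
      then show "i = i' \<and> f = f'" using rough_factor_inj[OF q(1)] rough_not_dvd[OF q(1)] by blast
    qed
    show "(\<lambda>(i, f). q ^ i * f) ` ?A = rough r e"
      using rough_split[OF q e least] rough_join[OF q] by (force simp: image_iff)
  qed
  then have "hsum r e = (\<Sum>x\<in>?A. 1 / real ((\<lambda>(i, f). q ^ i * f) x))"
    unfolding hsum_def by (rule sum.reindex_bij_betw[symmetric])
  also have "\<dots> = (\<Sum>(i, f)\<in>?A. (1 / real q ^ i) * (1 / real f))"
    by (rule sum.cong) auto
  also have "\<dots> = (\<Sum>i\<le>multiplicity q e. 1 / real q ^ i) * hsum q e"
    unfolding hsum_def sum_product by (rule sum.cartesian_product[symmetric])
  finally show ?thesis .
qed

lemma geometric_quotient:
  assumes "q > 1"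
  shows "(\<Sum>i\<le>v. 1 / real q ^ i) = (real q ^ (v + 1) - 1) / (real q ^ (v + 1) - real q ^ v)"
proof (induction v)
  case (Suc v)
  have q0: "real q > 1" using assms by simp
  have p: "real q ^ v > 0" using q0 by simp
  have d: "real q ^ (v + 1) - real q ^ v = real q ^ v * (real q - 1)"
    "real q ^ (Suc v + 1) - real q ^ Suc v = real q * real q ^ v * (real q - 1)"
    by (simp_all add: algebra_simps)
  show ?case unfolding sum.atMost_Suc Suc d using q0 p by (simp add: field_simps)
qed (use assms in simp)

lemma hsum_prod:
  assumes e: "e > 0"
  shows "hsum r e = (\<Prod>q\<in>{q\<in>prime_factors e. r < q}. \<Sum>i\<le>multiplicity q e. 1 / real q ^ i)"
proof (induction "card {q\<in>prime_factors e. r < q}" arbitrary: r rule: less_induct)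
  case less
  let ?S = "{q\<in>prime_factors e. r < q}"
  show ?case
  proof (cases "?S = {}")
    case True
    have "rough r e = {1}"
    proof -
      have "d = 1" if "d \<in> rough r e" for d
      proof (rule ccontr)
        assume "d \<noteq> 1"
        then obtain s where "prime s" "s dvd d" using prime_factor_nat by blast
        then have "s \<in> ?S" using that e by (auto simp: rough_def in_prime_factors_iff intro: dvd_trans)
        then show False using True by blast
      qed
      then show ?thesis by auto
    qed
    then show ?thesis unfolding True by (simp add: hsum_def)
  next
    case False
    define q where "q = Min ?S"
    have qS: "q \<in> ?S" unfolding q_def using False by (intro Min_in) auto
    then have q: "prime q" "r < q" by auto
    have least: "q \<le> s" if "prime s" "s dvd e" "r < s" for s
      unfolding q_def using that e by (intro Min_le) (auto simp: in_prime_factors_iff)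
    have S: "?S = insert q {s\<in>prime_factors e. q < s}"
    proof (intro equalityI subsetI)
      fix x assume x: "x \<in> ?S"
      then have "q \<le> x" by (intro least) auto
      then show "x \<in> insert q {s\<in>prime_factors e. q < s}" using x by auto
    next
      fix x assume "x \<in> insert q {s\<in>prime_factors e. q < s}"
      then show "x \<in> ?S" using qS q(2) less_trans by blast
    qed
    have "card {s\<in>prime_factors e. q < s} < card ?S"
      by (rule psubset_card_mono) (use qS q in auto)
    then have "hsum q e = (\<Prod>q\<in>{s\<in>prime_factors e. q < s}. \<Sum>i\<le>multiplicity q e. 1 / real q ^ i)"
      by (rule less.hyps)
    moreover have "hsum r e = (\<Sum>i\<le>multiplicity q e. 1 / real q ^ i) * hsum q e"
      by (rule hsum_rec[OF q e]) (rule least)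
    ultimately show ?thesis unfolding S by simp
  qed
qed

text \<open>
  The product in the definition of wideness is the Euler product of \<open>hsum\<close>.
\<close>

lemma wide_imp_hsum_le:
  assumes w: "wide e" and s: "prime s" "s dvd e" "s \<noteq> largest_prime e"
  shows "hsum s e \<le> real s / (real s - 1)"
proof -
  have e: "e > 0" using w by (simp add: wide_def)
  let ?S = "{q \<in> prime_factors e. s < q}"
  define m where "m = (\<Prod>q\<in>?S. q ^ multiplicity q e)"
  have fS: "finite ?S" by simp
  have m0: "m > 0" unfolding m_def by (rule prod_pos) (auto simp: prime_gt_0_nat)
  have mult: "multiplicity q m = (if q \<in> ?S then multiplicity q e else 0)" if "prime q" for q
    unfolding m_def using that by (subst multiplicity_prod_prime_powers) auto
  have pf: "prime_factors m = ?S"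
  proof -
    have "q \<in> prime_factors m \<longleftrightarrow> q \<in> ?S" if "prime q" for q
      using mult[OF that] that e m0 by (auto simp: prime_factors_multiplicity)
    then show ?thesis by (auto simp: in_prime_factors_iff)
  qed
  have "wide_wrt s m" using w s e unfolding wide_def m_def by (auto simp: in_prime_factors_iff)
  then have "real s / (real s - 1) \<ge> (\<Prod>q\<in>prime_factors m.
          (real q ^ (multiplicity q m + 1) - 1) /
          (real q ^ (multiplicity q m + 1) - real q ^ multiplicity q m))"
    by (simp add: wide_wrt_def)
  also have "(\<Prod>q\<in>prime_factors m.
          (real q ^ (multiplicity q m + 1) - 1) /
          (real q ^ (multiplicity q m + 1) - real q ^ multiplicity q m)) =
       (\<Prod>q\<in>?S. \<Sum>i\<le>multiplicity q e. 1 / real q ^ i)"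
    unfolding pf
  proof (rule prod.cong[OF refl])
    fix q assume q: "q \<in> ?S"
    then have "prime q" by auto
    then have "multiplicity q m = multiplicity q e" "q > 1" using q mult prime_gt_1_nat by auto
    then show "(real q ^ (multiplicity q m + 1) - 1) /
          (real q ^ (multiplicity q m + 1) - real q ^ multiplicity q m) =
        (\<Sum>i\<le>multiplicity q e. 1 / real q ^ i)" using geometric_quotient by simp
  qed
  finally show ?thesis using hsum_prod[OF e, of s] by simp
qed

section \<open>Layers and chains of orders\<close>

context fin_comm_group begin

text \<open>
  The part of the order prime to \<open>p\<close>.
\<close>

definition cofactor :: "nat \<Rightarrow> 'a \<Rightarrow> nat" where
  "cofactor p x = ord x div p ^ multiplicity p (ord x)"

definition layer :: "nat \<Rightarrow> 'a multiset \<Rightarrow> nat \<Rightarrow> 'a multiset" where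
  "layer p M d = {#x \<in># M. p dvd ord x \<and> cofactor p x = d#}"

definition chain :: "nat \<Rightarrow> nat \<Rightarrow> 'a multiset \<Rightarrow> nat \<Rightarrow> nat \<Rightarrow> 'a multiset" where
  "chain p q M D k = {#x \<in># M. p dvd ord x \<and> (\<exists>i\<le>k. cofactor p x = D * q ^ i)#}"

text \<open>
  Some reduction of \<open>X\<close> has products of orders dividing \<open>n\<close>, and costs at most \<open>v\<close>: cross number of
  \<open>X\<close> minus the weight of the products. Costs add up over disjoint multisets.
\<close>

definition net :: "nat \<Rightarrow> ('a \<Rightarrow> real) \<Rightarrow> 'a multiset \<Rightarrow> real \<Rightarrow> bool" where
  "net n \<omega> X v \<longleftrightarrow> (\<exists>R Q. Red X R Q \<and> (\<forall>y\<in>#Q. y \<in> carrier G \<and> ord y dvd n) \<and>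
      cr X - (\<Sum>y\<in>#Q. \<omega> y) \<le> v)"

lemma net_refl: "cr X \<le> v \<Longrightarrow> net n \<omega> X v"
  unfolding net_def using Red_refl[of X] by (intro exI[of _ X] exI[of _ "{#}"]) auto

lemma net_mono: "net n \<omega> X v \<Longrightarrow> v \<le> w \<Longrightarrow> net n \<omega> X w"
  unfolding net_def by (meson order_trans)

lemma net_add:
  assumes "net n \<omega> X v" "net n \<omega> Y w"
  shows "net n \<omega> (X + Y) (v + w)"
proof -
  obtain R Q where 1: "Red X R Q" "\<forall>y\<in>#Q. y \<in> carrier G \<and> ord y dvd n" "cr X - (\<Sum>y\<in>#Q. \<omega> y) \<le> v"
    using assms(1) unfolding net_def by blast
  obtain R' Q' where 2: "Red Y R' Q'" "\<forall>y\<in>#Q'. y \<in> carrier G \<and> ord y dvd n" "cr Y - (\<Sum>y\<in>#Q'. \<omega> y) \<le> w"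
    using assms(2) unfolding net_def by blast
  have "\<forall>y\<in>#Q + Q'. y \<in> carrier G \<and> ord y dvd n" using 1(2) 2(2) by auto
  moreover have "cr (X + Y) - (\<Sum>y\<in>#Q + Q'. \<omega> y) \<le> v + w" using 1(3) 2(3) by simp
  ultimately show ?thesis using Red_union[OF 1(1) 2(1)] unfolding net_def by blast
qed

lemma net_sum:
  assumes "finite I" "\<And>i. i \<in> I \<Longrightarrow> net n \<omega> (X i) (v i)"
  shows "net n \<omega> (\<Sum>i\<in>I. X i) (\<Sum>i\<in>I. v i)"
  using assms
proof (induction I)
  case empty
  show ?case by (rule net_refl) simp
next
  case (insert i I)
  then show ?case by (simp add: net_add)
qed

lemma ord_cofactor: "x \<in> carrier G \<Longrightarrow> ord x = p ^ multiplicity p (ord x) * cofactor p x"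
  unfolding cofactor_def by (simp add: multiplicity_dvd)

lemma cofactor_not_dvd: "prime p \<Longrightarrow> x \<in> carrier G \<Longrightarrow> \<not> p dvd cofactor p x"
  unfolding cofactor_def using ord_pos[of x] not_prime_1 by (intro multiplicity_decompose) auto

lemma cr_layer:
  assumes "set_mset M \<subseteq> carrier G"
  shows "cr (layer p M d) = mass p (layer p M d) / real d"
proof -
  have "1 / real (ord x) = 1 / real (p ^ multiplicity p (ord x)) / real d" if "x \<in># layer p M d" for x
  proof -
    have "x \<in> carrier G" "cofactor p x = d" using that assms by (auto simp: layer_def)
    then have "real (ord x) = real (p ^ multiplicity p (ord x)) * real d"
      using ord_cofactor[of x p] by (metis of_nat_mult)
    then show ?thesis by simp
  qed
  then have "cr (layer p M d) = (\<Sum>x\<in>#layer p M d. 1 / real (p ^ multiplicity p (ord x)) / real d)"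
    unfolding cr_def by (intro arg_cong[where f=sum_mset] image_mset_cong) auto
  also have "\<dots> = mass p (layer p M d) / real d"
    unfolding mass_def divide_inverse by (simp add: sum_mset_distrib_right)
  finally show ?thesis .
qed

lemma chain_0: "chain p q M D 0 = layer p M D"
  by (simp add: chain_def layer_def)

lemma chain_Suc:
  assumes "q > 1" "D > 0"
  shows "chain p q M D (Suc k) = layer p M D + chain p q M (D * q) k"
proof -
  have ne: "D * q ^ Suc i \<noteq> D" for i
  proof -
    have "q ^ Suc i > 1" using assms(1) by (rule one_less_power) simp
    then show ?thesis using assms(2) by (metis mult_cancel1 mult_1_right less_irrefl not_gr0)
  qed
  have "(\<exists>i\<le>Suc k. c = D * q ^ i) \<longleftrightarrow> c = D \<or> (\<exists>i\<le>k. c = D * q * q ^ i)" for c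
    by (auto simp: ex_simps le_Suc_eq mult.assoc) (metis One_nat_def not0_implies_Suc power_0 power_Suc mult_1_right not_less_eq_eq le_Suc_eq)+
  then have "chain p q M D (Suc k) = {#x \<in># M. p dvd ord x \<and> (cofactor p x = D \<or> (\<exists>i\<le>k. cofactor p x = D * q * q ^ i))#}"
    by (simp add: chain_def)
  also have "\<dots> = layer p M D + chain p q M (D * q) k"
    unfolding layer_def chain_def using ne
    by (induction M) (auto simp: mult.assoc)
  finally show ?thesis .
qed

lemma chain_elem:
  assumes p: "prime p" and M: "set_mset M \<subseteq> carrier G" and n: "n > 0" "\<not> p dvd n"
    and o: "\<And>x. x \<in># M \<Longrightarrow> ord x dvd p ^ a * n"
    and x: "x \<in># chain p q M D k"
  shows "\<exists>i\<le>k. \<exists>j\<le>a. ord x = p ^ j * (D * q ^ i)"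
proof -
  have x': "x \<in># M" "x \<in> carrier G" using x M by (auto simp: chain_def)
  obtain i where i: "i \<le> k" "cofactor p x = D * q ^ i" using x by (auto simp: chain_def)
  have "multiplicity p (ord x) \<le> a" using multiplicity_le_if_dvd[OF p n(2) o[OF x'(1)] n(1)] .
  then show ?thesis using i ord_cofactor[OF x'(2), of p] by metis
qed

text \<open>
  The form of \<open>chain_bound\<close> in which the mass left at the top of the chain, which is at most \<open>\<kappa>\<close>, is
  discarded.
\<close>

lemma net_chain:
  assumes p: "prime p" and thin: "thin p" and q: "q > 0" "\<not> p dvd q" and D: "D > 0" "\<not> p dvd D"
    and M: "set_mset M \<subseteq> carrier G" and n: "n > 0" "\<not> p dvd n"
    and o: "\<And>x. x \<in># M \<Longrightarrow> ord x dvd p ^ a * n"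
    and X: "set_mset X \<subseteq> carrier G" "\<And>x. x \<in># X \<Longrightarrow> ord x dvd p ^ a * D"
    and R0: "Red X R0 Q0" "mass p R0 < 1" "mass p X \<le> mass p R0 + real (size Q0)"
      "\<And>y. y \<in># Q0 \<Longrightarrow> y \<in> carrier G \<and> ord y dvd n"
    and dvd: "D * q ^ k dvd n"
    and \<omega>: "\<And>y i. y \<in> carrier G \<Longrightarrow> i \<le> k \<Longrightarrow> ord y dvd D * q ^ i \<Longrightarrow> 1 / real (D * q ^ i) \<le> \<omega> y"
  shows "net n \<omega> (X + chain p q M D k)
    (cr X - (\<Sum>y\<in>#Q0. \<omega> y) + (1 - 1 / real (p ^ a) - (mass p X - real (size Q0))) / real D)"
proof -
  define B where "B = chain p q M D k"
  define \<kappa> where "\<kappa> = 1 - 1 / real (p ^ a)"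
  have Bc: "set_mset B \<subseteq> carrier G" using M by (auto simp: B_def chain_def)
  have Be: "\<exists>i\<le>k. \<exists>j\<le>a. ord x = p ^ j * (D * q ^ i)" if "x \<in># B" for x
    using chain_elem[OF p M n o] that unfolding B_def by blast
  have "\<exists>R Q. Red (X + B) R (Q0 + Q) \<and> mass p R < 1 \<and>
      mass p (X + B) \<le> mass p R + real (size (Q0 + Q)) \<and>
      (\<forall>y\<in>#Q. y \<in> carrier G \<and> \<not> p dvd ord y \<and> ord y dvd D * q ^ k) \<and>
      cr B - (\<Sum>y\<in>#Q. \<omega> y) \<le> (\<kappa> - (mass p X - real (size Q0))) / real D
         - (\<kappa> - (mass p (X + B) - real (size (Q0 + Q)))) / real (D * q ^ k)"
    unfolding \<kappa>_def by (rule chain_bound[OF p thin q D X R0(1-3) Bc Be \<omega>])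
  then obtain R Q where RQ: "Red (X + B) R (Q0 + Q)" "mass p R < 1"
    "mass p (X + B) \<le> mass p R + real (size (Q0 + Q))"
    "\<forall>y\<in>#Q. y \<in> carrier G \<and> \<not> p dvd ord y \<and> ord y dvd D * q ^ k"
    "cr B - (\<Sum>y\<in>#Q. \<omega> y) \<le> (\<kappa> - (mass p X - real (size Q0))) / real D
         - (\<kappa> - (mass p (X + B) - real (size (Q0 + Q)))) / real (D * q ^ k)"
    by (elim exE conjE)
  have Dk: "D * q ^ k > 0" "\<not> p dvd D * q ^ k"
    using D q p prime_dvd_mult_iff[of p] prime_dvd_power[of p q] by auto
  have "mass p R \<le> \<kappa>" unfolding \<kappa>_def
  proof (rule mass_lt_one_le[OF _ _ RQ(2)])
    show "p > 0" using p prime_gt_0_nat by simp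
    fix x assume "x \<in># R"
    then have "x \<in># X + B" using Red_subset[OF RQ(1)] by (rule mset_subset_eqD[rotated])
    then consider "x \<in># X" | "x \<in># B" by auto
    then have "ord x dvd p ^ a * (D * q ^ k)"
    proof cases
      case 1
      then show ?thesis using X(2)[of x] by (metis dvd_mult2 mult.assoc)
    next
      case 2
      then obtain i j where "i \<le> k" "j \<le> a" "ord x = p ^ j * (D * q ^ i)" using Be by blast
      then show ?thesis by (auto intro!: mult_dvd_mono le_imp_power_dvd)
    qed
    then show "multiplicity p (ord x) \<le> a" by (rule multiplicity_le_if_dvd[OF p Dk(2) _ Dk(1)])
  qed
  then have "0 \<le> \<kappa> - (mass p (X + B) - real (size (Q0 + Q)))" using RQ(3) by linarith
  then have "0 \<le> (\<kappa> - (mass p (X + B) - real (size (Q0 + Q)))) / real (D * q ^ k)"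
    by (intro divide_nonneg_nonneg) auto
  then have "cr (X + B) - (\<Sum>y\<in>#Q0 + Q. \<omega> y) \<le>
      cr X - (\<Sum>y\<in>#Q0. \<omega> y) + (\<kappa> - (mass p X - real (size Q0))) / real D"
    using RQ(5) by simp
  moreover have "\<forall>y\<in>#Q0 + Q. y \<in> carrier G \<and> ord y dvd n"
    using RQ(4) R0(4) dvd dvd_trans by auto
  ultimately show ?thesis using RQ(1) unfolding net_def B_def \<kappa>_def by blast
qed

text \<open>
  The case of \<open>net_chain\<close> in which nothing has been extracted from the initial layers.
\<close>

lemma net_chain_start:
  assumes "prime p" "thin p" "q > 0" "\<not> p dvd q" "D > 0" "\<not> p dvd D"
    and "set_mset M \<subseteq> carrier G" "n > 0" "\<not> p dvd n"
    and "\<And>x. x \<in># M \<Longrightarrow> ord x dvd p ^ a * n"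
    and "set_mset X \<subseteq> carrier G" "\<And>x. x \<in># X \<Longrightarrow> ord x dvd p ^ a * D" "mass p X < 1"
    and "D * q ^ k dvd n"
    and "\<And>y i. y \<in> carrier G \<Longrightarrow> i \<le> k \<Longrightarrow> ord y dvd D * q ^ i \<Longrightarrow> 1 / real (D * q ^ i) \<le> \<omega> y"
  shows "net n \<omega> (X + chain p q M D k) (cr X + (1 - 1 / real (p ^ a) - mass p X) / real D)"
  using net_chain[OF assms(1-12) Red_refl[of X] assms(13) _ _ assms(14,15)] by simp

text \<open>
  If the initial layers have mass at least \<open>1\<close>, at least one block comes out of them, and
  its product is worth \<open>1 / d\<close>.
\<close>

lemma net_overflow:
  assumes p: "prime p" and thin: "thin p" and d: "d > 0" "\<not> p dvd d" "d dvd n"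
    and X: "set_mset X \<subseteq> carrier G" "\<And>x. x \<in># X \<Longrightarrow> ord x dvd p ^ a * d" "1 \<le> mass p X"
    and \<omega>: "\<And>y. y \<in> carrier G \<Longrightarrow> ord y dvd d \<Longrightarrow> 1 / real d \<le> \<omega> y"
  shows "\<exists>R0 Q0. Red X R0 Q0 \<and> mass p R0 < 1 \<and> mass p X \<le> mass p R0 + real (size Q0) \<and>
    (\<forall>y\<in>#Q0. y \<in> carrier G \<and> ord y dvd n) \<and> 1 \<le> size Q0 \<and> real (size Q0) / real d \<le> (\<Sum>y\<in>#Q0. \<omega> y)"
proof -
  obtain R Q where RQ: "Red X R Q" "mass p R < 1" "mass p X \<le> mass p R + real (size Q)"
    "\<forall>y\<in>#Q. y \<in> carrier G \<and> \<not> p dvd ord y \<and> ord y dvd d"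
    using extract_blocks[OF p thin X(1,2)] by blast
  have "real (size Q) > 0" using X(3) RQ(2,3) by linarith
  then have "1 \<le> size Q" by simp
  moreover have "real (size Q) / real d \<le> (\<Sum>y\<in>#Q. \<omega> y)"
  proof -
    have "real (size Q) / real d = (\<Sum>y\<in>#Q. 1 / real d)" by (simp add: sum_mset_constant)
    also have "\<dots> \<le> (\<Sum>y\<in>#Q. \<omega> y)" using RQ(4) \<omega> by (intro sum_mset_mono) auto
    finally show ?thesis .
  qed
  moreover have "\<forall>y\<in>#Q. y \<in> carrier G \<and> ord y dvd n" using RQ(4) d(3) dvd_trans by blast
  ultimately show ?thesis using RQ(1-3) by blast
qed

text \<open>
  No block can be replaced by its product without decreasing the cross number. It is enough to bound
  the cross number of such multisets, because merging keeps zero-sum freeness and reduces the size.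
\<close>

definition dense :: "'a multiset \<Rightarrow> bool" where
  "dense M \<longleftrightarrow> (\<forall>E. E \<subseteq># M \<longrightarrow> 2 \<le> size E \<longrightarrow> 1 / real (ord (mprod E)) < cr E)"

text \<open>
  Otherwise a block of mass at most \<open>1\<close> in the layer could be merged: its cross number is at most
  \<open>1 / d\<close>, and its product has order dividing \<open>d\<close>.
\<close>

lemma mass_layer_less_one:
  assumes p: "prime p" and thin: "thin p" and M: "set_mset M \<subseteq> carrier G" and dn: "dense M"
    and d: "d > 0" "\<not> p dvd d" and o: "\<And>x. x \<in># M \<Longrightarrow> ord x dvd p ^ a * n" and n: "n > 0" "\<not> p dvd n"
  shows "mass p (layer p M d) < 1"
proof (rule ccontr)
  assume "\<not> ?thesis"
  moreover have Lc: "set_mset (layer p M d) \<subseteq> carrier G" using M by (auto simp: layer_def)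
  ultimately obtain E where E: "E \<subseteq># layer p M d" "E \<noteq> {#}" "mass p E \<le> 1" "\<not> p dvd ord (mprod E)"
    using exists_p_free_block[OF p thin, of "layer p M d"] by auto
  have sub: "layer p M d \<subseteq># M" by (simp add: layer_def)
  have EM: "E \<subseteq># M" using E(1) sub subset_mset.order_trans by blast
  have el: "x \<in> carrier G" "p dvd ord x" "cofactor p x = d" "ord x dvd p ^ a * d" if "x \<in># E" for x
  proof -
    have xl: "x \<in># layer p M d" using E(1) that by (auto dest: mset_subset_eqD)
    then show "x \<in> carrier G" "p dvd ord x" "cofactor p x = d" using M by (auto simp: layer_def)
    have "x \<in># M" using xl by (auto simp: layer_def)
    then have "multiplicity p (ord x) \<le> a" using multiplicity_le_if_dvd[OF p n(2) o n(1)] by blast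
    then show "ord x dvd p ^ a * d"
      using ord_cofactor[OF \<open>x \<in> carrier G\<close>, of p] \<open>cofactor p x = d\<close>
      by (metis dvd_refl le_imp_power_dvd mult_dvd_mono)
  qed
  have Ec: "set_mset E \<subseteq> carrier G" using el by auto
  have "layer p E d = {#x \<in># E. True#}"
    unfolding layer_def by (rule filter_mset_cong) (use el in auto)
  then have "E = layer p E d" by simp
  then have crE: "cr E = mass p E / real d" using cr_layer[OF Ec, of p d] by simp
  have "ord (mprod E) dvd p ^ a * d" using Ec el by (intro ord_mprod_dvd)
  moreover have "coprime (ord (mprod E)) (p ^ a)"
    using E(4) p by (metis coprime_commute coprime_power_left_iff prime_imp_coprime)
  ultimately have "ord (mprod E) dvd d" by (simp add: coprime_dvd_mult_right_iff)
  then have "ord (mprod E) \<le> d" using d(1) dvd_imp_le by blast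
  then have "1 / real d \<le> 1 / real (ord (mprod E))" using ord_pos[OF mprod_closed] d(1) by (intro divide_left_mono) auto
  moreover have "cr E \<le> 1 / real d" using crE E(3) by (simp add: divide_right_mono)
  moreover have "2 \<le> size E"
  proof (rule ccontr)
    assume "\<not> 2 \<le> size E"
    then have "size E = 1" using E(2) by (metis One_nat_def Suc_1 Suc_leI less_2_cases_iff not_less size_eq_0_iff_empty)
    then obtain x where "E = {#x#}" using size_1_singleton_mset by blast
    then show False using E(4) el[of x] by simp
  qed
  ultimately show False using dn EM unfolding dense_def by fastforce
qed

lemma ord_prime_power_layer:
  assumes "prime p" "x \<in> carrier G" "p dvd ord x" "cofactor p x = 1"
  shows "\<exists>j\<ge>1. ord x = p ^ j"
proof -
  have "ord x = p ^ multiplicity p (ord x)" using ord_cofactor[OF assms(2), of p] assms(4) by simp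
  moreover have "multiplicity p (ord x) \<ge> 1"
    using assms(1,3) ord_pos[OF assms(2)] not_prime_1
    by (metis dvd_1_iff_1 calculation less_one not_le power_0 One_nat_def)
  ultimately show ?thesis by blast
qed

text \<open>
  Split the elements of \<open>p\<close>-power order into those of order \<open>p\<close>, at most \<open>p - 2\<close> in number, and the
  rest \<open>C'\<close>. Taking \<open>p\<close>-th powers multiplies the cross number of \<open>C'\<close> by \<open>p\<close>. If that reached \<open>1\<close>,
  some block of \<open>C'\<close> with cross number at most \<open>1 / p\<close> would have a product killed by \<open>p\<close>, hence of
  order \<open>p\<close>, and could be merged. So \<open>p cr C' < 1\<close>, and by integrality
  \<open>cr C' \<le> 1 / p - 1 / p\<^sup>a\<close>.
\<close>

lemma mass_layer_one_le:
  assumes p: "prime p" and thin: "thin p" and M: "zsf M" and dn: "dense M"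
    and o: "\<And>x. x \<in># M \<Longrightarrow> ord x dvd p ^ a * n" and n: "n > 0" "\<not> p dvd n" and a: "a \<ge> 1"
    and small: "size {#x \<in># M. ord x = p#} + 2 \<le> p"
  shows "mass p (layer p M 1) \<le> 1 - 1 / real (p ^ a) - 1 / real p"
proof -
  have p0: "p > 0" "p > 1" using p prime_gt_0_nat prime_gt_1_nat by auto
  have Mc: "set_mset M \<subseteq> carrier G" using M zsf_carrier by blast
  define C L C' where "C = layer p M 1" and "L = {#x \<in># C. ord x = p#}" and "C' = {#x \<in># C. ord x \<noteq> p#}"
  have CLC: "C = L + C'" unfolding L_def C'_def by (rule multiset_partition)
  have CM: "C \<subseteq># M" unfolding C_def layer_def by simp
  have Cel: "x \<in> carrier G \<and> (\<exists>j. 1 \<le> j \<and> j \<le> a \<and> ord x = p ^ j)" if "x \<in># C" for x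
  proof -
    have x: "x \<in> carrier G" "p dvd ord x" "cofactor p x = 1" "x \<in># M"
      using that Mc by (auto simp: C_def layer_def)
    obtain j where j: "j \<ge> 1" "ord x = p ^ j" using ord_prime_power_layer[OF p x(1-3)] by blast
    have "multiplicity p (ord x) \<le> a" using multiplicity_le_if_dvd[OF p n(2) o[OF x(4)] n(1)] .
    then have "j \<le> a" using j(2) p by simp
    then show ?thesis using j x(1) by blast
  qed
  have C'el: "x \<in> carrier G \<and> (\<exists>j. 2 \<le> j \<and> j \<le> a \<and> ord x = p ^ j)" if "x \<in># C'" for x
  proof -
    have "x \<in># C" "ord x \<noteq> p" using that by (auto simp: C'_def)
    then obtain j where j: "1 \<le> j" "j \<le> a" "ord x = p ^ j" "x \<in> carrier G" using Cel by blast
    then have "j \<noteq> 1" using \<open>ord x \<noteq> p\<close> by auto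
    then show ?thesis using j by (intro conjI exI[of _ j]) auto
  qed
  have C'c: "set_mset C' \<subseteq> carrier G" using C'el by auto
  have opow: "ord (x [^] p) = p ^ (j - 1)" if "x \<in> carrier G" "ord x = p ^ j" "2 \<le> j" for x j
  proof -
    have "p dvd ord x" using that by (simp add: dvd_power)
    then have "ord (x [^] p) = ord x div p" using ord_pow[of x p] that p0 by simp
    also have "p ^ j = p * p ^ (j - 1)" using that(3) by (metis Suc_1 Suc_le_D diff_Suc_1 power_Suc)
    then have "ord x div p = p ^ (j - 1)" using that(2) p0 by simp
    finally show ?thesis .
  qed
  let ?I = "\<lambda>X. image_mset (\<lambda>x. x [^] p) X"
  have massI: "mass p (?I X) = real p * cr X" if "set_mset X \<subseteq> set_mset C'" for X
    using that
  proof (induction X)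
    case (add x X)
    then obtain j where j: "x \<in> carrier G" "2 \<le> j" "ord x = p ^ j" using C'el by fastforce
    have "1 / real (p ^ (j - 1)) = real p * (1 / real (p ^ j))"
    proof -
      have "p ^ j = p * p ^ (j - 1)" using j(2) by (metis Suc_1 Suc_le_D diff_Suc_1 power_Suc)
      then show ?thesis using p0 by simp
    qed
    then show ?case using add opow[OF j(1,3,2)] p j(3) by (simp add: distrib_left)
  qed simp
  have small': "real p * cr C' < 1"
  proof (rule ccontr)
    assume "\<not> ?thesis"
    then have "mass p (?I C') \<ge> 1" using massI by simp
    then obtain E where E: "E \<subseteq># ?I C'" "E \<noteq> {#}" "mass p E \<le> 1" "\<not> p dvd ord (mprod E)"
      using exists_p_free_block[OF p thin, of "?I C'"] C'c by auto
    obtain E' where E': "E' \<subseteq># C'" "E = ?I E'"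
      using E(1) by (metis image_mset_eq_plusD mset_subset_eq_add_left subset_mset.add_diff_inverse)
    have E'C: "set_mset E' \<subseteq> set_mset C'" using E'(1) by (rule set_mset_mono)
    have E'ne: "E' \<noteq> {#}" using E(2) E' by auto
    have E'c: "set_mset E' \<subseteq> carrier G" using E'C C'c by blast
    have EM: "E' \<subseteq># M" using E'(1) CM CLC by (metis mset_subset_eq_add_right subset_mset.order_trans)
    have "ord (mprod E) dvd p ^ a * 1"
    proof (rule ord_mprod_dvd)
      show "set_mset E \<subseteq> carrier G" using E' E'c by auto
      fix y assume "y \<in># E"
      then obtain x where x: "x \<in># C'" "y = x [^] p" using E' E'C by auto
      then obtain j where j: "x \<in> carrier G" "2 \<le> j" "j \<le> a" "ord x = p ^ j" using C'el by blast
      then have "ord y = p ^ (j - 1)" using opow x by simp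
      then show "ord y dvd p ^ a * 1" using j(3) by (simp add: le_imp_power_dvd)
    qed
    moreover have "coprime (ord (mprod E)) (p ^ a)"
      using E(4) p by (metis coprime_commute coprime_power_left_iff prime_imp_coprime)
    ultimately have "ord (mprod E) dvd 1" by (simp only: coprime_dvd_mult_right_iff)
    then have "mprod E = \<one>" using ord_eq_1[OF mprod_closed] by simp
    then have pw: "mprod E' [^] p = \<one>" using mprod_pow[OF E'c, of p] E'(2) by simp
    have ne: "mprod E' \<noteq> \<one>" using zsf_mprod[OF M EM E'ne] .
    have "ord (mprod E') dvd p" using pw pow_one_iff[OF mprod_closed] by blast
    then have "ord (mprod E') = p" using p ne ord_eq_1[OF mprod_closed] prime_nat_iff by blast
    moreover have "cr E' \<le> 1 / real p"
      using massI[OF E'C] E(3) E'(2) p0 by (simp add: field_simps)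
    moreover have "2 \<le> size E'"
    proof (rule ccontr)
      assume "\<not> 2 \<le> size E'"
      then have "size E' = 1" using E'ne by (metis One_nat_def Suc_1 Suc_leI less_2_cases_iff not_less size_eq_0_iff_empty)
      then obtain x where x: "E' = {#x#}" using size_1_singleton_mset by blast
      then have "x \<in># C'" using E'C by auto
      then obtain j where j: "x \<in> carrier G" "2 \<le> j" "j \<le> a" "ord x = p ^ j" using C'el by blast
      have "ord x dvd p" using pw x j(1) pow_one_iff by simp
      then have "p ^ j dvd p ^ 1" using j by simp
      then have "j \<le> 1" using p0(2) power_dvd_imp_le by blast
      then show False using j(2) by simp
    qed
    ultimately show False using dn EM unfolding dense_def by fastforce
  qed
  have "real p * cr C' \<le> 1 - 1 / real (p ^ (a - 1))"
  proof -
    have "mass p (?I C') \<le> 1 - 1 / real (p ^ (a - 1))"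
    proof (rule mass_lt_one_le[OF p0(1)])
      show "mass p (?I C') < 1" using small' massI by simp
      fix y assume "y \<in># ?I C'"
      then obtain x where x: "x \<in># C'" "y = x [^] p" by auto
      then obtain j where j: "x \<in> carrier G" "2 \<le> j" "j \<le> a" "ord x = p ^ j" using C'el by blast
      then have "ord y = p ^ (j - 1)" using opow x by simp
      then show "multiplicity p (ord y) \<le> a - 1" using p j(3) by simp
    qed
    then show ?thesis using massI by simp
  qed
  moreover have "p ^ a = p * p ^ (a - 1)" using a by (metis One_nat_def Suc_le_D diff_Suc_1 power_Suc)
  then have "1 / real (p ^ (a - 1)) = real p * (1 / real (p ^ a))" using p0 by simp
  ultimately have C'b: "cr C' \<le> 1 / real p - 1 / real (p ^ a)"
    using p0 by (simp add: field_simps del: of_nat_power)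
  have "mass p C = cr C"
  proof -
    have "1 / real (p ^ multiplicity p (ord x)) = 1 / real (ord x)" if "x \<in># C" for x
      using Cel[OF that] p by auto
    then show ?thesis unfolding mass_def cr_def by (intro arg_cong[where f=sum_mset] image_mset_cong) auto
  qed
  moreover have "cr L = real (size L) / real p"
  proof -
    have "cr L = (\<Sum>x\<in>#L. 1 / real p)" unfolding cr_def
      by (intro arg_cong[where f=sum_mset] image_mset_cong) (auto simp: L_def)
    then show ?thesis by (simp add: sum_mset_constant)
  qed
  moreover have "size L \<le> size {#x \<in># M. ord x = p#}"
    unfolding L_def using CM by (intro size_mset_mono multiset_filter_mono)
  then have "real (size L) \<le> real p - 2" using small by linarith
  then have "real (size L) / real p \<le> (real p - 2) / real p" by (rule divide_right_mono) simp
  moreover have "(real p - 2) / real p = 1 - 2 / real p" using p0 by (simp add: field_simps)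
  ultimately show ?thesis using CLC C'b unfolding C_def by simp
qed

lemma subset_add_msetE:
  assumes "E \<subseteq># add_mset x L"
  shows "E \<subseteq># L \<or> (\<exists>E'. E = add_mset x E' \<and> E' \<subseteq># L)"
proof (cases "x \<in># E")
  case True
  then obtain E' where "E = add_mset x E'" by (metis multi_member_split)
  then show ?thesis using assms by auto
next
  case False
  then show ?thesis using assms
    by (metis diff_single_trivial subset_eq_diff_conv add_mset_add_single)
qed

end

section \<open>The induction step\<close>

text \<open>
  \<open>P\<close> will be the largest prime of the exponent, and \<open>KP\<close> the value of \<open>k\<^sup>*\<close> of its component, which
  may have any rank.
\<close>

locale cross_setting = fin_comm_group G for G (structure) +
  fixes P :: nat and KP :: real
  assumes P: "prime P"
    and base: "\<And>M. zsf M \<Longrightarrow> (\<And>x. x \<in># M \<Longrightarrow> \<exists>k. ord x = P ^ k) \<Longrightarrow> cr M \<le> KP"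
    and thin: "\<And>p. prime p \<Longrightarrow> p < P \<Longrightarrow> thin p"
begin

text \<open>
  The value of \<open>k\<^sup>*\<close> when, for each prime \<open>p\<close> below \<open>P\<close>, the \<open>p\<close>-component is cyclic and its order is the
  full power of \<open>p\<close> in \<open>e\<close>.
\<close>

definition Kb :: "nat \<Rightarrow> real" where
  "Kb e = KP + (\<Sum>p | prime p \<and> p < P. 1 - 1 / real (p ^ multiplicity p e))"

definition bound :: "nat \<Rightarrow> bool" where
  "bound e \<longleftrightarrow> (\<forall>M. zsf M \<longrightarrow> (\<forall>x\<in>#M. ord x dvd e) \<longrightarrow> cr M \<le> Kb e)"

lemma boundD: "bound e \<Longrightarrow> zsf M \<Longrightarrow> (\<And>x. x \<in># M \<Longrightarrow> ord x dvd e) \<Longrightarrow> cr M \<le> Kb e"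
  by (simp add: bound_def)

lemma Kb_split:
  assumes p: "prime p" "p < P" and n: "n > 0" "\<not> p dvd n"
  shows "Kb (p ^ a * n) = Kb n + (1 - 1 / real (p ^ a))"
proof -
  let ?S = "{p. prime p \<and> p < P}"
  have fS: "finite ?S" by (rule finite_subset[of _ "{..<P}"]) auto
  have pS: "p \<in> ?S" using p by simp
  have "(\<Sum>s\<in>?S - {p}. 1 - 1 / real (s ^ multiplicity s (p ^ a * n))) =
      (\<Sum>s\<in>?S - {p}. 1 - 1 / real (s ^ multiplicity s n))"
  proof (rule sum.cong[OF refl])
    fix s assume s: "s \<in> ?S - {p}"
    then have "multiplicity s (p ^ a * n) = multiplicity s (p ^ a) + multiplicity s n"
      using n p by (intro prime_elem_multiplicity_mult_distrib) (auto simp: prime_gt_0_nat)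
    also have "multiplicity s (p ^ a) = 0" using s p by (intro multiplicity_distinct_prime_power) auto
    finally show "1 - 1 / real (s ^ multiplicity s (p ^ a * n)) = 1 - 1 / real (s ^ multiplicity s n)" by simp
  qed
  then show ?thesis
    unfolding Kb_def sum.remove[OF fS pS] multiplicity_power_times[OF p(1) n(2)]
    using n by (simp add: not_dvd_imp_multiplicity_0)
qed

text \<open>
  The kept part of \<open>M\<close> together with the products is zero-sum free with orders dividing \<open>n\<close>.
\<close>

lemma net_bound:
  assumes z: "zsf (A + X)" and A: "\<And>x. x \<in># A \<Longrightarrow> ord x dvd n" and b: "bound n"
    and net: "net n (\<lambda>y. 1 / real (ord y)) X v"
  shows "cr (A + X) \<le> Kb n + v"
proof -
  obtain R Q where RQ: "Red X R Q" "\<forall>y\<in>#Q. y \<in> carrier G \<and> ord y dvd n"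
    "cr X - (\<Sum>y\<in>#Q. 1 / real (ord y)) \<le> v"
    using net unfolding net_def by (elim exE conjE)
  have "zsf (X + A)" using z by (simp add: add.commute)
  then have "zsf (R + Q + A)" using Red_zsf[OF RQ(1)] by blast
  moreover have "A + Q \<subseteq># R + Q + A" by (simp add: add.commute add.assoc)
  ultimately have "zsf (A + Q)" by (rule zsf_sub)
  then have "cr (A + Q) \<le> Kb n" by (rule boundD[OF b]) (use A RQ(2) in auto)
  then show ?thesis using RQ(3) unfolding cr_def by simp
qed

text \<open>
  Let \<open>L\<close> be the elements of order \<open>p\<close>, at least \<open>p - 1\<close> many, and \<open>N\<close> the others. The \<open>p\<close>-th powers
  of \<open>N\<close> are zero-sum free: if a product \<open>h\<close> of elements of \<open>N\<close> had order \<open>p\<close>, then adjoining it to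
  \<open>L\<close> would give \<open>p\<close> elements of order \<open>p\<close>, of mass \<open>1\<close>, and hence a nonempty subproduct of \<open>M\<close>
  equal to \<open>\<one>\<close>. Write \<open>A\<close> and \<open>B\<close> for the elements of \<open>N\<close> of order prime to \<open>p\<close> and divisible by \<open>p\<close>.
  The induction hypothesis for \<open>p^(a - 1) n\<close> bounds \<open>cr A + p cr B\<close>, and the one for \<open>n\<close> bounds \<open>cr A\<close>;
  adding \<open>p - 1\<close> times the second to the first bounds \<open>p cr N\<close>, and \<open>cr L \<le> 1 - 1 / p\<close>.
\<close>

lemma full_level_bound:
  assumes p: "prime p" "p < P" and n: "n > 0" "\<not> p dvd n" and a: "a \<ge> 1"
    and b1: "bound (p ^ (a - 1) * n)" and b2: "bound n"
    and M: "zsf M" "\<And>x. x \<in># M \<Longrightarrow> ord x dvd p ^ a * n"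
    and full: "p \<le> size {#x \<in># M. ord x = p#} + 1"
  shows "cr M \<le> Kb (p ^ a * n)"
proof -
  have p0: "p > 0" "p > 1" using p prime_gt_0_nat prime_gt_1_nat by auto
  have Mc: "set_mset M \<subseteq> carrier G" using M zsf_carrier by blast
  have pa: "p ^ a = p * p ^ (a - 1)" using a by (metis One_nat_def Suc_le_D diff_Suc_1 power_Suc)
  define L N where "L = {#x \<in># M. ord x = p#}" and "N = {#x \<in># M. ord x \<noteq> p#}"
  have MLN: "M = L + N" unfolding L_def N_def by (rule multiset_partition)
  have Nc: "set_mset N \<subseteq> carrier G" using Mc by (auto simp: N_def)
  have Lc: "set_mset L \<subseteq> carrier G" using Mc by (auto simp: L_def)
  have massL: "mass p X = real (size X) / real p" if "\<And>x. x \<in># X \<Longrightarrow> ord x = p" for X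
    using that p by (induction X) (auto simp: add_divide_distrib)
  have "zsf (image_mset (\<lambda>x. x [^] p) N)"
  proof (rule zsf_pow[OF Nc])
    fix T assume T: "T \<subseteq># N" "T \<noteq> {#}"
    have TM: "T \<subseteq># M" using T(1) MLN by (metis mset_subset_eq_add_right subset_mset.order_trans)
    show "mprod T [^] p \<noteq> \<one>"
    proof
      assume "mprod T [^] p = \<one>"
      define h where "h = mprod T"
      have h: "h \<in> carrier G" "h \<noteq> \<one>" unfolding h_def using zsf_mprod[OF M(1) TM T(2)] by auto
      have "ord h dvd p" using \<open>mprod T [^] p = \<one>\<close> pow_one_iff h(1) unfolding h_def by blast
      then have oh: "ord h = p" using p(1) h ord_eq_1[OF h(1)] prime_nat_iff by blast
      have ol: "ord x = p" if "x \<in># add_mset h L" for x using that oh by (auto simp: L_def)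
      have "mass p (add_mset h L) = real (size L + 1) / real p"
        using massL[of "add_mset h L"] ol by simp
      moreover have "real p \<le> real (size L + 1)" using full unfolding L_def by (simp only: of_nat_le_iff)
      ultimately have "1 \<le> mass p (add_mset h L)" using p0 by simp
      then obtain E where E: "E \<subseteq># add_mset h L" "E \<noteq> {#}" "\<not> p dvd ord (mprod E)"
        using exists_p_free_block[OF p(1) thin[OF p], of "add_mset h L"] Lc h by auto
      have "ord (mprod E) dvd p"
      proof (rule ord_mprod_dvd)
        show "set_mset E \<subseteq> carrier G" using set_mset_mono[OF E(1)] h(1) Lc by auto
        fix x assume "x \<in># E"
        then have "x \<in># add_mset h L" using E(1) by (rule mset_subset_eqD[rotated])
        then show "ord x dvd p" using ol by simp
      qed
      then have "ord (mprod E) = 1" using E(3) p(1) prime_nat_iff by blast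
      then have one: "mprod E = \<one>" using ord_eq_1[OF mprod_closed] by blast
      consider "E \<subseteq># L" | E' where "E = add_mset h E'" "E' \<subseteq># L" using subset_add_msetE[OF E(1)] by blast
      then show False
      proof cases
        case 1
        then have "E \<subseteq># M" using MLN by (metis mset_subset_eq_add_left subset_mset.order_trans)
        then show False using zsf_mprod[OF M(1)] E(2) one by blast
      next
        case 2
        have "E' + T \<subseteq># M" unfolding MLN by (rule subset_mset.add_mono[OF 2(2) T(1)])
        moreover have "mprod (E' + T) = mprod E" using 2(1) h(1) m_comm[of "mprod E'" h] by (simp add: h_def)
        ultimately show False using zsf_mprod[OF M(1), of "E' + T"] T(2) one by auto
      qed
    qed
  qed
  moreover have "ord y dvd p ^ (a - 1) * n" if y: "y \<in># image_mset (\<lambda>x. x [^] p) N" for y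
  proof -
    obtain x where x: "x \<in># N" "y = x [^] p" "x \<in> carrier G" using y Nc by auto
    then have "ord x dvd p ^ a * n" using M(2) by (auto simp: N_def)
    then have "x [^] (p ^ a * n) = \<one>" using x pow_one_iff by blast
    then have "y [^] (p ^ (a - 1) * n) = \<one>" using x pa by (simp add: nat_pow_pow mult.assoc)
    then show ?thesis using x pow_one_iff by (metis nat_pow_closed)
  qed
  ultimately have crI: "cr (image_mset (\<lambda>x. x [^] p) N) \<le> Kb (p ^ (a - 1) * n)"
    by (rule boundD[OF b1])
  define A B where "A = {#x \<in># N. \<not> p dvd ord x#}" and "B = {#x \<in># N. p dvd ord x#}"
  have NAB: "N = B + A" unfolding A_def B_def by (rule multiset_partition)
  have crA: "cr (image_mset (\<lambda>x. x [^] p) X) = cr X"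
    if "\<And>x. x \<in># X \<Longrightarrow> x \<in> carrier G \<and> \<not> p dvd ord x" for X
    using that
  proof (induction X)
    case (add x X)
    then have "coprime (ord x) p" using p(1) by (meson coprime_commute prime_imp_coprime union_single_eq_member)
    then have "ord (x [^] p) = ord x" using ord_pow_gen[of x p] add.prems[of x] p0 by simp
    then show ?case using add by simp
  qed simp
  have crB: "cr (image_mset (\<lambda>x. x [^] p) X) = real p * cr X"
    if "\<And>x. x \<in># X \<Longrightarrow> x \<in> carrier G \<and> p dvd ord x" for X
    using that
  proof (induction X)
    case (add x X)
    then have x: "x \<in> carrier G" "p dvd ord x" by auto
    then have "ord (x [^] p) = ord x div p" using ord_pow[of x p] p0 by simp
    then have "1 / real (ord (x [^] p)) = real p * (1 / real (ord x))"
      using x(2) p0 by (simp add: real_of_nat_div)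
    then show ?case using add by (simp add: distrib_left)
  qed simp
  have "cr (image_mset (\<lambda>x. x [^] p) A) = cr A" by (rule crA) (use Nc in \<open>auto simp: A_def\<close>)
  moreover have "cr (image_mset (\<lambda>x. x [^] p) B) = real p * cr B"
    by (rule crB) (use Nc in \<open>auto simp: B_def\<close>)
  ultimately have 1: "cr A + real p * cr B \<le> Kb n + (1 - 1 / real (p ^ (a - 1)))"
    using crI Kb_split[OF p n, of "a - 1"] unfolding NAB image_mset_union cr_simps by linarith
  have 2: "cr A \<le> Kb n"
  proof (rule boundD[OF b2])
    have "A \<subseteq># M"
      unfolding A_def N_def by (rule subset_mset.order_trans[OF multiset_filter_subset multiset_filter_subset])
    then show "zsf A" by (rule zsf_sub[OF M(1)])
    fix x assume x: "x \<in># A"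
    then have "ord x dvd p ^ a * n" "\<not> p dvd ord x" using M(2) by (auto simp: A_def N_def)
    moreover from this have "coprime (ord x) (p ^ a)"
      using p by (metis coprime_commute coprime_power_left_iff prime_imp_coprime)
    ultimately show "ord x dvd n" by (simp add: coprime_dvd_mult_right_iff)
  qed
  have crL: "cr L = real (size L) / real p"
  proof -
    have "cr L = (\<Sum>x\<in>#L. 1 / real p)" unfolding cr_def
      by (intro arg_cong[where f=sum_mset] image_mset_cong) (auto simp: L_def)
    then show ?thesis by (simp add: sum_mset_constant)
  qed
  have "cr L < 1"
  proof -
    have "zsf L" using M(1) by (rule zsf_sub) (simp add: L_def)
    moreover have "\<forall>x\<in>#L. \<exists>k. ord x = p ^ k" by (auto simp: L_def intro: exI[of _ 1])
    ultimately show ?thesis using thin[OF p] unfolding thin_def by blast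
  qed
  then have "real (size L) < real p" using crL p0 by simp
  then have "size L + 1 \<le> p" by simp
  then have "real (size L) \<le> real p - 1" by linarith
  then have crL': "real p * cr L \<le> real p - 1" using crL p0 by simp
  have "(real p - 1) * cr A \<le> (real p - 1) * Kb n" using 2 p0 by (intro mult_left_mono) auto
  then have "real p * (cr A + cr B) \<le> real p * Kb n + (1 - 1 / real (p ^ (a - 1)))"
    using 1 by (simp add: algebra_simps)
  then have "real p * cr M \<le> real p * Kb n + (1 - 1 / real (p ^ (a - 1))) + (real p - 1)"
    using crL' unfolding MLN NAB by (simp add: algebra_simps)
  also have "1 / real (p ^ (a - 1)) = real p * (1 / real (p ^ a))" using pa p0 by simp
  finally have "real p * cr M \<le> real p * (Kb n + (1 - 1 / real (p ^ a)))"
    by (simp add: algebra_simps)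
  then show ?thesis using Kb_split[OF p n, of a] p0 by simp
qed

end

lemma multiset_sum_filter:
  assumes "finite F" "\<And>x. x \<in># B \<Longrightarrow> \<exists>!f. f \<in> F \<and> R x f"
  shows "B = (\<Sum>f\<in>F. {#x \<in># B. R x f#})"
proof (rule multiset_eqI)
  fix x
  have "count (\<Sum>f\<in>F. {#x \<in># B. R x f#}) x = (\<Sum>f\<in>F. if R x f then count B x else 0)"
    by (simp add: count_sum)
  also have "\<dots> = count B x"
  proof (cases "x \<in># B")
    case True
    then obtain f where f: "f \<in> F" "R x f" "\<And>g. g \<in> F \<Longrightarrow> R x g \<Longrightarrow> g = f" using assms(2) by blast
    have "(\<Sum>g\<in>F. if R x g then count B x else 0) = (\<Sum>g\<in>F. if g = f then count B x else 0)"
    proof (rule sum.cong[OF refl])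
      fix g assume "g \<in> F"
      then have "R x g \<longleftrightarrow> g = f" using f by blast
      then show "(if R x g then count B x else 0) = (if g = f then count B x else 0)" by simp
    qed
    then show ?thesis using f(1) assms(1) by simp
  next
    case False
    then have "count B x = 0" by (simp add: not_in_iff)
    then show ?thesis by (intro trans[OF sum.neutral]) auto
  qed
  finally show "count B x = count (\<Sum>f\<in>F. {#x \<in># B. R x f#}) x" ..
qed

context fin_comm_group begin

lemma chains_partition:
  assumes p: "prime p" and q: "prime q" "p < q" and e: "e > 0"
    and small: "\<And>s. prime s \<Longrightarrow> s dvd e \<Longrightarrow> p \<le> s"
    and least: "\<And>s. prime s \<Longrightarrow> s dvd e \<Longrightarrow> p < s \<Longrightarrow> q \<le> s"
    and M: "set_mset M \<subseteq> carrier G" "\<And>x. x \<in># M \<Longrightarrow> ord x dvd e"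
  shows "{#x \<in># M. p dvd ord x#} = (\<Sum>f\<in>rough q e. chain p q M f (multiplicity q e))"
proof -
  let ?k = "multiplicity q e"
  let ?B = "{#x \<in># M. p dvd ord x#}"
  let ?R = "\<lambda>x f. \<exists>i\<le>?k. cofactor p x = f * q ^ i"
  have "?B = (\<Sum>f\<in>rough q e. {#x \<in># ?B. ?R x f#})"
  proof (rule multiset_sum_filter)
    show "finite (rough q e)" using e by simp
    fix x assume "x \<in># ?B"
    then have x: "x \<in> carrier G" "ord x dvd e" using M by auto
    have "cofactor p x dvd ord x" using ord_cofactor[OF x(1), of p] by (metis dvd_triv_right)
    then have ce: "cofactor p x dvd e" using x(2) dvd_trans by blast
    have "cofactor p x \<in> rough p e"
    proof -
      have "p < s" if "prime s" "s dvd cofactor p x" for s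
      proof -
        have "p \<le> s" using small that ce dvd_trans by blast
        moreover have "s \<noteq> p" using cofactor_not_dvd[OF p x(1)] that(2) by blast
        ultimately show ?thesis by simp
      qed
      then show ?thesis using ce by (simp add: rough_def)
    qed
    then obtain i f where f: "i \<le> ?k" "f \<in> rough q e" "cofactor p x = q ^ i * f"
      using rough_split[OF q e least] by blast
    show "\<exists>!f. f \<in> rough q e \<and> ?R x f"
    proof (rule ex1I[of _ f])
      show "f \<in> rough q e \<and> ?R x f" using f by (auto simp: mult.commute)
      fix g assume g: "g \<in> rough q e \<and> ?R x g"
      then obtain j where "cofactor p x = q ^ j * g" by (auto simp: mult.commute)
      then show "g = f"
        using rough_factor_inj[OF q(1) rough_not_dvd[OF q(1)] rough_not_dvd[OF q(1)]] f g by metis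
    qed
  qed
  moreover have "{#x \<in># ?B. ?R x f#} = chain p q M f ?k" for f
    unfolding chain_def by (simp add: filter_filter_mset conj_commute)
  ultimately show ?thesis by simp
qed

lemma rough_chain_dvd:
  assumes p: "prime p" and q: "prime q" "p < q" and f: "f \<in> rough q (p ^ a * n)"
    and k: "k \<le> multiplicity q (p ^ a * n)"
  shows "f * q ^ k dvd n" "\<not> p dvd f"
proof -
  have "q ^ k * f \<in> rough p (p ^ a * n)" using rough_join[OF q k f] .
  then have *: "q ^ k * f dvd p ^ a * n" "\<And>s. prime s \<Longrightarrow> s dvd q ^ k * f \<Longrightarrow> p < s"
    by (auto simp: rough_def)
  have nd: "\<not> p dvd q ^ k * f" using *(2)[OF p] by auto
  then have "coprime (q ^ k * f) (p ^ a)"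
    using p by (metis coprime_commute coprime_power_left_iff prime_imp_coprime)
  then have "q ^ k * f dvd n" using *(1) coprime_dvd_mult_right_iff by blast
  then show "f * q ^ k dvd n" by (simp only: mult.commute)
  show "\<not> p dvd f" using nd by auto
qed

text \<open>
  Chains started from nothing cost \<open>\<kappa> / f\<close> each.
\<close>

lemma net_plain_chains:
  assumes p: "prime p" and thin: "thin p" and q: "prime q" "p < q" and n: "n > 0" "\<not> p dvd n"
    and M: "set_mset M \<subseteq> carrier G" "\<And>x. x \<in># M \<Longrightarrow> ord x dvd p ^ a * n"
    and F: "F \<subseteq> rough q (p ^ a * n)" and k: "k \<le> multiplicity q (p ^ a * n)"
    and \<omega>: "\<And>f y i. f \<in> F \<Longrightarrow> y \<in> carrier G \<Longrightarrow> i \<le> k \<Longrightarrow> ord y dvd f * q ^ i \<Longrightarrow> 1 / real (f * q ^ i) \<le> \<omega> y"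
  shows "net n \<omega> (\<Sum>f\<in>F. chain p q M f k) ((1 - 1 / real (p ^ a)) * (\<Sum>f\<in>F. 1 / real f))"
proof -
  have e: "p ^ a * n > 0" using n p prime_gt_0_nat by simp
  have pq: "\<not> p dvd q" using p q primes_dvd_imp_eq by blast
  have "net n \<omega> (chain p q M f k) ((1 - 1 / real (p ^ a)) * (1 / real f))" if f: "f \<in> F" for f
  proof -
    have f': "f \<in> rough q (p ^ a * n)" "f > 0" using f F rough_pos[OF e] by auto
    have "net n \<omega> ({#} + chain p q M f k) (cr {#} + (1 - 1 / real (p ^ a) - mass p {#}) / real f)"
      by (rule net_chain_start[OF p thin _ pq f'(2) _ M(1) n M(2)])
        (use q prime_gt_0_nat rough_chain_dvd[OF p q f'(1) k] f' \<omega>[OF f] in auto)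
    then show ?thesis by simp
  qed
  moreover have "finite F" by (rule finite_subset[OF F finite_rough[OF e]])
  ultimately have "net n \<omega> (\<Sum>f\<in>F. chain p q M f k) (\<Sum>f\<in>F. (1 - 1 / real (p ^ a)) * (1 / real f))"
    by (intro net_sum)
  then show ?thesis by (simp only: sum_distrib_left)
qed

lemma one_over_ord_le:
  assumes "y \<in> carrier G" "ord y dvd d" "d > 0"
  shows "1 / real d \<le> 1 / real (ord y)"
proof -
  have "ord y \<le> d" using assms(2,3) dvd_imp_le by blast
  then show ?thesis using ord_pos[OF assms(1)] assms(3) by (intro divide_left_mono) auto
qed

lemma layer_elem:
  assumes p: "prime p" and n: "n > 0" "\<not> p dvd n"
    and M: "set_mset M \<subseteq> carrier G" "\<And>x. x \<in># M \<Longrightarrow> ord x dvd p ^ a * n" and x: "x \<in># layer p M d"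
  shows "x \<in> carrier G" "ord x dvd p ^ a * d"
proof -
  show "x \<in> carrier G" using x M by (auto simp: layer_def)
  have "\<exists>i\<le>0. \<exists>j\<le>a. ord x = p ^ j * (d * 1 ^ i)"
    by (rule chain_elem[OF p M(1) n M(2), where q=1]) (use x in \<open>auto simp: chain_0\<close>)
  then show "ord x dvd p ^ a * d" by (auto intro: mult_dvd_mono le_imp_power_dvd)
qed

lemma mass_layer_one_less:
  assumes p: "prime p" and thin: "thin p" and M: "zsf M"
  shows "mass p (layer p M 1) < 1"
proof -
  have Mc: "set_mset M \<subseteq> carrier G" using M zsf_carrier by blast
  have "zsf (layer p M 1)" using M by (rule zsf_sub) (simp add: layer_def)
  moreover have "\<forall>x\<in>#layer p M 1. \<exists>k. ord x = p ^ k"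
  proof
    fix x assume "x \<in># layer p M 1"
    then have "x \<in> carrier G" "p dvd ord x" "cofactor p x = 1" using Mc by (auto simp: layer_def)
    then show "\<exists>k. ord x = p ^ k" using ord_prime_power_layer[OF p] by blast
  qed
  ultimately have "cr (layer p M 1) < 1" using thin unfolding thin_def by blast
  then show ?thesis using cr_layer[OF Mc, of p 1] by simp
qed

end

context cross_setting begin

text \<open>
  The chain of \<open>f = 1\<close> is started from its lowest layer, of mass \<open>l\<close>. That layer costs \<open>l\<close>, and the
  rest of the chain only \<open>(\<kappa> - l) / q\<close>, as extraction begins at level \<open>q\<close>. All other chains cost
  \<open>\<kappa> / f\<close>.
\<close>

lemma chain_cross_bound:
  assumes p: "prime p" "p < P" and n: "n > 0" "\<not> p dvd n" and e: "e = p ^ a * n" and b: "bound n"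
    and q: "prime q" "p < q" "q dvd n"
    and small: "\<And>s. prime s \<Longrightarrow> s dvd e \<Longrightarrow> p \<le> s"
    and least: "\<And>s. prime s \<Longrightarrow> s dvd e \<Longrightarrow> p < s \<Longrightarrow> q \<le> s"
    and M: "zsf M" "\<And>x. x \<in># M \<Longrightarrow> ord x dvd e"
  defines "\<kappa> \<equiv> 1 - 1 / real (p ^ a)" and "l \<equiv> mass p (layer p M 1)"
  shows "cr M \<le> Kb n + (l + (\<kappa> - l) / real q + \<kappa> * (hsum q e - 1))"
proof -
  have Mc: "set_mset M \<subseteq> carrier G" using M zsf_carrier by blast
  have e0: "e > 0" using n p prime_gt_0_nat e by simp
  have pq: "\<not> p dvd q" using p q primes_dvd_imp_eq by blast
  let ?k = "multiplicity q e"
  let ?\<omega> = "\<lambda>y. 1 / real (ord y)"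
  have "q dvd e" using q(3) e by simp
  then have k1: "?k \<ge> 1" using q(1) e0
    by (metis One_nat_def Suc_leI multiplicity_gt_zero_iff not_prime_unit not_less_zero gr0I)
  obtain k' where k': "?k = Suc k'" using k1 by (metis One_nat_def Suc_le_D)
  define A B where "A = {#x \<in># M. \<not> p dvd ord x#}" and "B = {#x \<in># M. p dvd ord x#}"
  have MAB: "M = A + B" unfolding A_def B_def by (subst add.commute) (rule multiset_partition)
  have Mo: "\<And>x. x \<in># M \<Longrightarrow> ord x dvd p ^ a * n" using M(2) e by simp
  have fin: "finite (rough q e)" using e0 by simp
  have B: "B = chain p q M 1 ?k + (\<Sum>f\<in>rough q e - {1}. chain p q M f ?k)"
  proof -
    have "B = (\<Sum>f\<in>rough q e. chain p q M f ?k)"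
      unfolding B_def by (rule chains_partition[OF p(1) q(1,2) e0]) (use small least Mc M(2) in blast)+
    also have "\<dots> = chain p q M 1 ?k + (\<Sum>f\<in>rough q e - {1}. chain p q M f ?k)"
      by (rule sum.remove[OF fin]) simp
    finally show ?thesis .
  qed
  have 1: "net n ?\<omega> (chain p q M 1 ?k) (l + (\<kappa> - l) / real q)"
  proof -
    have s: "chain p q M 1 ?k = layer p M 1 + chain p q M (1 * q) k'"
      unfolding k' by (rule chain_Suc) (use q prime_gt_1_nat in auto)
    have "1 * q ^ ?k dvd n" using rough_chain_dvd[OF p(1) q(1,2), of 1 a n ?k] e by simp
    then have dv: "q * q ^ k' dvd n" using k' by simp
    have "net n ?\<omega> (layer p M 1 + chain p q M q k') (cr (layer p M 1) + (1 - 1 / real (p ^ a) - mass p (layer p M 1)) / real q)"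
    proof (rule net_chain_start[OF p(1) thin[OF p] _ pq _ pq Mc n Mo _ _ _ dv])
      show "set_mset (layer p M 1) \<subseteq> carrier G" using Mc by (auto simp: layer_def)
      show "mass p (layer p M 1) < 1" by (rule mass_layer_one_less[OF p(1) thin[OF p] M(1)])
      show "q > 0" "q > 0" using q prime_gt_0_nat by auto
      fix x assume "x \<in># layer p M 1"
      then have "ord x dvd p ^ a * 1" using layer_elem(2)[OF p(1) n Mc Mo] by blast
      then show "ord x dvd p ^ a * q" by (metis dvd_mult2 mult_1_right)
    qed (use q prime_gt_0_nat in \<open>auto intro!: one_over_ord_le simp del: of_nat_mult\<close>)
    then show ?thesis unfolding s using cr_layer[OF Mc, of p 1] by (simp add: l_def \<kappa>_def)
  qed
  have "net n ?\<omega> (\<Sum>f\<in>rough q e - {1}. chain p q M f ?k) (\<kappa> * (\<Sum>f\<in>rough q e - {1}. 1 / real f))"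
    unfolding \<kappa>_def
  proof (rule net_plain_chains[OF p(1) thin[OF p] q(1,2) n Mc Mo])
    show "rough q e - {1} \<subseteq> rough q (p ^ a * n)" "?k \<le> multiplicity q (p ^ a * n)" using e by auto
    fix f y i assume "f \<in> rough q e - {1}" "y \<in> carrier G" "ord y dvd f * q ^ i"
    then show "1 / real (f * q ^ i) \<le> 1 / real (ord y)"
      using rough_pos[OF e0, of f q] q prime_gt_0_nat by (intro one_over_ord_le) auto
  qed
  also have "(\<Sum>f\<in>rough q e - {1}. 1 / real f) = hsum q e - 1"
    unfolding hsum_def using sum.remove[OF fin, of 1 "\<lambda>f. 1 / real f"] by simp
  finally have "net n ?\<omega> B (l + (\<kappa> - l) / real q + \<kappa> * (hsum q e - 1))"
    unfolding B by (rule net_add[OF 1])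
  moreover have "ord x dvd n" if "x \<in># A" for x
  proof -
    have "ord x dvd p ^ a * n" "\<not> p dvd ord x" using that Mo by (auto simp: A_def)
    moreover from this have "coprime (ord x) (p ^ a)"
      using p by (metis coprime_commute coprime_power_left_iff prime_imp_coprime)
    ultimately show ?thesis by (simp add: coprime_dvd_mult_right_iff)
  qed
  ultimately show ?thesis using net_bound[OF _ _ b] M(1) MAB by metis
qed

end

section \<open>The primes 2 and 3\<close>

lemma geometric_le:
  assumes "r > 1"
  shows "(\<Sum>i\<le>v. 1 / real r ^ i) \<le> real r / (real r - 1)"
proof -
  have r: "real r > 1" using assms by simp
  have p: "real r ^ v > 0" using r by simp
  have "(\<Sum>i\<le>v. 1 / real r ^ i) = (real r ^ (v + 1) - 1) / (real r ^ v * (real r - 1))"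
    unfolding geometric_quotient[OF assms] by (simp add: algebra_simps)
  also have "\<dots> \<le> real r ^ (v + 1) / (real r ^ v * (real r - 1))"
    using r p by (intro divide_right_mono) auto
  also have "\<dots> = real r / (real r - 1)" using p by simp
  finally show ?thesis .
qed

lemma geometric_ge:
  assumes "j \<le> v"
  shows "(\<Sum>i\<le>j. 1 / real r ^ i) \<le> (\<Sum>i\<le>v. 1 / real r ^ i)"
  by (rule sum_mono2) (use assms in auto)

lemma hsum_top:
  assumes "e > 0" "\<And>s. prime s \<Longrightarrow> s dvd e \<Longrightarrow> s \<le> r"
  shows "hsum r e = 1"
proof -
  have "d = 1" if d: "d \<in> rough r e" for d
  proof (rule ccontr)
    assume "d \<noteq> 1"
    then obtain s where s: "prime s" "s dvd d" using prime_factor_nat by blast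
    have "s dvd e" using s(2) d dvd_trans unfolding rough_def by blast
    then have "s \<le> r" using assms(2) s(1) by blast
    moreover have "r < s" using s d unfolding rough_def by blast
    ultimately show False by simp
  qed
  then have "rough r e = {1}" by auto
  then show ?thesis by (simp add: hsum_def)
qed

context cross_setting begin

text \<open>
  Elements of order \<open>3\<close> are credited at only \<open>1 / 15\<close>. In the last case of the analysis below, the
  cost estimate uses no more than this, so each product of order \<open>3\<close> yields a surplus of \<open>4 / 15\<close>.
\<close>

definition light :: "'a \<Rightarrow> real" where
  "light y = (if ord y = 3 then 1 / 15 else 1 / real (ord y))"

lemma light_le:
  assumes "y \<in> carrier G" "ord y dvd D" "D > 0" "3 dvd D \<Longrightarrow> 15 \<le> D"
  shows "1 / real D \<le> light y"
proof (cases "ord y = 3")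
  case True
  then have "15 \<le> D" using assms by simp
  then have "1 / real D \<le> 1 / 15" by (intro divide_left_mono) auto
  then show ?thesis using True by (simp add: light_def)
next
  case False
  then show ?thesis using one_over_ord_le[OF assms(1-3)] by (simp add: light_def)
qed

lemma rough_three_ge:
  assumes "f \<in> rough 3 e" "f \<noteq> 1"
  shows "5 \<le> f"
proof -
  obtain s where s: "prime s" "s dvd f" using prime_factor_nat assms(2) by blast
  then have "3 < s" using assms(1) by (auto simp: rough_def)
  moreover have "s \<noteq> 4" using primes_dvd_imp_eq[OF two_is_prime_nat s(1)] by auto
  ultimately have "5 \<le> s" by simp
  moreover have "prime (3::nat)" by simp
  then have "f > 0" using assms(1) unfolding rough_def
    by (metis (mono_tags, lifting) dvd_0_right gr0I less_irrefl mem_Collect_eq)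
  ultimately show ?thesis using dvd_imp_le[OF s(2)] by simp
qed

text \<open>
  Write \<open>1 + Y\<close> for the sum of \<open>1 / f\<close> over divisors with primes above \<open>3\<close>; the simple chain bound
  suffices when \<open>Y \<le> 1 / 3\<close>. Otherwise the next prime \<open>r\<close> is \<open>5\<close> or \<open>7\<close>, as \<open>1 + Y\<close> is at most
  \<open>(r / (r - 1))\<^sup>2\<close>. Let \<open>l\<close>, \<open>x3\<close>, \<open>xr\<close> be the masses of the layers \<open>1\<close>, \<open>3\<close>, \<open>r\<close>; recall
  \<open>\<kappa> - l \<ge> 1 / 2\<close>. There are three cases.

  If \<open>l + x3 > \<kappa>\<close>, then layers \<open>1\<close> and \<open>3\<close> already yield a block, worth \<open>1 / 3\<close>, and the
  chain of \<open>1\<close> costs at most \<open>l + (\<kappa> - l) / 9\<close>, or just \<open>l\<close> if \<open>9\<close> does not divide \<open>e\<close>.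

  If \<open>l + x3 \<le> \<kappa> < l + xr\<close>, then layers \<open>1\<close> and \<open>r\<close> yield a block, worth \<open>1 / r\<close>. The chain of
  \<open>r\<close> is started from both layers, and the levels \<open>3, 9, \<dots>\<close> form a chain of their own.

  If neither is the case, all three chains are started from their lowest layers, and the smallness of
  \<open>x3\<close> and \<open>xr\<close> is enough unless \<open>r = 5\<close>, \<open>Y > 2 / 5\<close>, which excludes \<open>9\<close> dividing \<open>e\<close>. Then the loss exceeds
  \<open>\<kappa>\<close> by at most \<open>Y - 2 / 5 \<le> 1 / 10\<close>. Either some extracted product has order \<open>3\<close>, and the
  surplus from \<open>light\<close> pays for this; or at most one element of order \<open>3\<close> is present after the
  extraction, and the chain bound for the primes \<open>3\<close> and \<open>5\<close> improves on the induction hypothesis for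
  \<open>n\<close>.
\<close>

lemma two_three_bound:
  assumes P2: "2 < P" and n: "n > 0" "\<not> 2 dvd n" and e: "e = 2 ^ a * n" and b: "bound n" and a: "a \<ge> 1"
    and three: "3 dvd n"
    and le_P: "\<And>s. prime s \<Longrightarrow> s dvd e \<Longrightarrow> s \<le> P"
    and h2: "hsum 2 e \<le> 2"
    and h: "\<And>s. prime s \<Longrightarrow> s dvd e \<Longrightarrow> s < P \<Longrightarrow> hsum s e \<le> real s / (real s - 1)"
    and M: "zsf M" "\<And>x. x \<in># M \<Longrightarrow> ord x dvd e" and dn: "dense M"
    and l: "mass 2 (layer 2 M 1) \<le> 1 - 1 / real (2 ^ a) - 1 / 2"
    and few3: "3 < P \<Longrightarrow> size {#x \<in># M. ord x = 3#} \<le> 1"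
    and bn: "\<And>m. 3 < P \<Longrightarrow> n = 3 * m \<Longrightarrow> \<not> 3 dvd m \<Longrightarrow> bound m"
  shows "cr M \<le> Kb e"
proof -
  have p2: "prime (2::nat)" by simp
  have p3: "prime (3::nat)" by simp
  have Mc: "set_mset M \<subseteq> carrier G" using M zsf_carrier by blast
  have Mo: "\<And>x. x \<in># M \<Longrightarrow> ord x dvd 2 ^ a * n" using M(2) e by simp
  have e0: "e > 0" using n e by simp
  have th2: "thin 2" using thin[OF p2 P2] .
  define \<kappa> where "\<kappa> = 1 - 1 / real (2 ^ a)"
  define l where "l = mass 2 (layer 2 M 1)"
  define Y where "Y = hsum 3 e - 1"
  define k where "k = multiplicity 3 e"
  have Kbe: "Kb e = Kb n + \<kappa>" unfolding e \<kappa>_def by (rule Kb_split[OF p2 P2 n])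
  have \<kappa>1: "\<kappa> \<le> 1" unfolding \<kappa>_def by simp
  have l0: "0 \<le> l" unfolding l_def by (rule mass_nonneg)
  have \<mu>: "1 / 2 \<le> \<kappa> - l" using l unfolding l_def \<kappa>_def by simp
  have e3: "3 dvd e" using three e by simp
  have k1: "k \<ge> 1" unfolding k_def using e3 e0 p3
    by (metis One_nat_def Suc_leI multiplicity_gt_zero_iff not_prime_unit not_less_zero gr0I)
  have small: "2 \<le> s" if "prime s" for s :: nat using that prime_ge_2_nat by blast
  have least: "3 \<le> s" if "2 < s" for s :: nat using that by simp
  have Y0: "0 \<le> Y" unfolding Y_def using hsum_ge_one[OF e0] by simp
  show ?thesis
  proof (cases "Y \<le> 1 / 3")
    case True
    have "cr M \<le> Kb n + (l + (\<kappa> - l) / real 3 + \<kappa> * Y)"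
      unfolding \<kappa>_def l_def Y_def
      by (rule chain_cross_bound[OF p2 P2 n e b p3 _ three _ _ M]) (use small in auto)
    moreover have "\<kappa> * Y \<le> \<kappa> * (1 / 3)" using True \<mu> l0 by (intro mult_left_mono) auto
    moreover have "(\<kappa> - l) / real 3 = \<kappa> / 3 - l / 3" by (simp add: diff_divide_distrib)
    ultimately show ?thesis using Kbe \<mu> \<kappa>1 by linarith
  next
    case False
    then have Y3: "1 / 3 < Y" by simp
    define S where "S = {s. prime s \<and> s dvd e \<and> 3 < s}"
    have "S \<noteq> {}"
    proof
      assume "S = {}"
      then have "hsum 3 e = 1" unfolding S_def using e0 by (intro hsum_top) (auto simp: not_less)
      then show False using Y3 unfolding Y_def by simp
    qed
    define r where "r = (LEAST s. s \<in> S)"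
    have rS: "r \<in> S" unfolding r_def using \<open>S \<noteq> {}\<close> LeastI_ex[of "\<lambda>s. s \<in> S"] by blast
    have r: "prime r" "r dvd e" "3 < r" using rS by (auto simp: S_def)
    have rleast: "r \<le> s" if "prime s" "s dvd e" "3 < s" for s
      unfolding r_def using that by (intro Least_le) (simp add: S_def)
    have P3: "3 < P" using le_P[OF r(1,2)] r(3) by simp
    have Yh: "Y \<le> 1 / 2" using h[OF p3 e3 P3] unfolding Y_def by simp
    define b' where "b' = multiplicity r e"
    have b'1: "b' \<ge> 1" unfolding b'_def using r e0
      by (metis One_nat_def Suc_leI multiplicity_gt_zero_iff not_prime_unit not_less_zero gr0I)
    have hr: "hsum r e \<le> real r / (real r - 1)"
    proof (cases "r < P")
      case True
      then show ?thesis using h r by blast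
    next
      case False
      have "hsum r e = 1"
      proof (rule hsum_top[OF e0])
        fix s assume "prime s" "s dvd e"
        then show "s \<le> r" using le_P[of s] False by simp
      qed
      then show ?thesis using r(3) by simp
    qed
    have Yr: "1 + Y = (\<Sum>i\<le>b'. 1 / real r ^ i) * hsum r e"
      unfolding Y_def b'_def using hsum_rec[OF r(1,3) e0 rleast] by simp
    have hr1: "1 \<le> hsum r e" using hsum_ge_one[OF e0] .
    have Yub: "1 + Y \<le> real r / (real r - 1) * (real r / (real r - 1))"
      unfolding Yr using geometric_le[of r b'] hr hr1 r(3) by (intro mult_mono) auto
    have r57: "r = 5 \<or> r = 7"
    proof -
      have "\<not> 11 \<le> r"
      proof
        assume "11 \<le> r"
        then have "real r / (real r - 1) \<le> 11 / 10" by (simp add: divide_simps)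
        then have "real r / (real r - 1) * (real r / (real r - 1)) \<le> 11 / 10 * (11 / 10)"
          using r(3) by (intro mult_mono) auto
        then show False using Yub Y3 by simp
      qed
      then have "r \<in> {4, 5, 6, 7, 8, 9, 10}" using r(3) by auto
      moreover have "r \<notin> {4, 6, 8, 9, 10}"
        using primes_dvd_imp_eq[OF p2 r(1)] primes_dvd_imp_eq[OF p3 r(1)] by auto
      ultimately show ?thesis by auto
    qed
    have Y7: "Y \<le> 13 / 36" if "r = 7" using Yub that by simp
    have Yk: "Y \<le> 5 / 13" if "k \<ge> 2"
    proof -
      have "(\<Sum>i\<le>2. 1 / real 3 ^ i) \<le> (\<Sum>i\<le>k. 1 / real 3 ^ i)" by (rule geometric_ge[OF that])
      then have "13 / 9 \<le> (\<Sum>i\<le>k. 1 / real 3 ^ i)" by (simp add: eval_nat_numeral)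
      then have "13 / 9 * (1 + Y) \<le> (\<Sum>i\<le>k. 1 / real 3 ^ i) * (1 + Y)"
        using Y0 by (intro mult_right_mono) auto
      also have "\<dots> = hsum 2 e"
        unfolding Y_def k_def using hsum_rec[OF p3 _ e0, of 2] by simp
      finally show ?thesis using h2 by simp
    qed
    define x3 xr where "x3 = mass 2 (layer 2 M 3)" and "xr = mass 2 (layer 2 M r)"
    have r2: "\<not> 2 dvd r" using r r57 by auto
    have r2': "\<not> 2 dvd 3 * r" using r57 by auto
    have lay1: "mass 2 (layer 2 M d) \<le> \<kappa>" "mass 2 (layer 2 M d) < 1" if "d > 0" "\<not> 2 dvd d" for d
    proof -
      show lt: "mass 2 (layer 2 M d) < 1"
        by (rule mass_layer_less_one[OF p2 th2 Mc dn that Mo n])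
      show "mass 2 (layer 2 M d) \<le> \<kappa>" unfolding \<kappa>_def
      proof (rule mass_lt_one_le[OF _ _ lt])
        fix x assume "x \<in># layer 2 M d"
        then have "x \<in># M" by (simp add: layer_def)
        then show "multiplicity 2 (ord x) \<le> a" using multiplicity_le_if_dvd[OF p2 n(2) Mo n(1)] by blast
      qed simp
    qed
    have x3b: "x3 \<le> \<kappa>" "x3 < 1" unfolding x3_def by (rule lay1; simp)+
    have xrb: "xr \<le> \<kappa>" "xr < 1" unfolding xr_def using lay1[of r] r2 r(3) by auto
    have x30: "0 \<le> x3" "0 \<le> xr" unfolding x3_def xr_def by (rule mass_nonneg)+
    define A B where "A = {#x \<in># M. \<not> 2 dvd ord x#}" and "B = {#x \<in># M. 2 dvd ord x#}"
    have MAB: "M = A + B" unfolding A_def B_def by (subst add.commute) (rule multiset_partition)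
    have Ao: "ord x dvd n" if "x \<in># A" for x
    proof -
      have "ord x dvd 2 ^ a * n" "\<not> 2 dvd ord x" using that Mo by (auto simp: A_def)
      then show ?thesis by (simp add: coprime_dvd_mult_right_iff)
    qed
    have fin: "finite (rough 3 e)" using e0 by simp
    define F where "F = rough 3 e - {1, r}"
    have rr: "r \<in> rough 3 e" using r by (auto simp: rough_def dest: primes_dvd_imp_eq)
    have sumF: "(\<Sum>f\<in>F. 1 / real f) = Y - 1 / real r"
    proof -
      have "hsum 3 e = 1 / real 1 + (\<Sum>f\<in>rough 3 e - {1}. 1 / real f)"
        unfolding hsum_def by (rule sum.remove[OF fin]) simp
      also have "(\<Sum>f\<in>rough 3 e - {1}. 1 / real f) = 1 / real r + (\<Sum>f\<in>rough 3 e - {1} - {r}. 1 / real f)"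
        by (rule sum.remove) (use fin rr r(3) in auto)
      also have "rough 3 e - {1} - {r} = F" unfolding F_def by auto
      finally show ?thesis unfolding Y_def by simp
    qed
    have B: "B = chain 2 3 M 1 k + (chain 2 3 M r k + (\<Sum>f\<in>F. chain 2 3 M f k))"
    proof -
      have "B = (\<Sum>f\<in>rough 3 e. chain 2 3 M f k)"
        unfolding B_def k_def by (rule chains_partition[OF p2 p3 _ e0]) (use small least Mc M(2) in auto)
      also have "\<dots> = chain 2 3 M 1 k + (\<Sum>f\<in>rough 3 e - {1}. chain 2 3 M f k)"
        by (rule sum.remove[OF fin]) simp
      also have "(\<Sum>f\<in>rough 3 e - {1}. chain 2 3 M f k) = chain 2 3 M r k + (\<Sum>f\<in>rough 3 e - {1} - {r}. chain 2 3 M f k)"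
        by (rule sum.remove) (use fin rr r(3) in auto)
      also have "rough 3 e - {1} - {r} = F" unfolding F_def by auto
      finally show ?thesis .
    qed
    obtain k' where k': "k = Suc k'" using k1 by (metis One_nat_def Suc_le_D)
    have c1: "chain 2 3 M 1 k = layer 2 M 1 + chain 2 3 M 3 k'"
      unfolding k' using chain_Suc[of 3 1 2 M k'] by simp
    have cr': "chain 2 3 M r k = layer 2 M r + chain 2 3 M (3 * r) k'"
      unfolding k' using chain_Suc[of 3 r 2 M k'] r(3) by (simp add: mult.commute)
    have crl: "cr (layer 2 M d) = mass 2 (layer 2 M d) / real d" for d by (rule cr_layer[OF Mc])
    have kle: "k \<le> multiplicity 3 (2 ^ a * n)" unfolding k_def e ..
    have dvdf: "f * 3 ^ k dvd n" if "f \<in> rough 3 e" for f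
      using rough_chain_dvd(1)[OF p2 p3 _ _ kle, of f] that e by simp
    have d1: "3 * 3 ^ k' dvd n" using dvdf[of 1] k' by simp
    have "r * 3 ^ k = 3 * r * 3 ^ k'" unfolding k' by simp
    then have dr: "3 * r * 3 ^ k' dvd n" using dvdf[OF rr] by (simp only:)
    have rn: "3 * r dvd n" by (rule dvd_trans[OF dvd_triv_left dr])
    then have rn': "r dvd n" by (rule dvd_trans[OF dvd_triv_right])
    have lc: "set_mset (layer 2 M d) \<subseteq> carrier G" for d using Mc by (auto simp: layer_def)
    have lo: "ord x dvd 2 ^ a * d" if "x \<in># layer 2 M d" for x d
      using layer_elem(2)[OF p2 n Mc Mo that] .
    have lo': "ord x dvd 2 ^ a * D" if "x \<in># layer 2 M d" "d dvd D" for x d D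
      using lo[OF that(1)] that(2) by (meson dvd_trans mult_dvd_mono dvd_refl)
    define T U W where "T = \<kappa> * Y" and "U = \<kappa> / real r" and "W = \<kappa> * (Y - 1 / real r)"
    have expand: "W = T - U" unfolding T_def U_def W_def by (simp add: right_diff_distrib)
    have netF: "net n \<omega> (\<Sum>f\<in>F. chain 2 3 M f k) (W)"
      if "\<And>f y i. f \<in> F \<Longrightarrow> y \<in> carrier G \<Longrightarrow> i \<le> k \<Longrightarrow> ord y dvd f * 3 ^ i \<Longrightarrow> 1 / real (f * 3 ^ i) \<le> \<omega> y"
      for \<omega>
      unfolding W_def sumF[symmetric] \<kappa>_def
      by (rule net_plain_chains[OF p2 th2 p3 _ n Mc Mo _ kle that]) (auto simp: F_def e)
    have net1: "net n \<omega> (chain 2 3 M 1 k) (l + (\<kappa> - l) / 3)"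
      if "\<And>y i. y \<in> carrier G \<Longrightarrow> i \<le> k' \<Longrightarrow> ord y dvd 3 * 3 ^ i \<Longrightarrow> 1 / real (3 * 3 ^ i) \<le> \<omega> y" for \<omega>
    proof -
      have "net n \<omega> (layer 2 M 1 + chain 2 3 M 3 k') (cr (layer 2 M 1) + (1 - 1 / real (2 ^ a) - mass 2 (layer 2 M 1)) / real 3)"
        by (rule net_chain_start[OF p2 th2 _ _ _ _ Mc n Mo lc lo' _ d1 that]) (use lay1(2)[of 1] in auto)
      then show ?thesis unfolding c1 using crl[of 1] by (simp add: l_def \<kappa>_def)
    qed
    have netr: "net n \<omega> (chain 2 3 M r k) (xr / real r + (\<kappa> - xr) / real (3 * r))"
      if "\<And>y i. y \<in> carrier G \<Longrightarrow> i \<le> k' \<Longrightarrow> ord y dvd 3 * r * 3 ^ i \<Longrightarrow> 1 / real (3 * r * 3 ^ i) \<le> \<omega> y" for \<omega>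
    proof -
      have "net n \<omega> (layer 2 M r + chain 2 3 M (3 * r) k')
         (cr (layer 2 M r) + (1 - 1 / real (2 ^ a) - mass 2 (layer 2 M r)) / real (3 * r))"
        by (rule net_chain_start[OF p2 th2 _ _ _ r2' Mc n Mo lc lo' _ dr that]) (use lay1(2)[of r] r2 r(3) in auto)
      then show ?thesis unfolding cr' using crl[of r] by (simp only: xr_def \<kappa>_def)
    qed
    let ?o = "\<lambda>y. 1 / real (ord y)"
    have oF: "net n ?o (\<Sum>f\<in>F. chain 2 3 M f k) (W)"
      by (rule netF, rule one_over_ord_le) (use rough_pos[OF e0] in \<open>auto simp: F_def\<close>)
    have or: "net n ?o (chain 2 3 M r k) (xr / real r + (\<kappa> - xr) / real (3 * r))"
      by (rule netr, rule one_over_ord_le) (use r(3) in auto)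
    have o1: "net n ?o (chain 2 3 M 1 k) (l + (\<kappa> - l) / 3)"
      by (rule net1, rule one_over_ord_le) auto
    have finish: "cr M \<le> Kb e" if "net n ?o B v" "v \<le> \<kappa>" for v
      using net_bound[OF _ Ao b that(1)] M(1) MAB that(2) Kbe by fastforce
    have \<kappa>0: "0 \<le> \<kappa>" using \<mu> l0 by simp
    have \<kappa>Y: "T \<le> \<kappa> * c" if "Y \<le> c" for c unfolding T_def using that \<kappa>0 by (rule mult_left_mono)
    have or\<kappa>: "net n ?o (chain 2 3 M r k) (U)"
      by (rule net_mono[OF or]) (use r57 xrb in \<open>auto simp: U_def field_simps\<close>)
    have overflow: "\<exists>R0 Q0. Red (layer 2 M 1 + layer 2 M d) R0 Q0 \<and> mass 2 R0 < 1 \<and>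
        mass 2 (layer 2 M 1 + layer 2 M d) \<le> mass 2 R0 + real (size Q0) \<and>
        (\<forall>y\<in>#Q0. y \<in> carrier G \<and> ord y dvd n) \<and> 1 \<le> size Q0 \<and>
        real (size Q0) / real d \<le> (\<Sum>y\<in>#Q0. 1 / real (ord y))"
      if d: "d > 0" "\<not> 2 dvd d" "d dvd n" and big: "\<kappa> < l + mass 2 (layer 2 M d)" for d
    proof (rule net_overflow[OF p2 th2 d])
      show "set_mset (layer 2 M 1 + layer 2 M d) \<subseteq> carrier G" using lc by simp
      show ords: "ord x dvd 2 ^ a * d" if "x \<in># layer 2 M 1 + layer 2 M d" for x
        using that lo'[of x 1 d] lo[of x d] by auto
      show "1 \<le> mass 2 (layer 2 M 1 + layer 2 M d)"
      proof (rule ccontr)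
        assume "\<not> ?thesis"
        then have "mass 2 (layer 2 M 1 + layer 2 M d) \<le> \<kappa>" unfolding \<kappa>_def
          by (intro mass_lt_one_le) (use multiplicity_le_if_dvd[OF p2 d(2) ords d(1)] in auto)
        then show False using big by (simp add: l_def)
      qed
    qed (use d one_over_ord_le in auto)
    consider (I) "\<kappa> - l < x3" | (IIa) "x3 \<le> \<kappa> - l" "\<kappa> - l < xr" | (IIb) "x3 \<le> \<kappa> - l" "xr \<le> \<kappa> - l"
      by linarith
    then show ?thesis
    proof cases
      case I
      obtain R0 Q0 where Q0: "Red (layer 2 M 1 + layer 2 M 3) R0 Q0" "mass 2 R0 < 1"
        "mass 2 (layer 2 M 1 + layer 2 M 3) \<le> mass 2 R0 + real (size Q0)"
        "\<forall>y\<in>#Q0. y \<in> carrier G \<and> ord y dvd n" "1 \<le> size Q0"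
        "real (size Q0) / real 3 \<le> (\<Sum>y\<in>#Q0. 1 / real (ord y))"
        using overflow[of 3] three I unfolding x3_def by auto
      define c where "c = real (size Q0)"
      have c1': "1 \<le> c" unfolding c_def using Q0(5) by simp
      have crX: "cr (layer 2 M 1 + layer 2 M 3) = l + x3 / 3"
        using crl[of 1] crl[of 3] by (simp add: l_def x3_def)
      show ?thesis
      proof (cases k')
        case 0
        have eq: "chain 2 3 M 1 k = layer 2 M 1 + layer 2 M 3" unfolding c1 0 chain_0 ..
        have "net n ?o (chain 2 3 M 1 k) l"
          unfolding net_def eq
        proof (intro exI conjI)
          show "Red (layer 2 M 1 + layer 2 M 3) R0 Q0" "\<forall>y\<in>#Q0. y \<in> carrier G \<and> ord y dvd n"
            using Q0 by auto
          show "cr (layer 2 M 1 + layer 2 M 3) - (\<Sum>y\<in>#Q0. 1 / real (ord y)) \<le> l"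
            using crX Q0(6) c1' x3b(2) unfolding c_def by simp
        qed
        then have "net n ?o B (l + (U + W))"
          unfolding B by (intro net_add or\<kappa> oF)
        then show ?thesis
          by (rule finish) (use \<kappa>Y[OF Yh] expand \<mu> \<kappa>1 in linarith)
      next
        case (Suc k'')
        have c9: "chain 2 3 M 3 k' = layer 2 M 3 + chain 2 3 M 9 k''"
          unfolding Suc using chain_Suc[of 3 3 2 M k''] by simp
        have eq: "chain 2 3 M 1 k = layer 2 M 1 + layer 2 M 3 + chain 2 3 M 9 k''"
          unfolding c1 c9 by (simp add: add.assoc)
        have d9: "9 * 3 ^ k'' dvd n" using d1 unfolding Suc by simp
        have "net n ?o (layer 2 M 1 + layer 2 M 3 + chain 2 3 M 9 k'')
          (cr (layer 2 M 1 + layer 2 M 3) - (\<Sum>y\<in>#Q0. 1 / real (ord y)) +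
           (1 - 1 / real (2 ^ a) - (mass 2 (layer 2 M 1 + layer 2 M 3) - real (size Q0))) / real 9)"
        proof (rule net_chain[OF p2 th2 _ _ _ _ Mc n Mo _ _ Q0(1-3) _ d9])
          show "set_mset (layer 2 M 1 + layer 2 M 3) \<subseteq> carrier G" using lc by simp
          show "ord x dvd 2 ^ a * 9" if "x \<in># layer 2 M 1 + layer 2 M 3" for x
            using that lo'[of x 1 9] lo'[of x 3 9] by auto
          show "1 / real (9 * 3 ^ i) \<le> 1 / real (ord y)" if "y \<in> carrier G" "ord y dvd 9 * 3 ^ i" for y i
            using that by (intro one_over_ord_le) auto
        qed (use Q0(4) in auto)
        moreover have "cr (layer 2 M 1 + layer 2 M 3) - (\<Sum>y\<in>#Q0. 1 / real (ord y)) +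
           (1 - 1 / real (2 ^ a) - (mass 2 (layer 2 M 1 + layer 2 M 3) - real (size Q0))) / real 9
            \<le> l + (\<kappa> - l) / 9"
        proof -
          have m: "mass 2 (layer 2 M 1 + layer 2 M 3) = l + x3" by (simp add: l_def x3_def)
          have q: "c / 3 \<le> (\<Sum>y\<in>#Q0. 1 / real (ord y))" using Q0(6) unfolding c_def by simp
          have "l + x3 / 3 - s + (\<kappa> - (l + x3 - c)) / 9 \<le> l + (\<kappa> - l) / 9" if "c / 3 \<le> s" for s
            using that c1' x3b(2) by (simp add: field_simps)
          from this[OF q] show ?thesis
            unfolding m crX c_def[symmetric] \<kappa>_def[symmetric] of_nat_numeral .
        qed
        ultimately have "net n ?o (chain 2 3 M 1 k) (l + (\<kappa> - l) / 9)" unfolding eq by (rule net_mono)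
        then have nB: "net n ?o B (l + (\<kappa> - l) / 9 + (U + W))"
          unfolding B by (intro net_add or\<kappa> oF)
        have k2: "k \<ge> 2" unfolding k' Suc by simp
        show ?thesis
          using \<kappa>Y[OF Yk[OF k2]] expand \<mu> \<kappa>1 by (intro finish[OF nB]) (simp add: field_simps)
      qed
    next
      case IIa
      have rpos: "0 < r" using r(3) by simp
      obtain R0 Q0 where Q0: "Red (layer 2 M 1 + layer 2 M r) R0 Q0" "mass 2 R0 < 1"
        "mass 2 (layer 2 M 1 + layer 2 M r) \<le> mass 2 R0 + real (size Q0)"
        "\<forall>y\<in>#Q0. y \<in> carrier G \<and> ord y dvd n" "1 \<le> size Q0"
        "real (size Q0) / real r \<le> (\<Sum>y\<in>#Q0. 1 / real (ord y))"
        using overflow[OF rpos r2 rn'] IIa unfolding xr_def by auto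
      define c where "c = real (size Q0)"
      have c1': "1 \<le> c" unfolding c_def using Q0(5) by simp
      have "net n ?o (layer 2 M 1 + layer 2 M r + chain 2 3 M (3 * r) k')
          (cr (layer 2 M 1 + layer 2 M r) - (\<Sum>y\<in>#Q0. 1 / real (ord y)) +
           (1 - 1 / real (2 ^ a) - (mass 2 (layer 2 M 1 + layer 2 M r) - real (size Q0))) / real (3 * r))"
      proof (rule net_chain[OF p2 th2 _ _ _ r2' Mc n Mo _ _ Q0(1-3) _ dr])
        show "set_mset (layer 2 M 1 + layer 2 M r) \<subseteq> carrier G" using lc by simp
        show "ord x dvd 2 ^ a * (3 * r)" if "x \<in># layer 2 M 1 + layer 2 M r" for x
          using that lo'[of x 1 "3 * r"] lo'[of x r "3 * r"] by auto
        show "1 / real (3 * r * 3 ^ i) \<le> 1 / real (ord y)" if "y \<in> carrier G" "ord y dvd 3 * r * 3 ^ i" for y i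
          using that rpos by (intro one_over_ord_le) auto
      qed (use Q0(4) rpos in auto)
      moreover have "cr (layer 2 M 1 + layer 2 M r) - (\<Sum>y\<in>#Q0. 1 / real (ord y)) +
           (1 - 1 / real (2 ^ a) - (mass 2 (layer 2 M 1 + layer 2 M r) - real (size Q0))) / real (3 * r)
            \<le> l + (\<kappa> - l) / real (3 * r)"
      proof -
        have m: "mass 2 (layer 2 M 1 + layer 2 M r) = l + xr" "cr (layer 2 M 1 + layer 2 M r) = l + xr / real r"
          using crl[of 1] crl[of r] by (simp_all add: l_def xr_def)
        have q: "c / real r \<le> (\<Sum>y\<in>#Q0. 1 / real (ord y))" using Q0(6) unfolding c_def by simp
        have "0 \<le> (c - xr) * (1 / real r - 1 / real (3 * r))"
          using c1' xrb(2) rpos by (intro mult_nonneg_nonneg) (auto simp: divide_simps)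
        also have "\<dots> = (c - xr) / real r - (c - xr) / real (3 * r)"
          by (simp only: right_diff_distrib times_divide_eq_right mult_1_right)
        finally have le: "(c - xr) / real (3 * r) \<le> (c - xr) / real r" by (simp only: diff_ge_0_iff_ge)
        have "\<kappa> - (l + xr - c) = (\<kappa> - l) + (c - xr)" by simp
        then have eq: "(\<kappa> - (l + xr - c)) / real (3 * r) = (\<kappa> - l) / real (3 * r) + (c - xr) / real (3 * r)"
          by (simp only: add_divide_distrib)
        have "l + x - s + z \<le> l + w" if "z = w + d" "d \<le> g" "g = c' - x" "c' \<le> s"
          for x s z w d g c' :: real using that by linarith
        from this[OF eq le diff_divide_distrib q] show ?thesis
          unfolding m c_def[symmetric] \<kappa>_def[symmetric] .
      qed
      ultimately have n1: "net n ?o (layer 2 M 1 + layer 2 M r + chain 2 3 M (3 * r) k') (l + (\<kappa> - l) / real (3 * r))"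
        by (rule net_mono)
      have eq: "B = (layer 2 M 1 + layer 2 M r + chain 2 3 M (3 * r) k') + (chain 2 3 M 3 k' + (\<Sum>f\<in>F. chain 2 3 M f k))"
        unfolding B c1 cr' by (simp add: ac_simps)
      show ?thesis
      proof (cases k')
        case 0
        have "net n ?o (chain 2 3 M 3 k') (x3 / 3)"
          unfolding 0 chain_0 by (rule net_refl) (use crl[of 3] in \<open>simp add: x3_def\<close>)
        then have "net n ?o B (l + (\<kappa> - l) / real (3 * r) + (x3 / 3 + W))"
          unfolding eq by (intro net_add n1 oF)
        moreover have "l + (\<kappa> - l) / real (3 * r) + (x3 / 3 + W) \<le> \<kappa>"
          using r57
        proof
          assume r5: "r = 5"
          have "(\<kappa> - l) / real (3 * r) = \<kappa> / 15 - l / 15" "U = \<kappa> / 5"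
            unfolding U_def r5 by (simp_all add: diff_divide_distrib)
          then show ?thesis using \<kappa>Y[OF Yh] IIa(1) \<mu> \<kappa>1 expand unfolding r5 by (simp add: field_simps)
        next
          assume r7: "r = 7"
          have "(\<kappa> - l) / real (3 * r) = \<kappa> / 21 - l / 21" "U = \<kappa> / 7"
            unfolding U_def r7 by (simp_all add: diff_divide_distrib)
          then show ?thesis using \<kappa>Y[OF Y7[OF r7]] IIa(1) \<mu> \<kappa>1 expand unfolding r7 by (simp add: field_simps)
        qed
        ultimately show ?thesis by (rule finish)
      next
        case (Suc k'')
        have c9: "chain 2 3 M 3 k' = layer 2 M 3 + chain 2 3 M 9 k''"
          unfolding Suc using chain_Suc[of 3 3 2 M k''] by simp
        have d9: "9 * 3 ^ k'' dvd n" using d1 unfolding Suc by simp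
        have "net n ?o (layer 2 M 3 + chain 2 3 M 9 k'')
           (cr (layer 2 M 3) + (1 - 1 / real (2 ^ a) - mass 2 (layer 2 M 3)) / real 9)"
        proof (rule net_chain_start[OF p2 th2 _ _ _ _ Mc n Mo lc lo' _ d9])
          show "1 / real (9 * 3 ^ i) \<le> 1 / real (ord y)" if "y \<in> carrier G" "ord y dvd 9 * 3 ^ i" for y i
            using that by (intro one_over_ord_le) auto
        qed (use lay1(2)[of 3] in auto)
        then have n3: "net n ?o (chain 2 3 M 3 k') (x3 / 3 + (\<kappa> - x3) / 9)"
          unfolding c9 using crl[of 3] by (simp add: x3_def \<kappa>_def)
        have "net n ?o B (l + (\<kappa> - l) / real (3 * r) + ((x3 / 3 + (\<kappa> - x3) / 9) + W))"
          unfolding eq by (intro net_add n1 n3 oF)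
        moreover have "l + (\<kappa> - l) / real (3 * r) + ((x3 / 3 + (\<kappa> - x3) / 9) + W) \<le> \<kappa>"
          using r57
        proof
          assume r5: "r = 5"
          have "(\<kappa> - l) / real (3 * r) = \<kappa> / 15 - l / 15" "U = \<kappa> / 5"
            unfolding U_def r5 by (simp_all add: diff_divide_distrib)
          moreover have "k \<ge> 2" unfolding k' Suc by simp
          ultimately show ?thesis using \<kappa>Y[OF Yk[OF \<open>k \<ge> 2\<close>]] IIa(1) \<mu> \<kappa>1 expand unfolding r5 by (simp add: field_simps)
        next
          assume r7: "r = 7"
          have "(\<kappa> - l) / real (3 * r) = \<kappa> / 21 - l / 21" "U = \<kappa> / 7"
            unfolding U_def r7 by (simp_all add: diff_divide_distrib)
          then show ?thesis using \<kappa>Y[OF Y7[OF r7]] IIa(1) \<mu> \<kappa>1 expand unfolding r7 by (simp add: field_simps)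
        qed
        ultimately show ?thesis by (rule finish)
      qed
    next
      case IIb
      have netB: "net n ?o B (l + (\<kappa> - l) / 3 + ((xr / real r + (\<kappa> - xr) / real (3 * r)) + W))"
        unfolding B by (intro net_add o1 or oF)
      consider (seven) "r = 7" | (low) "r = 5" "Y \<le> 2 / 5" | (hard) "r = 5" "2 / 5 < Y"
        using r57 by linarith
      then show ?thesis
      proof cases
        case seven
        have "(\<kappa> - xr) / real (3 * r) = \<kappa> / 21 - xr / 21" "U = \<kappa> / 7" "xr / real r = xr / 7"
          unfolding U_def seven by (simp_all add: diff_divide_distrib)
        then show ?thesis
          using \<kappa>Y[OF Y7[OF seven]] IIb \<mu> \<kappa>1 expand by (intro finish[OF netB]) (simp add: field_simps seven)
      next
        case low
        have "(\<kappa> - xr) / real (3 * r) = \<kappa> / 15 - xr / 15" "U = \<kappa> / 5" "xr / real r = xr / 5"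
          unfolding U_def low by (simp_all add: diff_divide_distrib)
        then show ?thesis
          using \<kappa>Y[OF low(2)] IIb \<mu> \<kappa>1 expand by (intro finish[OF netB]) (simp add: field_simps low)
      next
        case hard
        have "\<not> k \<ge> 2" using Yk hard(2) by auto
        then have k1': "k = 1" "k' = 0" using k1 k' by auto
        define v where "v = l + x3 / 3 + ((xr / real r + (\<kappa> - xr) / real (3 * r)) + W)"
        have v: "v \<le> \<kappa> + (Y - 2 / 5)"
        proof -
          (* v - \<kappa> is affine in \<kappa>, and the worst case is \<kappa> = 1 *)
          have "0 \<le> (1 - \<kappa>) * (Y - 2 / 15)" using \<kappa>1 hard(2) by (intro mult_nonneg_nonneg) auto
          moreover have "(1 - \<kappa>) * (Y - c) = (Y - c) - (\<kappa> * Y - \<kappa> * c)" for c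
            by (simp add: algebra_simps)
          ultimately have "T - \<kappa> * (2 / 15) \<le> Y - 2 / 15" unfolding T_def by simp
          moreover have "(\<kappa> - xr) / real (3 * r) = \<kappa> / 15 - xr / 15" "U = \<kappa> / 5" "xr / real r = xr / 5"
            unfolding U_def hard by (simp_all add: diff_divide_distrib)
          ultimately show ?thesis unfolding v_def using IIb \<mu> expand by linarith
        qed
        (* all elements of layers 1 and 3 are kept, so no product of order 3 has to be credited here *)
        have "net n light (chain 2 3 M 1 k) (l + x3 / 3)"
          unfolding c1 k1'(2) chain_0 by (rule net_refl) (use crl[of 1] crl[of 3] in \<open>simp add: l_def x3_def\<close>)
        moreover have "net n light (chain 2 3 M r k) (xr / real r + (\<kappa> - xr) / real (3 * r))"
          by (rule netr, rule light_le) (use k1' hard in auto)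
        moreover have "net n light (\<Sum>f\<in>F. chain 2 3 M f k) (W)"
        proof (rule netF, rule light_le)
          fix f y i assume f: "f \<in> F" and i: "i \<le> k"
          have f5: "5 \<le> f" using f rough_three_ge[of f e] unfolding F_def by auto
          then show "0 < f * 3 ^ i" by simp
          assume "3 dvd f * 3 ^ i"
          moreover have "\<not> 3 dvd f" using f rough_not_dvd[OF p3] unfolding F_def by auto
          ultimately have "i \<noteq> 0" by (metis mult_1_right power_0)
          then show "15 \<le> f * 3 ^ i" using i k1' f5 by (simp add: le_Suc_eq)
        qed
        ultimately have "net n light B v" unfolding B v_def by (intro net_add)
        then obtain R Q where RQ: "Red B R Q" "\<forall>y\<in>#Q. y \<in> carrier G \<and> ord y dvd n"
          "cr B - (\<Sum>y\<in>#Q. light y) \<le> v" unfolding net_def by (elim exE conjE)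
        have "zsf (R + Q + A)" using Red_zsf[OF RQ(1), of A] M(1) MAB by (simp add: add.commute)
        moreover have "A + Q \<subseteq># R + Q + A" by (simp add: add.commute add.assoc)
        ultimately have zAQ: "zsf (A + Q)" by (rule zsf_sub)
        have AQo: "ord x dvd n" if "x \<in># A + Q" for x using that Ao RQ(2) by auto
        have light_ord: "light y \<le> 1 / real (ord y)" for y by (simp add: light_def)
        have crM: "cr M = cr A + cr B" using MAB by simp
        show ?thesis
        proof (cases "\<exists>y\<in>#Q. ord y = 3")
          case True
          then obtain y Q' where y: "Q = add_mset y Q'" "ord y = 3" by (metis multi_member_split)
          have "(\<Sum>y\<in>#Q'. light y) \<le> (\<Sum>y\<in>#Q'. 1 / real (ord y))" using light_ord by (intro sum_mset_mono)
          then have "(\<Sum>y\<in>#Q. light y) + 4 / 15 \<le> cr Q"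
            using y by (simp add: cr_def light_def)
          moreover have "cr (A + Q) \<le> Kb n" by (rule boundD[OF b zAQ AQo])
          ultimately show ?thesis using RQ(3) v Yh Kbe crM by simp
        next
          case False
          have "(\<Sum>y\<in>#Q. light y) = cr Q"
            unfolding cr_def using False by (intro arg_cong[where f=sum_mset] image_mset_cong) (auto simp: light_def)
          then have step: "cr M \<le> cr (A + Q) + v" using RQ(3) crM by simp
          obtain m where m: "n = 3 * m" using three by (elim dvdE)
          have m0: "m > 0" using n(1) m by simp
          have "multiplicity 3 n = 1"
          proof -
            have "multiplicity (3::nat) (2 ^ a * n) = multiplicity (3::nat) (2 ^ a) + multiplicity (3::nat) n"
              using n by (intro prime_elem_multiplicity_mult_distrib) auto
            also have "multiplicity (3::nat) ((2::nat) ^ a) = 0" by (intro multiplicity_distinct_prime_power) auto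
            finally show ?thesis using k1'(1) unfolding k_def e by simp
          qed
          then have m3: "\<not> 3 dvd m"
          proof -
            have "\<not> 3 ^ 2 dvd n" using \<open>multiplicity 3 n = 1\<close>
              by (metis Suc_1 lessI linorder_not_le multiplicity_geI n(1) not_prime_unit p3 less_numeral_extra(3) power2_eq_square)
            then show ?thesis unfolding m by (auto simp: power2_eq_square)
          qed
          have "n dvd e" using e by simp
          have five: "5 dvd n" using rn' hard by simp
          then have "coprime (5::nat) 3" by (simp add: coprime_iff_gcd_eq_1 gcd_nat.simps)
          then have fm: "5 dvd m" using five m coprime_dvd_mult_right_iff by blast
          (* the element mass of order 3 is at most 1/3 here, which makes the chain bound for 3 and 5 better than Kb n *)
          define l3 where "l3 = mass 3 (layer 3 (A + Q) 1)"
          have "cr (A + Q) \<le> Kb m + (mass 3 (layer 3 (A + Q) 1) +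
              (1 - 1 / real (3 ^ 1) - mass 3 (layer 3 (A + Q) 1)) / real 5 + (1 - 1 / real (3 ^ 1)) * (hsum 5 n - 1))"
          proof (rule chain_cross_bound[OF p3 P3 m0 m3 _ bn[OF P3 m m3] _ _ fm _ _ zAQ AQo])
            show "n = 3 ^ 1 * m" using m by simp
            show "prime (5::nat)" "(3::nat) < 5" using r(1) hard by auto
            fix s assume s: "prime s" "s dvd n"
            have "s \<noteq> 2" using s n(2) by auto
            then show "3 \<le> s" using prime_ge_2_nat[OF s(1)] by simp
            assume "3 < s"
            then show "5 \<le> s" using rleast[of s] s \<open>n dvd e\<close> hard dvd_trans by blast
          qed
          then have c: "cr (A + Q) \<le> Kb m + (l3 + (2 / 3 - l3) / 5 + 2 / 3 * (hsum 5 n - 1))"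
            unfolding l3_def by simp
          have "l3 \<le> 1 / 3"
          proof -
            have el: "ord x = 3" if "x \<in># layer 3 (A + Q) 1" for x
            proof -
              have x: "x \<in># A + Q" "x \<in> carrier G" "3 dvd ord x" "cofactor 3 x = 1"
                using that zsf_carrier[OF zAQ] by (auto simp: layer_def)
              obtain j where j: "j \<ge> 1" "ord x = 3 ^ j" using ord_prime_power_layer[OF p3 x(2-4)] by blast
              have "multiplicity 3 (ord x) \<le> 1"
                using multiplicity_le_if_dvd[OF p3 m3, of "ord x" 1] AQo[OF x(1)] m m0 by simp
              then have "j = 1" using j p3 by simp
              then show ?thesis using j by simp
            qed
            have "layer 3 (A + Q) 1 = layer 3 A 1"
            proof -
              have "layer 3 Q 1 = {#}"
              proof (rule ccontr)
                assume "layer 3 Q 1 \<noteq> {#}"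
                then obtain x where x: "x \<in># layer 3 Q 1" by blast
                then have "x \<in># layer 3 (A + Q) 1" "x \<in># Q" by (auto simp: layer_def)
                then show False using el False by blast
              qed
              then show ?thesis by (simp add: layer_def)
            qed
            moreover have "size (layer 3 A 1) \<le> 1"
            proof -
              have "layer 3 A 1 = {#x \<in># layer 3 A 1. ord x = 3#}"
              proof -
                have "{#x \<in># layer 3 A 1. ord x = 3#} = {#x \<in># layer 3 A 1. True#}"
                  by (rule filter_mset_cong) (use el \<open>layer 3 (A + Q) 1 = layer 3 A 1\<close> in auto)
                then show ?thesis by simp
              qed
              also have "\<dots> \<subseteq># {#x \<in># M. ord x = 3#}"
                unfolding MAB by (intro multiset_filter_mono) (simp add: layer_def subset_mset.add_increasing2)
              finally show ?thesis using few3[OF P3] size_mset_mono le_trans by blast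
            qed
            moreover have "mass 3 (layer 3 A 1) = real (size (layer 3 A 1)) / 3"
            proof -
              have "mass 3 (layer 3 A 1) = (\<Sum>x\<in>#layer 3 A 1. 1 / 3)" unfolding mass_def
                by (intro arg_cong[where f=sum_mset] image_mset_cong)
                  (use el \<open>layer 3 (A + Q) 1 = layer 3 A 1\<close> in auto)
              then show ?thesis by (simp add: sum_mset_constant)
            qed
            ultimately show ?thesis unfolding l3_def by simp
          qed
          moreover have "hsum 5 n \<le> 5 / 4"
          proof -
            have "hsum 5 n \<le> hsum 5 e" by (rule hsum_mono[OF e0 \<open>n dvd e\<close>])
            also have "hsum 5 e \<le> 5 / 4" using hr hard by simp
            finally show ?thesis .
          qed
          moreover have "Kb n = Kb m + 2 / 3"
            using Kb_split[OF p3 P3 m0 m3, of 1] m by simp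
          ultimately show ?thesis using step c v Kbe Yh by (simp add: field_simps)
        qed
      qed
    qed
  qed
qed

section \<open>The upper bound for numbers with small reciprocal sums\<close>

text \<open>
  Unlike wideness, this passes to all divisors that are still multiples of \<open>P\<close>.
\<close>

definition good :: "nat \<Rightarrow> bool" where
  "good e \<longleftrightarrow> e > 0 \<and> P dvd e \<and> (\<forall>s. prime s \<longrightarrow> s dvd e \<longrightarrow> s \<le> P) \<and>
     (\<forall>s. prime s \<longrightarrow> s dvd e \<longrightarrow> s < P \<longrightarrow> hsum s e \<le> real s / (real s - 1))"

lemma good_dvd:
  assumes "good e" "e' dvd e" "P dvd e'"
  shows "good e'"
proof -
  have e: "e > 0" using assms(1) by (simp add: good_def)
  have "e' > 0" using e assms(2) dvd_pos_nat by blast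
  moreover have "s \<le> P" if "prime s" "s dvd e'" for s
    using that assms dvd_trans unfolding good_def by blast
  moreover have "hsum s e' \<le> real s / (real s - 1)" if "prime s" "s dvd e'" "s < P" for s
  proof -
    have "hsum s e' \<le> hsum s e" by (rule hsum_mono[OF e assms(2)])
    also have "\<dots> \<le> real s / (real s - 1)"
      using that assms(1,2) dvd_trans unfolding good_def by blast
    finally show ?thesis .
  qed
  ultimately show ?thesis using assms(3) unfolding good_def by blast
qed

lemma KP_le_Kb: "KP \<le> Kb e"
proof -
  have "0 \<le> (\<Sum>p | prime p \<and> p < P. 1 - 1 / real (p ^ multiplicity p e))"
  proof (rule sum_nonneg)
    fix p assume "p \<in> {p. prime p \<and> p < P}"
    then have "p ^ multiplicity p e > 0" using prime_gt_0_nat by auto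
    then have "1 \<le> p ^ multiplicity p e" by linarith
    then have "1 \<le> real (p ^ multiplicity p e)" by (metis of_nat_1 of_nat_le_iff)
    moreover have "0 \<le> 1 - 1 / x" if "1 \<le> x" for x :: real using that by simp
    ultimately show "0 \<le> 1 - 1 / real (p ^ multiplicity p e)" by blast
  qed
  then show ?thesis by (simp add: Kb_def)
qed

lemma split_off_prime:
  assumes "prime p" "p < P" "p dvd e" "good e"
  obtains a n where "e = p ^ a * n" "\<not> p dvd n" "a \<ge> 1" "n > 0" "good n" "good (p ^ (a - 1) * n)"
    "n < e" "p ^ (a - 1) * n < e"
proof -
  have e: "e > 0" "P dvd e" using assms(4) by (simp_all add: good_def)
  obtain n where n: "e = p ^ multiplicity p e * n" "\<not> p dvd n"
    using multiplicity_decompose'[of e p] e(1) assms(1) not_prime_1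
    by (metis (no_types, lifting) less_numeral_extra(3) nat_dvd_1_iff_1)
  define a where "a = multiplicity p e"
  have a1: "a \<ge> 1" unfolding a_def using assms(1,3) e(1)
    by (metis One_nat_def Suc_leI multiplicity_gt_zero_iff not_prime_unit not_less_zero gr0I)
  have p1: "p > 1" using assms(1) prime_gt_1_nat by blast
  have n0: "n > 0" using n e by (metis gr0I mult_0_right)
  have en: "e = p ^ a * n" using n(1) a_def by simp
  have ep: "e = p * (p ^ (a - 1) * n)" unfolding en using a1 by (metis One_nat_def Suc_le_D diff_Suc_1 power_Suc mult.assoc)
  have "coprime P (p ^ a)"
    using P assms(1,2) by (metis coprime_power_right_iff nat_neq_iff primes_coprime)
  then have Pn: "P dvd n" using e(2) unfolding en using coprime_dvd_mult_right_iff by blast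
  have "n dvd e" "p ^ (a - 1) * n dvd e" using en ep by simp_all
  then have "good n" "good (p ^ (a - 1) * n)" using good_dvd[OF assms(4)] Pn by simp_all
  moreover have "p ^ (a - 1) * n < e"
  proof -
    have "p ^ (a - 1) * n > 0" using n0 p1 by simp
    then have "1 * (p ^ (a - 1) * n) < p * (p ^ (a - 1) * n)" using p1 by (intro mult_strict_right_mono)
    then show ?thesis using ep by simp
  qed
  moreover have "n \<le> p ^ (a - 1) * n" using p1 by simp
  ultimately show thesis using that[of a n] en n(2) a1 n0 by simp
qed

lemma cr_le_dense:
  assumes dense: "\<And>M. zsf M \<Longrightarrow> (\<And>x. x \<in># M \<Longrightarrow> ord x dvd e) \<Longrightarrow> dense M \<Longrightarrow> cr M \<le> K"
  shows "zsf M \<Longrightarrow> (\<And>x. x \<in># M \<Longrightarrow> ord x dvd e) \<Longrightarrow> cr M \<le> K"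
proof (induction "size M" arbitrary: M rule: less_induct)
  case less
  show ?case
  proof (cases "dense M")
    case True
    then show ?thesis using dense less.prems by blast
  next
    case False
    then obtain E where E: "E \<subseteq># M" "2 \<le> size E" "cr E \<le> 1 / real (ord (mprod E))"
      unfolding dense_def by (auto simp: not_less)
    then obtain R where R: "M = E + R" by (metis subset_mset.le_iff_add)
    have Ene: "E \<noteq> {#}" using E(2) by auto
    have Mc: "set_mset M \<subseteq> carrier G" using less.prems(1) zsf_carrier by blast
    let ?M = "add_mset (mprod E) R"
    have "cr ?M \<le> K"
    proof (rule less.hyps)
      show "size ?M < size M" using R E(2) by simp
      show "zsf ?M" using zsf_merge less.prems(1) R Ene by blast
      fix x assume "x \<in># ?M"
      then consider "x = mprod E" | "x \<in># R" by auto
      then show "ord x dvd e"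
      proof cases
        case 1
        have "ord (mprod E) dvd e" by (rule ord_mprod_dvd) (use Mc less.prems(2) R in auto)
        then show ?thesis using 1 by simp
      next
        case 2
        then show ?thesis using less.prems(2) R by simp
      qed
    qed
    then show ?thesis using R E(3) by simp
  qed
qed

text \<open>
  Induction on \<open>e\<close>, with \<open>p\<close> and \<open>q\<close> its two smallest primes. In the generic case
  \<open>q \<ge> p + 2\<close>, the chain bound leaves to show that \<open>Y \<le> (\<kappa> - l) (1 - 1 / q)\<close>, where \<open>1 + Y = hsum q e\<close>.
  Here \<open>\<kappa> - l \<ge> 1 / p\<close>, and \<open>Y \<le> 1 / (q - 1) \<le> (1 / p) (1 - 1 / q)\<close> because
  \<open>p q \<le> (q - 2) q \<le> (q - 1)\<^sup>2\<close>.
\<close>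

theorem good_imp_bound: "good e \<Longrightarrow> bound e"
proof (induction e rule: less_induct)
  case (less e)
  note g = less.prems
  have e: "e > 0" "P dvd e" "\<And>s. prime s \<Longrightarrow> s dvd e \<Longrightarrow> s \<le> P"
    "\<And>s. prime s \<Longrightarrow> s dvd e \<Longrightarrow> s < P \<Longrightarrow> hsum s e \<le> real s / (real s - 1)"
    using g unfolding good_def by blast+
  have main: "cr M \<le> Kb e" if M: "zsf M" "\<And>x. x \<in># M \<Longrightarrow> ord x dvd e" and dn: "dense M" for M
  proof -
    have Mc: "set_mset M \<subseteq> carrier G" using M zsf_carrier by blast
    have full: "cr M \<le> Kb e"
      if s: "prime s" "s dvd e" "s < P" and big: "s \<le> size {#x \<in># M. ord x = s#} + 1" for s
    proof -
      obtain a n where an: "e = s ^ a * n" "\<not> s dvd n" "a \<ge> 1" "n > 0" "good n" "good (s ^ (a - 1) * n)"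
        "n < e" "s ^ (a - 1) * n < e" using split_off_prime[OF s(1,3,2) g] by blast
      show ?thesis unfolding an(1)
        by (rule full_level_bound[OF s(1,3) an(4,2,3)]) (use less.IH an M big in auto)
    qed
    show ?thesis
    proof (cases "\<exists>p. prime p \<and> p dvd e \<and> p < P")
      case False
      have "\<exists>k. ord x = P ^ k" if x: "x \<in># M" for x
      proof -
        have xc: "x \<in> carrier G" using x Mc by blast
        have "cofactor P x = 1"
        proof (rule ccontr)
          assume "cofactor P x \<noteq> 1"
          then obtain s where s: "prime s" "s dvd cofactor P x" using prime_factor_nat by blast
          have "ord x = P ^ multiplicity P (ord x) * cofactor P x" by (rule ord_cofactor[OF xc])
          then have "cofactor P x dvd ord x" by (metis dvd_triv_right)
          then have se: "s dvd e" by (rule dvd_trans[OF s(2) dvd_trans[OF _ M(2)[OF x]]])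
          have "s \<noteq> P" using s(2) cofactor_not_dvd[OF P xc] by blast
          then have "s < P" using e(3)[OF s(1) se] by simp
          then show False using False s(1) se by blast
        qed
        then show ?thesis using ord_cofactor[OF xc, of P] by (metis mult_1_right)
      qed
      then have "cr M \<le> KP" using base M(1) by blast
      then show ?thesis using KP_le_Kb[of e] by linarith
    next
      case True
      define p where "p = (LEAST p. prime p \<and> p dvd e \<and> p < P)"
      have p: "prime p" "p dvd e" "p < P" unfolding p_def using LeastI_ex[OF True] by auto
      have small: "p \<le> s" if s: "prime s" "s dvd e" for s
      proof (cases "s < P")
        case True
        then show ?thesis unfolding p_def using s by (intro Least_le) simp
      next
        case False
        then show ?thesis using p(3) by simp
      qed
      obtain a n where an: "e = p ^ a * n" "\<not> p dvd n" "a \<ge> 1" "n > 0" "good n" "good (p ^ (a - 1) * n)"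
        "n < e" "p ^ (a - 1) * n < e" using split_off_prime[OF p(1,3,2) g] by blast
      have Mo: "\<And>x. x \<in># M \<Longrightarrow> ord x dvd p ^ a * n" using M(2) an(1) by simp
      have bn: "bound n" using less.IH an by blast
      have Pn: "P dvd n" using an(5) by (simp add: good_def)
      define q where "q = (LEAST q. prime q \<and> q dvd n)"
      have q: "prime q" "q dvd n"
        unfolding q_def using LeastI_ex[of "\<lambda>q. prime q \<and> q dvd n"] P Pn by auto
      have qe: "q dvd e" using q(2) an(1) by simp
      have qleast: "q \<le> s" if s: "prime s" "s dvd e" "p < s" for s
      proof -
        have "coprime s (p ^ a)" using s p(1) by (metis coprime_power_right_iff nat_neq_iff primes_coprime)
        then have "s dvd n" using s(2) an(1) coprime_dvd_mult_right_iff by blast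
        then show ?thesis unfolding q_def using s(1) by (intro Least_le) simp
      qed
      have "q \<noteq> p" using q(2) an(2) by auto
      then have pq: "p < q" using small[OF q(1) qe] by simp
      show ?thesis
      proof (cases "p \<le> size {#x \<in># M. ord x = p#} + 1")
        case True
        then show ?thesis by (rule full[OF p])
      next
        case False
        then have few: "size {#x \<in># M. ord x = p#} + 2 \<le> p" by simp
        define \<kappa> l where "\<kappa> = 1 - 1 / real (p ^ a)" and "l = mass p (layer p M 1)"
        have l: "l \<le> \<kappa> - 1 / real p" unfolding l_def \<kappa>_def
          by (rule mass_layer_one_le[OF p(1) thin[OF p(1,3)] M(1) dn Mo an(4,2,3) few])
        show ?thesis
        proof (cases "p = 2 \<and> q = 3")
          case True
          then have p2: "p = 2" and q3: "q = 3" by auto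
          show ?thesis
          proof (cases "3 < P \<and> 2 \<le> size {#x \<in># M. ord x = 3#}")
            case True
            then show ?thesis using full[of 3] q(1) qe q3 by simp
          next
            case False
            show ?thesis
            proof (rule two_three_bound[OF _ an(4) _ _ bn an(3) _ e(3) _ e(4) M dn])
              show "2 < P" "\<not> 2 dvd n" "e = 2 ^ a * n" "3 dvd n" using p(3) an(1,2) q(2) p2 q3 by auto
              show "hsum 2 e \<le> 2" using e(4)[OF p] p2 by simp
              show "mass 2 (layer 2 M 1) \<le> 1 - 1 / real (2 ^ a) - 1 / 2"
                using l unfolding l_def \<kappa>_def p2 by simp
              show "3 < P \<Longrightarrow> size {#x \<in># M. ord x = 3#} \<le> 1" using False by simp
              fix m assume m: "3 < P" "n = 3 * m" "\<not> 3 dvd m"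
              have "coprime P 3" using P q(1) q3 m(1) by (metis nat_neq_iff primes_coprime)
              then have "P dvd m" using Pn m(2) coprime_dvd_mult_right_iff by blast
              moreover have "m dvd e" using m(2) an(1) by simp
              ultimately have "good m" using good_dvd[OF g] by blast
              moreover have "m < e" using m(2) an(4,7) by simp
              ultimately show "bound m" using less.IH by blast
            qed auto
          qed
        next
          case False
          have pq2: "p + 2 \<le> q"
          proof (rule ccontr)
            assume "\<not> ?thesis"
            then have qp: "q = p + 1" using pq by simp
            have "p = 2"
            proof (rule ccontr)
              assume "p \<noteq> 2"
              then have "odd p" using p(1) primes_dvd_imp_eq two_is_prime_nat by blast
              then have "even q" using qp by simp
              then have "q = 2" using q(1) primes_dvd_imp_eq two_is_prime_nat by blast
              then show False using pq prime_ge_2_nat[OF p(1)] by simp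
            qed
            then show False using False qp by simp
          qed
          have c: "cr M \<le> Kb n + (l + (\<kappa> - l) / real q + \<kappa> * (hsum q e - 1))"
            unfolding l_def \<kappa>_def
            by (rule chain_cross_bound[OF p(1,3) an(4,2,1) bn q(1) pq q(2) _ _ M]) (use small qleast in auto)
          have hq: "hsum q e - 1 \<le> 1 / (real q - 1)"
          proof (cases "q < P")
            case True
            have "real q - 1 > 0" using prime_gt_1_nat[OF q(1)] by simp
            then have "real q / (real q - 1) = 1 + 1 / (real q - 1)" by (simp add: field_simps)
            then show ?thesis using e(4)[OF q(1) qe True] by simp
          next
            case False
            have "hsum q e = 1"
            proof (rule hsum_top[OF e(1)])
              fix s assume "prime s" "s dvd e"
              then show "s \<le> q" using e(3)[of s] False by simp
            qed
            then show ?thesis using prime_gt_1_nat[OF q(1)] by simp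
          qed
          have p0: "real p > 0" using p(1) prime_gt_0_nat by simp
          have q2: "real q \<ge> real p + 2" using pq2 by linarith
          have "1 / (real q - 1) \<le> 1 / real p * (1 - 1 / real q)"
          proof -
            have "real p * real q \<le> (real q - 2) * real q" using q2 by (intro mult_right_mono) auto
            also have "\<dots> \<le> (real q - 1) * (real q - 1)" by (simp add: algebra_simps)
            finally have "real p * real q \<le> (real q - 1) * (real q - 1)" .
            moreover have "1 / real p * (1 - 1 / real q) = (real q - 1) / (real p * real q)"
              using p0 q2 by (simp add: field_simps)
            ultimately show ?thesis using p0 q2 by (simp add: divide_le_eq pos_le_divide_eq pos_divide_le_eq mult.commute)
          qed
          also have "\<dots> \<le> (\<kappa> - l) * (1 - 1 / real q)"
            using l q2 p0 by (intro mult_right_mono) auto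
          finally have "1 / (real q - 1) \<le> (\<kappa> - l) * (1 - 1 / real q)" .
          then have "hsum q e - 1 \<le> (\<kappa> - l) * (1 - 1 / real q)" using hq by (rule order_trans[rotated])
          moreover have "\<kappa> * (hsum q e - 1) \<le> 1 * (hsum q e - 1)"
            using hsum_ge_one[OF e(1), of q] by (intro mult_right_mono) (auto simp: \<kappa>_def)
          moreover have "(\<kappa> - l) * (1 - 1 / real q) = (\<kappa> - l) - (\<kappa> - l) / real q"
            by (simp add: right_diff_distrib)
          moreover have "Kb n + (l + d + t) \<le> Kb n + \<kappa>" if "h \<le> z" "t \<le> 1 * h" "z = (\<kappa> - l) - d"
            for h z t d using that by linarith
          ultimately have "cr M \<le> Kb n + \<kappa>" using c order_trans by blast
          then show ?thesis unfolding an(1) \<kappa>_def Kb_split[OF p(1,3) an(4,2)] .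
        qed
      qed
    qed
  qed
  show ?case unfolding bound_def using cr_le_dense[of e "Kb e", OF main] by blast
qed

end

section \<open>Decomposition into cyclic groups of prime power order\<close>

context fin_comm_group begin

text \<open>
  In a finite group these are the subgroups; closure under inverses is automatic.
\<close>

definition mclosed :: "'a set \<Rightarrow> bool" where
  "mclosed K \<longleftrightarrow> K \<subseteq> carrier G \<and> \<one> \<in> K \<and> (\<forall>x\<in>K. \<forall>y\<in>K. x \<otimes> y \<in> K)"

lemma mclosed_pow: "mclosed K \<Longrightarrow> x \<in> K \<Longrightarrow> x [^] (n::nat) \<in> K"
  by (induction n) (auto simp: mclosed_def)

lemma mclosed_inv:
  assumes "mclosed K" "x \<in> K"
  shows "inv x \<in> K"
proof -
  have x: "x \<in> carrier G" using assms by (auto simp: mclosed_def)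
  have "x [^] (ord x - 1) \<otimes> x = x [^] Suc (ord x - 1)" by simp
  also have "Suc (ord x - 1) = ord x" using ord_pos[OF x] by simp
  finally have "x [^] (ord x - 1) \<otimes> x = \<one>" using x by simp
  then have "inv x = x [^] (ord x - 1)" using x by (intro inv_equality) auto
  then show ?thesis using mclosed_pow[OF assms] by simp
qed

definition independent :: "nat \<Rightarrow> (nat \<Rightarrow> 'a) \<Rightarrow> bool" where
  "independent r g \<longleftrightarrow> (\<forall>c::nat \<Rightarrow> nat. (\<Otimes>i\<in>{..<r}. g i [^] c i) = \<one> \<longrightarrow> (\<forall>i<r. ord (g i) dvd c i))"

lemma finprod_closed_mclosed:
  fixes r :: nat
  assumes "mclosed K" "\<And>i. i < r \<Longrightarrow> g i \<in> K"
  shows "(\<Otimes>i\<in>{..<r}. g i [^] (c i :: nat)) \<in> K"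
  using assms(2)
proof (induction r)
  case 0
  then show ?case using assms(1) by (simp add: mclosed_def)
next
  case (Suc r)
  have gc: "g i \<in> carrier G" if "i < Suc r" for i
    using Suc.prems[OF that] assms(1) by (auto simp: mclosed_def)
  have "(\<Otimes>i\<in>{..<Suc r}. g i [^] c i) = g r [^] c r \<otimes> (\<Otimes>i\<in>{..<r}. g i [^] c i)"
    unfolding lessThan_Suc using gc by (intro finprod_insert) auto
  moreover have "(\<Otimes>i\<in>{..<r}. g i [^] c i) \<in> K" using Suc by simp
  moreover have "g r [^] c r \<in> K" using Suc.prems mclosed_pow[OF assms(1)] by simp
  ultimately show ?case using assms(1) by (simp add: mclosed_def)
qed

text \<open>
  A maximal \<open>K\<close> meeting \<open>\<langle>g\<rangle>\<close> trivially is a complement. If not, there is \<open>x \<notin> \<langle>g\<rangle> K\<close> with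
  \<open>x\<^sup>q = g\<^sup>a k\<close> for a prime \<open>q\<close>. Since the order of \<open>g\<close> is maximal, \<open>g\<^sup>a\<close> is a \<open>q\<close>-th power in \<open>\<langle>g\<rangle>\<close>, and
  dividing \<open>x\<close> by a \<open>q\<close>-th root of it one may take \<open>x\<^sup>q \<in> K\<close>. Then \<open>K\<close> and \<open>x\<close> generate a larger
  subgroup that still meets \<open>\<langle>g\<rangle>\<close> trivially.
\<close>

lemma max_p_element_complement:
  assumes H: "mclosed H" and p: "prime p" and g: "g \<in> H" "ord g = p ^ m" "m \<ge> 1"
    and max: "\<And>x k. x \<in> H \<Longrightarrow> ord x = p ^ k \<Longrightarrow> k \<le> m"
  shows "\<exists>K. mclosed K \<and> K \<subseteq> H \<and> (\<forall>a::nat. g [^] a \<in> K \<longrightarrow> g [^] a = \<one>) \<and>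
           (\<forall>x\<in>H. \<exists>a::nat. \<exists>k\<in>K. x = g [^] a \<otimes> k)"
proof -
  have Hc: "H \<subseteq> carrier G" using H by (simp add: mclosed_def)
  have gc: "g \<in> carrier G" using g Hc by blast
  have p0: "p > 0" using p prime_gt_0_nat by simp
  define \<K> where "\<K> = {K. mclosed K \<and> K \<subseteq> H \<and> (\<forall>a::nat. g [^] a \<in> K \<longrightarrow> g [^] a = \<one>)}"
  have "finite \<K>" unfolding \<K>_def
    by (rule finite_subset[of _ "Pow (carrier G)"]) (use fin Hc in auto)
  moreover have "{\<one>} \<in> \<K>" unfolding \<K>_def using H by (auto simp: mclosed_def)
  ultimately obtain K where K: "K \<in> \<K>" and Kmax: "\<And>L. L \<in> \<K> \<Longrightarrow> K \<subseteq> L \<Longrightarrow> L = K"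
    using finite_has_maximal[of \<K>] by (metis empty_iff)
  have mK: "mclosed K" "K \<subseteq> H" "\<And>a::nat. g [^] a \<in> K \<Longrightarrow> g [^] a = \<one>" using K by (auto simp: \<K>_def)
  have Kc: "K \<subseteq> carrier G" using mK Hc by blast
  have one: "\<one> \<in> K" using mK(1) by (simp add: mclosed_def)
  define W where "W = {x. \<exists>a::nat. \<exists>k\<in>K. x = g [^] a \<otimes> k}"
  have W: "mclosed W"
    unfolding mclosed_def
  proof (intro conjI ballI)
    show "W \<subseteq> carrier G" using gc Kc by (auto simp: W_def)
    show "\<one> \<in> W" unfolding W_def using one by (auto intro!: exI[of _ 0] bexI[of _ \<one>])
    fix x y assume "x \<in> W" "y \<in> W"
    then obtain a b k l where x: "k \<in> K" "x = g [^] (a::nat) \<otimes> k" and y: "l \<in> K" "y = g [^] (b::nat) \<otimes> l"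
      unfolding W_def by blast
    have "x \<otimes> y = g [^] (a + b) \<otimes> (k \<otimes> l)"
      using x y gc Kc by (simp add: nat_pow_mult[symmetric] m_ac subset_iff)
    moreover have "k \<otimes> l \<in> K" using mK(1) x y by (simp add: mclosed_def)
    ultimately show "x \<otimes> y \<in> W" unfolding W_def by blast
  qed
  have Wc: "W \<subseteq> carrier G" using W by (simp add: mclosed_def)
  have gW: "g [^] (a::nat) \<in> W" for a unfolding W_def using one gc by (auto intro!: exI[of _ a] bexI[of _ \<one>])
  have KW: "K \<subseteq> W" unfolding W_def
  proof
    fix k assume k: "k \<in> K"
    then have "k = g [^] (0::nat) \<otimes> k" using Kc by auto
    then show "k \<in> {x. \<exists>a::nat. \<exists>k\<in>K. x = g [^] a \<otimes> k}" using k by blast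
  qed
  have "H \<subseteq> W"
  proof (rule ccontr)
    assume "\<not> H \<subseteq> W"
    then obtain y where y: "y \<in> H" "y \<notin> W" by blast
    have yc: "y \<in> carrier G" using y Hc by blast
    define t where "t = (LEAST t. t > 0 \<and> y [^] (t::nat) \<in> W)"
    have "y [^] ord y \<in> W" using W yc by (simp add: mclosed_def)
    then have ex: "\<exists>t. t > 0 \<and> y [^] (t::nat) \<in> W" using ord_pos[OF yc] by blast
    have t: "t > 0" "y [^] t \<in> W" unfolding t_def using LeastI_ex[OF ex] by auto
    have tmin: "t \<le> s" if "s > 0" "y [^] (s::nat) \<in> W" for s
      unfolding t_def using that by (intro Least_le) simp
    have "t \<noteq> 1" using t(2) y(2) yc by (metis nat_pow_eone)
    then obtain q where q: "prime q" "q dvd t" using prime_factor_nat by blast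
    then obtain u where u: "t = q * u" by (elim dvdE)
    have u0: "u > 0" "u < t" using t(1) u q(1) prime_gt_1_nat by (auto intro: Nat.gr0I)
    define x where "x = y [^] u"
    have xW: "x \<notin> W" using tmin[of u] u0 unfolding x_def by auto
    have xH: "x \<in> H" unfolding x_def by (rule mclosed_pow[OF H y(1)])
    have xc: "x \<in> carrier G" using xH Hc by blast
    have "x [^] q = y [^] t" unfolding x_def u using yc by (simp add: nat_pow_pow mult.commute)
    then have "x [^] q \<in> W" using t(2) by simp
    then obtain a k where ak: "k \<in> K" "x [^] q = g [^] (a::nat) \<otimes> k" unfolding W_def by blast
    have kc: "k \<in> carrier G" using ak Kc by blast
    have "\<exists>b::nat. g [^] a = g [^] (q * b)"
    proof (cases "q = p")
      case False
      then have "coprime q (p ^ m)" using p q(1) by (simp add: coprime_power_right_iff primes_coprime)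
      then obtain w where "[q * w = 1] (mod p ^ m)" using cong_solve_coprime_nat[of q "p ^ m"] by auto
      then have "[q * w * a = 1 * a] (mod p ^ m)" by (rule cong_scalar_right)
      then have "[q * (w * a) = a] (mod ord g)" using g(2) by (simp add: mult.assoc)
      then have "[int (q * (w * a)) = int a] (mod int (ord g))" by (simp only: cong_int_iff)
      then have "int (ord g) dvd int a - int (q * (w * a))" by (simp only: cong_iff_dvd_diff dvd_diff_commute)
      then have "g [^] int (q * (w * a)) = g [^] int a" using int_pow_eq[OF gc] by blast
      then have "g [^] a = g [^] (q * (w * a))" unfolding int_pow_int by (rule sym)
      then show ?thesis by blast
    next
      case True
      obtain n' where n': "ord x = p ^ multiplicity p (ord x) * n'" "\<not> p dvd n'"
      proof (rule multiplicity_decompose'[of "ord x" p])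
        show "ord x \<noteq> 0" using ord_pos[OF xc] by simp
        show "\<not> is_unit p" using p not_prime_unit by blast
      qed blast
      have "ord (x [^] n') = p ^ multiplicity p (ord x)"
        by (rule ord_pow_cofactor[OF p xc _ n'(2), of "multiplicity p (ord x)"]) (use n'(1) in simp)
      then have "multiplicity p (ord x) \<le> m" using max mclosed_pow[OF H xH] by blast
      then have "ord x dvd p ^ m * n'" using n'(1) 
        by (metis dvd_refl le_imp_power_dvd mult_dvd_mono)
      moreover have pm: "p ^ m = p * p ^ (m - 1)" using g(3) by (metis One_nat_def Suc_le_D diff_Suc_1 power_Suc)
      ultimately have "ord x dvd p * (p ^ (m - 1) * n')" by (simp only: mult.assoc)
      then have "x [^] (p * (p ^ (m - 1) * n')) = \<one>" using xc pow_one_iff by blast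
      then have "(x [^] p) [^] (p ^ (m - 1) * n') = \<one>" using xc by (simp add: nat_pow_pow)
      then have "(g [^] a \<otimes> k) [^] (p ^ (m - 1) * n') = \<one>" using ak(2) True by simp
      then have "g [^] (a * (p ^ (m - 1) * n')) \<otimes> k [^] (p ^ (m - 1) * n') = \<one>"
        using gc kc by (simp add: nat_pow_distrib nat_pow_pow)
      then have "g [^] (a * (p ^ (m - 1) * n')) = inv (k [^] (p ^ (m - 1) * n'))"
        using gc kc by (metis inv_equality nat_pow_closed inv_inv inv_closed)
      moreover have "inv (k [^] (p ^ (m - 1) * n')) \<in> K"
        using mclosed_inv[OF mK(1)] mclosed_pow[OF mK(1) ak(1)] by blast
      ultimately have "g [^] (a * (p ^ (m - 1) * n')) \<in> K" by (simp only:)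
      then have "g [^] (a * (p ^ (m - 1) * n')) = \<one>" by (rule mK(3))
      then have "p * p ^ (m - 1) dvd a * (p ^ (m - 1) * n')" using gc pow_one_iff g(2) pm by simp
      then have "p * p ^ (m - 1) dvd (a * n') * p ^ (m - 1)" by (simp only: ac_simps)
      then have "p dvd a * n'" using p0 by simp
      then have "p dvd a" using n'(2) p prime_dvd_mult_iff by blast
      then show ?thesis using True by (elim dvdE) auto
    qed
    then obtain b :: nat where b: "g [^] a = g [^] (q * b)" by blast
    (* x is corrected by a q-th root of the component of x^q in the span of g, so that the q-th power lies in K *)
    define x' where "x' = x \<otimes> inv (g [^] b)"
    have gb: "g [^] b \<in> carrier G" "g [^] b \<in> H" using gc mclosed_pow[OF H g(1)] by auto
    have x'c: "x' \<in> carrier G" unfolding x'_def using xc gb by simp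
    have x'H: "x' \<in> H" unfolding x'_def using H xH mclosed_inv[OF H gb(2)] by (simp add: mclosed_def)
    have "x' \<otimes> g [^] b = x" unfolding x'_def using xc gb by (simp add: m_assoc)
    then have x'W: "x' \<notin> W" using xW gW[of b] W unfolding mclosed_def by metis
    have x'q: "x' [^] q = k"
    proof -
      have "x' [^] q = x [^] q \<otimes> inv (g [^] (q * b))"
        unfolding x'_def using xc gb gc by (simp add: nat_pow_distrib nat_pow_inv nat_pow_pow mult.commute)
      also have "\<dots> = k" using ak(2) b gc kc by (simp add: m_ac)
      finally show ?thesis .
    qed
    define L where "L = {z. \<exists>k1\<in>K. \<exists>i::nat. z = k1 \<otimes> x' [^] i}"
    have "L \<in> \<K>"
      unfolding \<K>_def mem_Collect_eq
    proof (intro conjI allI impI)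
      show mL: "mclosed L"
        unfolding mclosed_def
      proof (intro conjI ballI)
        show "L \<subseteq> carrier G" unfolding L_def using Kc x'c by auto
        show "\<one> \<in> L" unfolding L_def using one by (auto intro!: bexI[of _ \<one>] exI[of _ 0])
        fix z w assume "z \<in> L" "w \<in> L"
        then obtain k1 k2 i j where z: "k1 \<in> K" "z = k1 \<otimes> x' [^] (i::nat)" and w: "k2 \<in> K" "w = k2 \<otimes> x' [^] (j::nat)"
          unfolding L_def by blast
        have "z \<otimes> w = (k1 \<otimes> k2) \<otimes> x' [^] (i + j)"
          using z w x'c Kc by (simp add: nat_pow_mult[symmetric] m_ac subset_iff)
        moreover have "k1 \<otimes> k2 \<in> K" using mK(1) z w by (simp add: mclosed_def)
        ultimately show "z \<otimes> w \<in> L" unfolding L_def by blast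
      qed
      show "L \<subseteq> H" unfolding L_def using H mK(2) mclosed_pow[OF H x'H] by (auto simp: mclosed_def)
      fix c :: nat assume "g [^] c \<in> L"
      then obtain k1 i where ki: "k1 \<in> K" "g [^] c = k1 \<otimes> x' [^] (i::nat)" unfolding L_def by blast
      have k1c: "k1 \<in> carrier G" using ki Kc by blast
      show "g [^] c = \<one>"
      proof (cases "q dvd i")
        case True
        then obtain j where "i = q * j" by (elim dvdE)
        then have "x' [^] i = k [^] j" using x'q x'c by (metis nat_pow_pow)
        then have "g [^] c \<in> K" using ki mclosed_pow[OF mK(1) ak(1)] mK(1) by (simp add: mclosed_def)
        then show ?thesis by (rule mK(3))
      next
        case False
        then have "coprime i q" using q(1) by (meson coprime_commute prime_imp_coprime)
        then obtain w where "[i * w = 1] (mod q)" using cong_solve_coprime_nat[of i q] by auto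
        then have "(i * w) mod q = 1" using prime_gt_1_nat[OF q(1)] by (simp add: cong_def)
        then obtain v where v: "i * w = q * v + 1" by (metis mult_div_mod_eq)
        have "x' [^] i = inv k1 \<otimes> g [^] c" using ki(2) k1c x'c gc by (simp add: m_assoc[symmetric])
        moreover have "inv k1 \<in> W" using mclosed_inv[OF mK(1) ki(1)] KW by blast
        ultimately have "x' [^] i \<in> W" using gW[of c] W by (simp add: mclosed_def)
        then have "x' [^] (i * w) \<in> W" using mclosed_pow[OF W] x'c by (metis nat_pow_pow)
        moreover have "x' [^] (i * w) = k [^] v \<otimes> x'"
          unfolding v using x'c x'q by (metis nat_pow_Suc nat_pow_pow Suc_eq_plus1)
        moreover have kv: "k [^] v \<in> K" using mclosed_pow[OF mK(1) ak(1)] .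
        ultimately have "inv (k [^] v) \<otimes> (k [^] v \<otimes> x') \<in> W"
          using mclosed_inv[OF mK(1) kv] KW W unfolding mclosed_def by (metis subsetD)
        moreover have "inv (k [^] v) \<otimes> (k [^] v \<otimes> x') = x'" using kc x'c by (simp add: m_assoc[symmetric])
        ultimately show ?thesis using x'W by simp
      qed
    qed
    moreover have "K \<subseteq> L"
    proof
      fix k assume k: "k \<in> K"
      then have "k = k \<otimes> x' [^] (0::nat)" using Kc by auto
      then show "k \<in> L" unfolding L_def using k by blast
    qed
    ultimately have "L = K" using Kmax by blast
    moreover have "x' \<in> L"
    proof -
      have "x' = \<one> \<otimes> x' [^] (1::nat)" using x'c by simp
      then show ?thesis unfolding L_def using one by blast
    qed
    ultimately show False using x'W KW by blast
  qed
  then show ?thesis using mK unfolding W_def by blast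
qed

lemma exists_prime_power_basis:
  "mclosed H \<Longrightarrow> \<exists>r g. independent r g \<and> (\<forall>i<r. g i \<in> H \<and> (\<exists>p k. prime p \<and> k \<ge> 1 \<and> ord (g i) = p ^ k)) \<and>
     (\<forall>x\<in>H. \<exists>c::nat \<Rightarrow> nat. x = (\<Otimes>i\<in>{..<r}. g i [^] c i))"
proof (induction "card H" arbitrary: H rule: less_induct)
  case less
  note H = less.prems
  have Hc: "H \<subseteq> carrier G" "\<one> \<in> H" using H by (auto simp: mclosed_def)
  show ?case
  proof (cases "H = {\<one>}")
    case True
    then show ?thesis
      by (intro exI[of _ 0] exI[of _ "\<lambda>_. \<one>"]) (auto simp: independent_def)
  next
    case False
    then obtain y where y: "y \<in> H" "y \<noteq> \<one>" using Hc by blast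
    have yc: "y \<in> carrier G" using y Hc by blast
    have "ord y \<noteq> 1" using y(2) ord_eq_1[OF yc] by simp
    then obtain p where p: "prime p" "p dvd ord y" using prime_factor_nat by blast
    have "ord (y [^] (ord y div p)) = p"
    proof -
      have "ord y div p dvd ord y" using p(2) by (metis dvd_div_mult_self dvd_triv_left)
      moreover have "ord y div p \<noteq> 0" using p(2) ord_pos[OF yc] by (metis dvd_div_eq_0_iff less_irrefl)
      ultimately have "ord (y [^] (ord y div p)) = ord y div (ord y div p)" by (rule ord_pow[OF yc])
      also have "\<dots> = p" using p(2) ord_pos[OF yc] by (metis div_div_eq_right dvd_refl div_self less_irrefl mult_1 dvd_div_eq_0_iff nonzero_mult_div_cancel_left dvd_mult_div_cancel)
      finally show ?thesis .
    qed
    then have ex: "\<exists>x\<in>H. ord x = p ^ 1" using mclosed_pow[OF H y(1)] by auto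
    define S where "S = {k. \<exists>x\<in>H. ord x = p ^ k}"
    have fS: "finite S"
    proof (rule finite_subset)
      show "S \<subseteq> {..card (carrier G)}"
      proof
        fix k assume "k \<in> S"
        then obtain x where x: "x \<in> H" "ord x = p ^ k" by (auto simp: S_def)
        then have "p ^ k \<le> card (carrier G)"
          using ord_le_group_order[OF fin, of x] Hc(1) unfolding Coset.order_def by auto
        moreover have "k < p ^ k" using p(1) prime_gt_1_nat by (intro power_gt_expt) auto
        ultimately show "k \<in> {..card (carrier G)}" by simp
      qed
    qed simp
    define m where "m = Max S"
    have "1 \<in> S" using ex by (simp add: S_def)
    then have m: "m \<in> S" "m \<ge> 1" and mmax: "\<And>k. k \<in> S \<Longrightarrow> k \<le> m"
      unfolding m_def using fS by (auto intro: Max_in Max_ge)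
    obtain g where g: "g \<in> H" "ord g = p ^ m" using m(1) by (auto simp: S_def)
    have gc: "g \<in> carrier G" using g Hc by blast
    obtain K where K: "mclosed K" "K \<subseteq> H" "\<And>a::nat. g [^] a \<in> K \<Longrightarrow> g [^] a = \<one>"
      "\<And>x. x \<in> H \<Longrightarrow> \<exists>a::nat. \<exists>k\<in>K. x = g [^] a \<otimes> k"
      using max_p_element_complement[OF H p(1) g m(2)] mmax unfolding S_def by blast
    have "g \<notin> K"
    proof
      assume "g \<in> K"
      then have "g = \<one>" using K(3)[of 1] gc by simp
      then have "p ^ m = 1" using g(2) by simp
      then show False using m(2) p(1) prime_gt_1_nat[OF p(1)] by simp
    qed
    then have "K \<subset> H" using K(2) g(1) by blast
    then have "card K < card H" using Hc fin by (meson finite_subset psubset_card_mono)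
    then obtain r gs where IH: "independent r gs"
      "\<forall>i<r. gs i \<in> K \<and> (\<exists>p k. prime p \<and> k \<ge> 1 \<and> ord (gs i) = p ^ k)"
      "\<forall>x\<in>K. \<exists>c::nat \<Rightarrow> nat. x = (\<Otimes>i\<in>{..<r}. gs i [^] c i)"
      using less.hyps[OF _ K(1)] by blast
    have Kc: "K \<subseteq> carrier G" using K Hc by blast
    define h where "h = gs(r := g)"
    have hc: "h i \<in> carrier G" if "i < Suc r" for i
      using that IH(2) Kc gc unfolding h_def by (auto simp: less_Suc_eq)
    have prod: "(\<Otimes>i\<in>{..<Suc r}. h i [^] c i) = g [^] c r \<otimes> (\<Otimes>i\<in>{..<r}. gs i [^] c i)" for c :: "nat \<Rightarrow> nat"
    proof -
      have "(\<Otimes>i\<in>{..<Suc r}. h i [^] c i) = h r [^] c r \<otimes> (\<Otimes>i\<in>{..<r}. h i [^] c i)"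
        unfolding lessThan_Suc using hc by (intro finprod_insert) auto
      also have "(\<Otimes>i\<in>{..<r}. h i [^] c i) = (\<Otimes>i\<in>{..<r}. gs i [^] c i)"
        using IH(2) Kc by (intro finprod_cong') (auto simp: h_def)
      finally show ?thesis by (simp add: h_def)
    qed
    have inK: "(\<Otimes>i\<in>{..<r}. gs i [^] c i) \<in> K" for c :: "nat \<Rightarrow> nat"
      using finprod_closed_mclosed[OF K(1)] IH(2) by blast
    have "independent (Suc r) h"
      unfolding independent_def
    proof (intro allI impI)
      fix c :: "nat \<Rightarrow> nat" and i assume eq: "(\<Otimes>i\<in>{..<Suc r}. h i [^] c i) = \<one>" and i: "i < Suc r"
      let ?z = "\<Otimes>i\<in>{..<r}. gs i [^] c i"
      have zc: "?z \<in> carrier G" using inK Kc by blast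
      have "g [^] c r \<otimes> ?z = \<one>" using eq prod by simp
      then have "g [^] c r = inv ?z" using zc gc by (metis inv_equality nat_pow_closed inv_inv inv_closed)
      then have "g [^] c r \<in> K" using mclosed_inv[OF K(1) inK] by simp
      then have one: "g [^] c r = \<one>" by (rule K(3))
      then have "?z = \<one>" using \<open>g [^] c r \<otimes> ?z = \<one>\<close> zc by simp
      then have "\<forall>i<r. ord (gs i) dvd c i" using IH(1) unfolding independent_def by blast
      moreover have "ord g dvd c r" using one gc pow_one_iff by blast
      ultimately show "ord (h i) dvd c i" using i unfolding h_def by (auto simp: less_Suc_eq)
    qed
    moreover have "h i \<in> H \<and> (\<exists>p k. prime p \<and> k \<ge> 1 \<and> ord (h i) = p ^ k)" if "i < Suc r" for i
      using that IH(2) K(2) g p(1) m(2) unfolding h_def by (auto simp: less_Suc_eq)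
    moreover have "\<exists>c::nat \<Rightarrow> nat. x = (\<Otimes>i\<in>{..<Suc r}. h i [^] c i)" if x: "x \<in> H" for x
    proof -
      obtain a k where ak: "k \<in> K" "x = g [^] (a::nat) \<otimes> k" using K(4)[OF x] by blast
      obtain c :: "nat \<Rightarrow> nat" where c: "k = (\<Otimes>i\<in>{..<r}. gs i [^] c i)" using IH(3) ak(1) by blast
      have "(\<Otimes>i\<in>{..<r}. gs i [^] (c(r := a)) i) = k"
        unfolding c using IH(2) Kc by (intro finprod_cong') auto
      then have "x = (\<Otimes>i\<in>{..<Suc r}. h i [^] (c(r := a)) i)" unfolding prod using ak(2) by simp
      then show ?thesis by blast
    qed
    ultimately show ?thesis by blast
  qed
qed

end

section \<open>The upper bound in coordinates\<close>

text \<open>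
  An isomorphism onto a product of cyclic groups is used as a system of coordinates: \<open>h x i\<close> is the
  representative in \<open>[0, n i)\<close>.
\<close>

locale cyclic_decomposition = fin_comm_group G for G (structure) +
  fixes r :: nat and p \<alpha> :: "nat \<Rightarrow> nat" and h :: "'a \<Rightarrow> nat \<Rightarrow> int"
  assumes prime_p: "\<And>i. i < r \<Longrightarrow> prime (p i)"
    and \<alpha>_pos: "\<And>i. i < r \<Longrightarrow> \<alpha> i \<ge> 1"
    and h_iso: "h \<in> iso G (product_group {..<r} (\<lambda>i. integer_mod_group (p i ^ \<alpha> i)))"
begin

abbreviation n :: "nat \<Rightarrow> nat" where
  "n i \<equiv> p i ^ \<alpha> i"

lemma n_gt_1: "i < r \<Longrightarrow> 1 < n i"
  using prime_gt_1_nat[OF prime_p] \<alpha>_pos by (metis One_nat_def Suc_le_lessD one_less_power)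

lemma h_carrier:
  assumes "x \<in> carrier G"
  shows "h x \<in> (\<Pi>\<^sub>E i\<in>{..<r}. carrier (integer_mod_group (n i)))"
  using h_iso assms unfolding iso_def hom_def by auto

lemma h_range:
  assumes "x \<in> carrier G" "i < r"
  shows "0 \<le> h x i" "h x i < int (n i)"
  using PiE_mem[OF h_carrier[OF assms(1)], of i] assms(2) prime_gt_0_nat[OF prime_p[OF assms(2)]]
  by (auto simp: carrier_integer_mod_group split: if_splits)

lemma h_mult:
  assumes "x \<in> carrier G" "y \<in> carrier G" "i < r"
  shows "h (x \<otimes> y) i = (h x i + h y i) mod int (n i)"
  using h_iso assms unfolding iso_def hom_def by auto

lemma h_one:
  assumes "i < r"
  shows "h \<one> i = 0"
proof -
  have "h (\<one> \<otimes> \<one>) i = (h \<one> i + h \<one> i) mod int (n i)" using assms by (intro h_mult) auto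
  then have "(h \<one> i + h \<one> i) mod int (n i) = h \<one> i mod int (n i)"
    using h_range[OF one_closed assms] by simp
  then have "int (n i) dvd h \<one> i" by (metis add_diff_cancel_left' mod_eq_dvd_iff)
  then show ?thesis using h_range[OF one_closed assms] by (metis zdvd_not_zless order_le_less)
qed

lemma h_pow:
  assumes "x \<in> carrier G" "i < r"
  shows "h (x [^] (k::nat)) i = (int k * h x i) mod int (n i)"
proof (induction k)
  case 0
  then show ?case using h_one assms by simp
next
  case (Suc k)
  have "h (x [^] Suc k) i = (h (x [^] k) i + h x i) mod int (n i)"
    using assms by (simp add: h_mult)
  also have "\<dots> = (int (Suc k) * h x i) mod int (n i)"
    by (simp only: Suc mod_add_left_eq) (simp add: algebra_simps)
  finally show ?case .
qed

lemma h_inj: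
  assumes "x \<in> carrier G" "y \<in> carrier G" "\<And>i. i < r \<Longrightarrow> h x i = h y i"
  shows "x = y"
proof -
  have "h x = h y"
    by (rule PiE_ext[OF h_carrier[OF assms(1)] h_carrier[OF assms(2)]]) (use assms(3) in auto)
  moreover have "inj_on h (carrier G)" using h_iso by (auto simp: iso_def bij_betw_def)
  ultimately show ?thesis using assms by (auto dest: inj_onD)
qed

lemma h_surj:
  assumes "\<And>i. i < r \<Longrightarrow> 0 \<le> f i \<and> f i < int (n i)"
  shows "\<exists>x\<in>carrier G. \<forall>i<r. h x i = f i"
proof -
  have "restrict f {..<r} \<in> (\<Pi>\<^sub>E i\<in>{..<r}. carrier (integer_mod_group (n i)))"
    using assms n_gt_1 by (auto simp: carrier_integer_mod_group)
  moreover have "h ` carrier G = (\<Pi>\<^sub>E i\<in>{..<r}. carrier (integer_mod_group (n i)))"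
    using h_iso by (auto simp: iso_def bij_betw_def)
  ultimately obtain x where "x \<in> carrier G" "restrict f {..<r} = h x" by (metis imageE)
  then show ?thesis by (metis lessThan_iff restrict_apply')
qed

lemma pow_one_iff_coords:
  assumes "x \<in> carrier G"
  shows "x [^] (k::nat) = \<one> \<longleftrightarrow> (\<forall>i<r. int (n i) dvd int k * h x i)"
proof
  assume "x [^] k = \<one>"
  then show "\<forall>i<r. int (n i) dvd int k * h x i"
    using h_pow[OF assms, of _ k] h_one by (metis mod_0_imp_dvd)
next
  assume *: "\<forall>i<r. int (n i) dvd int k * h x i"
  show "x [^] k = \<one>"
  proof (rule h_inj)
    fix i assume "i < r"
    then show "h (x [^] k) i = h \<one> i" using * h_pow[OF assms] h_one by simp
  qed (use assms in auto)
qed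

lemma coprime_prime_powers: "prime s \<Longrightarrow> prime q \<Longrightarrow> s \<noteq> q \<Longrightarrow> coprime ((s::nat) ^ a) (q ^ b)"
  by (simp add: primes_coprime)

lemma h_other_prime:
  assumes "x \<in> carrier G" "ord x = s ^ k" "prime s" "i < r" "p i \<noteq> s"
  shows "h x i = 0"
proof -
  have "x [^] (s ^ k) = \<one>" using assms(1,2) pow_one_iff by simp
  then have "int (n i) dvd int (s ^ k) * h x i" using pow_one_iff_coords[OF assms(1)] assms(4) by blast
  moreover have "coprime (n i) (s ^ k)" using coprime_prime_powers prime_p assms by simp
  then have "coprime (int (n i)) (int (s ^ k))" by (simp only: coprime_int_iff)
  ultimately have "int (n i) dvd h x i" by (metis coprime_dvd_mult_right_iff)
  then show ?thesis using h_range[OF assms(1,4)] by (metis zdvd_not_zless order_le_less)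
qed

definition comps :: "nat \<Rightarrow> nat set" where
  "comps s = {i. i < r \<and> p i = s}"

lemma cross_number_p_part_le:
  assumes s: "prime s" and z: "zsf M" and M: "\<And>x. x \<in># M \<Longrightarrow> \<exists>k. ord x = s ^ k"
  shows "cr M \<le> (\<Sum>i\<in>comps s. 1 - 1 / real (s ^ \<alpha> i))"
proof (rule cross_number_p_group_le[where \<pi> = "\<lambda>i x. nat (h x i)", OF s _ _ _ z M])
  show "finite (comps s)" by (simp add: comps_def)
next
  fix j x y assume j: "j \<in> comps s" and x: "x \<in> carrier G" and y: "y \<in> carrier G"
  have jr: "j < r" "p j = s" using j by (auto simp: comps_def)
  have "nat (h (x \<otimes> y) j) = nat ((h x j + h y j) mod int (s ^ \<alpha> j))" using h_mult[OF x y jr(1)] jr(2) by simp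
  also have "\<dots> = (nat (h x j) + nat (h y j)) mod s ^ \<alpha> j"
    using h_range[OF x jr(1)] h_range[OF y jr(1)] by (simp add: nat_mod_distrib nat_add_distrib nat_power_eq)
  finally show "nat (h (x \<otimes> y) j) mod s ^ \<alpha> j = (nat (h x j) + nat (h y j)) mod s ^ \<alpha> j" by simp
next
  fix x k assume x: "x \<in> carrier G" and k: "ord x = s ^ k"
    and d: "\<And>j. j \<in> comps s \<Longrightarrow> s ^ \<alpha> j dvd nat (h x j)"
  show "x = \<one>"
  proof (rule h_inj)
    fix i assume i: "i < r"
    show "h x i = h \<one> i"
    proof (cases "p i = s")
      case True
      then have "n i dvd nat (h x i)" using d[of i] i by (simp add: comps_def)
      moreover have "nat (h x i) < n i" using h_range[OF x i] by linarith
      ultimately have "nat (h x i) = 0" by (meson dvd_imp_le gr0I not_less)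
      then show ?thesis using h_range[OF x i] h_one[OF i] by linarith
    next
      case False
      then show ?thesis using h_other_prime[OF x k s i] h_one[OF i] by simp
    qed
  qed (use x in auto)
qed

lemma exists_unit_vector:
  assumes "i < r"
  shows "\<exists>x\<in>carrier G. \<forall>j<r. h x j = (if j = i then 1 else 0)"
proof (rule h_surj)
  fix j assume j: "j < r"
  have "0 < p j" using prime_gt_0_nat[OF prime_p[OF j]] .
  moreover have "1 < int (n j)" using n_gt_1[OF j] by linarith
  ultimately show "0 \<le> (if j = i then 1 else 0 :: int) \<and> (if j = i then 1 else 0) < int (n j)" by auto
qed

text \<open>
  The standard generators.
\<close>

definition u :: "nat \<Rightarrow> 'a" where
  "u i = (SOME x. x \<in> carrier G \<and> (\<forall>j<r. h x j = (if j = i then 1 else 0)))"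

text \<open>
  The standard generators.
\<close>

lemma u:
  assumes "i < r"
  shows "u i \<in> carrier G" "\<And>j. j < r \<Longrightarrow> h (u i) j = (if j = i then 1 else 0)"
  using someI_ex[of "\<lambda>x. x \<in> carrier G \<and> (\<forall>j<r. h x j = (if j = i then 1 else 0))"]
    exists_unit_vector[OF assms] unfolding u_def by blast+

lemma annihilates_iff: "(\<forall>x\<in>carrier G. x [^] (k::nat) = \<one>) \<longleftrightarrow> (\<forall>i<r. n i dvd k)"
proof
  assume *: "\<forall>x\<in>carrier G. x [^] k = \<one>"
  show "\<forall>i<r. n i dvd k"
  proof (intro allI impI)
    fix i assume i: "i < r"
    have "u i [^] k = \<one>" using * u(1)[OF i] by blast
    then have "int (n i) dvd int k * h (u i) i" using pow_one_iff_coords[OF u(1)[OF i]] i by blast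
    then have "int (n i) dvd int k" using u(2)[OF i i] by simp
    then show "n i dvd k" by (simp only: int_dvd_int_iff)
  qed
next
  assume *: "\<forall>i<r. n i dvd k"
  then have "\<forall>i<r. int (n i) dvd int k" by (simp only: int_dvd_int_iff)
  then show "\<forall>x\<in>carrier G. x [^] k = \<one>" by (simp add: pow_one_iff_coords)
qed

lemma ord_u:
  assumes i: "i < r"
  shows "ord (u i) = n i"
proof -
  have "ord (u i) dvd k \<longleftrightarrow> n i dvd k" for k
  proof -
    have "ord (u i) dvd k \<longleftrightarrow> (\<forall>j<r. int (n j) dvd int k * h (u i) j)"
      using pow_one_iff[OF u(1)[OF i]] pow_one_iff_coords[OF u(1)[OF i]] by blast
    also have "\<dots> \<longleftrightarrow> int (n i) dvd int k" using u(2)[OF i] i by auto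
    also have "\<dots> \<longleftrightarrow> n i dvd k" by (simp only: int_dvd_int_iff)
    finally show ?thesis .
  qed
  then show ?thesis by (metis dvd_antisym dvd_refl)
qed

lemma group_exp:
  shows "group_exp G > 0" "\<And>i. i < r \<Longrightarrow> n i dvd group_exp G" "\<And>x. x \<in> carrier G \<Longrightarrow> ord x dvd group_exp G"
    "\<And>k. k > 0 \<Longrightarrow> (\<And>i. i < r \<Longrightarrow> n i dvd k) \<Longrightarrow> group_exp G \<le> k"
proof -
  let ?Q = "\<lambda>k::nat. k > 0 \<and> (\<forall>x\<in>carrier G. x [^] k = \<one>)"
  have "?Q (\<Prod>i<r. n i)"
    unfolding annihilates_iff by (auto intro!: prod_pos dvd_prodI simp: prime_p prime_gt_0_nat)
  then have Q: "?Q (group_exp G)" unfolding group_exp_def by (rule LeastI[of ?Q])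
  then show "group_exp G > 0" "\<And>i. i < r \<Longrightarrow> n i dvd group_exp G"
    unfolding annihilates_iff by blast+
  show "ord x dvd group_exp G" if "x \<in> carrier G" for x using Q pow_one_iff that by blast
  show "group_exp G \<le> k" if "k > 0" "\<And>i. i < r \<Longrightarrow> n i dvd k" for k
    unfolding group_exp_def using that annihilates_iff by (intro Least_le) blast
qed

text \<open>
  Otherwise \<open>group_exp G / s\<close> would also annihilate the group.
\<close>

lemma exp_attained:
  assumes s: "prime s" "s dvd group_exp G"
  shows "\<exists>i\<in>comps s. \<alpha> i = multiplicity s (group_exp G)"
proof (rule ccontr)
  let ?e = "group_exp G"
  assume *: "\<not> ?thesis"
  obtain k where k: "?e = s * k" using s(2) by (elim dvdE)
  have k0: "k > 0" using group_exp(1) k by (cases k) auto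
  have "n i dvd k" if i: "i < r" for i
  proof (cases "p i = s")
    case True
    have "s ^ \<alpha> i dvd ?e" using group_exp(2)[OF i] True by simp
    then have "\<alpha> i \<le> multiplicity s ?e"
      using s group_exp(1) by (intro multiplicity_geI) (auto simp: prime_gt_0_nat prime_nat_iff)
    moreover have "\<alpha> i \<noteq> multiplicity s ?e" using * i True by (auto simp: comps_def)
    ultimately have "s ^ Suc (\<alpha> i) dvd ?e" by (intro multiplicity_dvd') simp
    then show ?thesis using k s prime_gt_0_nat True by simp
  next
    case False
    have "coprime (n i) (s ^ 1)" by (rule coprime_prime_powers) (use False s prime_p i in auto)
    then show ?thesis using group_exp(2)[OF i] k by (metis coprime_dvd_mult_right_iff power_one_right)
  qed
  then have "?e \<le> k" using group_exp(4) k0 by blast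
  then show False using k k0 prime_gt_1_nat[OF s(1)] by (simp add: mult_le_cancel2)
qed

lemma card_carrier: "card (carrier G) = (\<Prod>i<r. n i)"
proof -
  have "card (carrier G) = card (\<Pi>\<^sub>E i\<in>{..<r}. carrier (integer_mod_group (n i)))"
    using h_iso by (auto simp: iso_def intro: bij_betw_same_card)
  also have "\<dots> = (\<Prod>i<r. card (carrier (integer_mod_group (n i))))" by (simp add: card_PiE)
  also have "\<dots> = (\<Prod>i<r. n i)"
  proof (rule prod.cong)
    fix i assume "i \<in> {..<r}"
    then have "p i > 0" using prime_p prime_gt_0_nat by simp
    then show "card (carrier (integer_mod_group (n i))) = n i" by (simp add: carrier_integer_mod_group nat_power_eq)
  qed simp
  finally show ?thesis .
qed

text \<open>
  A generator of the cyclic Sylow subgroup has order the full power of \<open>s\<close> in \<open>|G|\<close>, but its order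
  is at most the largest \<open>s ^ \<alpha> i\<close>; so there is no room for a second component.
\<close>

lemma comps_cyclic_unique:
  assumes s: "prime s" and cyc: "\<And>Q. is_p_component G s Q \<Longrightarrow> cyclic_group (G\<lparr>carrier := Q\<rparr>)"
    and ij: "i \<in> comps s" "j \<in> comps s"
  shows "i = j"
proof -
  let ?N = "multiplicity s (card (carrier G))"
  have card0: "card (carrier G) > 0" using fin by (simp add: card_gt_0_iff) (use one_closed in blast)
  obtain m where "card (carrier G) = s ^ ?N * m" using multiplicity_dvd[of s "card (carrier G)"] by (elim dvdE)
  then obtain Q where Q: "subgroup Q G" "card Q = s ^ ?N"
    using sylow_thm[OF s is_group _ fin, of ?N m] unfolding Coset.order_def by blast
  interpret Q: group "G\<lparr>carrier := Q\<rparr>" using Q(1) by (rule subgroup_imp_group)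
  have "cyclic_group (G\<lparr>carrier := Q\<rparr>)" using cyc Q s by (simp add: is_p_component_def)
  then obtain g where g: "g \<in> Q" "Q = range (\<lambda>k::int. g [^]\<^bsub>G\<lparr>carrier := Q\<rparr>\<^esub> k)"
    unfolding Q.cyclic_group by auto
  have gc: "g \<in> carrier G" using g(1) Q(1) subgroup.subset by blast
  have "Q = range (\<lambda>k::int. g [^] k)" using g int_pow_consistent[OF Q(1) g(1)] by simp
  also have "\<dots> = generate G {g}" unfolding generate_pow[OF gc] by auto
  finally have ordg: "ord g = s ^ ?N" using generate_pow_card[OF gc] Q(2) by simp
  have fc: "finite (comps s)" by (simp add: comps_def)
  define m where "m = Max (\<alpha> ` comps s)"
  obtain k where k: "k \<in> comps s" "\<alpha> k = m"
    unfolding m_def using Max_in[of "\<alpha> ` comps s"] fc ij(1)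
    by (metis empty_iff finite_imageI imageE image_is_empty)
  have le: "\<alpha> l \<le> m" if "l \<in> comps s" for l unfolding m_def using fc that by auto
  have "g [^] (s ^ m) = \<one>"
    unfolding pow_one_iff_coords[OF gc]
  proof (intro allI impI)
    fix l assume l: "l < r"
    show "int (n l) dvd int (s ^ m) * h g l"
    proof (cases "p l = s")
      case True
      then have "n l dvd s ^ m" using le[of l] l by (auto simp: comps_def le_imp_power_dvd)
      then have "int (n l) dvd int (s ^ m)" by (simp only: int_dvd_int_iff)
      then show ?thesis by (rule dvd_mult2)
    next
      case False
      then show ?thesis using h_other_prime[OF gc ordg s l] by simp
    qed
  qed
  then have "s ^ ?N dvd s ^ m" using pow_one_iff[OF gc] ordg by simp
  then have Nm: "?N \<le> m" using prime_gt_1_nat[OF s] by (metis power_dvd_imp_le)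
  have "l = k" if l: "l \<in> comps s" for l
  proof (rule ccontr)
    assume lk: "l \<noteq> k"
    have "(\<Prod>i\<in>{l, k}. n i) dvd (\<Prod>i<r. n i)"
      by (rule prod_dvd_prod_subset) (use l k in \<open>auto simp: comps_def\<close>)
    moreover have "(\<Prod>i\<in>{l, k}. n i) = s ^ (\<alpha> l + m)" using lk l k by (auto simp: comps_def power_add)
    ultimately have "s ^ (\<alpha> l + m) dvd card (carrier G)" using card_carrier by simp
    then have "\<alpha> l + m \<le> ?N"
      using s card0 by (intro multiplicity_geI) (auto simp: prime_gt_0_nat prime_nat_iff)
    moreover have "\<alpha> l \<ge> 1" using \<alpha>_pos l by (simp add: comps_def)
    ultimately show False using Nm by simp
  qed
  then show ?thesis using ij by blast
qed

text \<open>
  The exponents \<open>\<alpha> i\<close> are recovered from \<open>group_exp G\<close> by \<open>exp_attained\<close>, so that the bound \<open>Kb\<close> is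
  part of the sum over the components.
\<close>

lemma cross_number_le:
  assumes w: "wide (group_exp G)"
    and cyc: "\<And>s Q. is_p_component G s Q \<Longrightarrow> s \<noteq> largest_prime (group_exp G) \<Longrightarrow> cyclic_group (G\<lparr>carrier := Q\<rparr>)"
    and z: "zsf M"
  shows "cr M \<le> (\<Sum>i<r. 1 - 1 / real (n i))"
proof -
  let ?e = "group_exp G"
  have nonneg: "0 \<le> 1 - 1 / real (n i)" if "i < r" for i
    using n_gt_1[OF that] by (metis diff_ge_0_iff_ge divide_le_eq_1_pos le_less of_nat_0_less_iff of_nat_1 of_nat_less_iff less_trans zero_less_one)
  show ?thesis
  proof (cases "?e = 1")
    case True
    have "M = {#}"
    proof (rule ccontr)
      assume "M \<noteq> {#}"
      then obtain x where x: "x \<in># M" by blast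
      then have xc: "x \<in> carrier G" using zsf_carrier[OF z] by blast
      have "ord x dvd 1" using group_exp(3)[OF xc] True by simp
      then have "x = \<one>" using pow_one_iff[OF xc, of 1] xc by simp
      then show False using zsf_ne_one[OF z x] by simp
    qed
    then show ?thesis using nonneg by (auto intro: sum_nonneg)
  next
    case False
    define P where "P = largest_prime ?e"
    have e0: "?e > 0" by (rule group_exp(1))
    have pf: "prime_factors ?e \<noteq> {}" using False e0 by (simp add: prime_factorization_empty_iff)
    have PP: "P \<in> prime_factors ?e" unfolding P_def largest_prime_def using pf by (intro Max_in) auto
    have primeP: "prime P" "P dvd ?e" using PP by (auto simp: in_prime_factors_iff)
    have Pmax: "s \<le> P" if "prime s" "s dvd ?e" for s
      unfolding P_def largest_prime_def using that e0 by (intro Max_ge) (auto simp: prime_factors_dvd)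
    define KP where "KP = (\<Sum>i\<in>comps P. 1 - 1 / real (P ^ \<alpha> i))"
    interpret cross_setting G P KP
    proof unfold_locales
      show "prime P" by (rule primeP(1))
      show "cr M \<le> KP" if "zsf M" "\<And>x. x \<in># M \<Longrightarrow> \<exists>k. ord x = P ^ k" for M
        unfolding KP_def by (rule cross_number_p_part_le[OF primeP(1) that])
      show "thin s" if s: "prime s" "s < P" for s
        unfolding thin_def
      proof (intro allI impI)
        fix M assume M: "zsf M" "\<forall>x\<in>#M. \<exists>k. ord x = s ^ k"
        have le: "cr M \<le> (\<Sum>i\<in>comps s. 1 - 1 / real (s ^ \<alpha> i))"
          by (rule cross_number_p_part_le[OF s(1) M(1)]) (use M(2) in blast)
        have uniq: "i = j" if "i \<in> comps s" "j \<in> comps s" for i j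
          by (rule comps_cyclic_unique[OF s(1) _ that]) (use cyc s(2) in \<open>auto simp: P_def\<close>)
        show "cr M < 1"
        proof (cases "comps s = {}")
          case True
          then show ?thesis using le by simp
        next
          case False
          then obtain i where "i \<in> comps s" by blast
          then have "comps s = {i}" using uniq by blast
          then have "cr M \<le> 1 - 1 / real (s ^ \<alpha> i)" using le by simp
          moreover have "0 < 1 / real (s ^ \<alpha> i)" using prime_gt_0_nat[OF s(1)] by simp
          ultimately show ?thesis by linarith
        qed
      qed
    qed
    have "good ?e"
      unfolding good_def
    proof (intro conjI allI impI)
      show "hsum s ?e \<le> real s / (real s - 1)" if "prime s" "s dvd ?e" "s < P" for s
        by (rule wide_imp_hsum_le[OF w that(1,2)]) (use that(3) in \<open>simp add: P_def\<close>)
      show "?e > 0" by (rule e0)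
      show "P dvd ?e" by (rule primeP(2))
      show "s \<le> P" if "prime s" "s dvd ?e" for s using that by (rule Pmax)
    qed
    then have "bound ?e" by (rule good_imp_bound)
    then have "cr M \<le> Kb ?e"
      unfolding bound_def using z zsf_carrier[OF z] group_exp(3) by (meson subsetD)
    also have "Kb ?e \<le> (\<Sum>i<r. 1 - 1 / real (n i))"
    proof -
      define A where "A = {s. prime s \<and> s < P}"
      define B where "B = {s \<in> A. s dvd ?e}"
      have fA: "finite A" by (rule finite_subset[of _ "{..P}"]) (auto simp: A_def)
      have "\<exists>i. \<forall>s\<in>B. i s \<in> comps s \<and> \<alpha> (i s) = multiplicity s ?e"
        using exp_attained by (intro bchoice) (auto simp: A_def B_def)
      then obtain \<iota> where \<iota>: "\<And>s. s \<in> B \<Longrightarrow> \<iota> s \<in> comps s \<and> \<alpha> (\<iota> s) = multiplicity s ?e" by blast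
      have "(\<Sum>s\<in>A. 1 - 1 / real (s ^ multiplicity s ?e)) = (\<Sum>s\<in>B. 1 - 1 / real (s ^ multiplicity s ?e))"
        using fA by (intro sum.mono_neutral_right) (auto simp: B_def not_dvd_imp_multiplicity_0)
      also have "\<dots> = (\<Sum>s\<in>B. 1 - 1 / real (n (\<iota> s)))"
      proof (rule sum.cong)
        fix s assume "s \<in> B"
        then have "p (\<iota> s) = s" "\<alpha> (\<iota> s) = multiplicity s ?e" using \<iota> by (auto simp: comps_def)
        then show "1 - 1 / real (s ^ multiplicity s ?e) = 1 - 1 / real (n (\<iota> s))" by simp
      qed simp
      also have "\<dots> = (\<Sum>i\<in>\<iota> ` B. 1 - 1 / real (n i))"
      proof (subst sum.reindex)
        show "inj_on \<iota> B"
        proof (rule inj_onI)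
          fix s t assume st: "s \<in> B" "t \<in> B" "\<iota> s = \<iota> t"
          have "p (\<iota> s) = s" "p (\<iota> t) = t"
            using \<iota>[OF st(1)] \<iota>[OF st(2)] by (simp_all add: comps_def)
          then show "s = t" using st(3) by metis
        qed
      qed simp
      finally have 1: "(\<Sum>s\<in>A. 1 - 1 / real (s ^ multiplicity s ?e)) = (\<Sum>i\<in>\<iota> ` B. 1 - 1 / real (n i))" .
      have 2: "KP = (\<Sum>i\<in>comps P. 1 - 1 / real (n i))"
        unfolding KP_def by (rule sum.cong) (auto simp: comps_def)
      have sub: "\<iota> ` B \<subseteq> {..<r}" "comps P \<subseteq> {..<r}"
        using \<iota> unfolding comps_def by blast+
      have disj: "comps P \<inter> \<iota> ` B = {}"
      proof (rule ccontr)
        assume "\<not> ?thesis"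
        then obtain s where s: "s \<in> B" "\<iota> s \<in> comps P" by blast
        have "p (\<iota> s) = s" using \<iota>[OF s(1)] by (simp add: comps_def)
        moreover have "p (\<iota> s) = P" using s(2) by (simp add: comps_def)
        ultimately show False using s(1) by (simp add: A_def B_def)
      qed
      have "Kb ?e = (\<Sum>i\<in>comps P. 1 - 1 / real (n i)) + (\<Sum>i\<in>\<iota> ` B. 1 - 1 / real (n i))"
        unfolding Kb_def using 1 2 unfolding A_def by simp
      also have "\<dots> = (\<Sum>i\<in>comps P \<union> \<iota> ` B. 1 - 1 / real (n i))"
        using sub disj by (intro sum.union_disjoint[symmetric]) (auto intro: finite_subset)
      also have "\<dots> \<le> (\<Sum>i<r. 1 - 1 / real (n i))"
        using sub nonneg by (intro sum_mono2) auto
      finally show ?thesis .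
    qed
    finally show ?thesis .
  qed
qed

end

section \<open>Indexed sequences and the extremal value\<close>

text \<open>
  Forgetting the labels.
\<close>

definition seq_mset :: "('a \<times> nat) set \<Rightarrow> 'a multiset" where
  "seq_mset S = image_mset fst (mset_set S)"

lemma count_seq_mset:
  assumes "finite S"
  shows "count (seq_mset S) g = seq_mult S g"
proof -
  have "count (seq_mset S) g = (\<Sum>t\<in>fst -` {g} \<inter> S. count (mset_set S) t)"
    unfolding seq_mset_def count_image_mset using assms by simp
  also have "\<dots> = (\<Sum>t\<in>fst -` {g} \<inter> S. 1)" using assms by (intro sum.cong) auto
  also have "\<dots> = card {t \<in> S. fst t = g}" by (simp add: vimage_def Int_def conj_commute)
  finally show ?thesis by (simp add: seq_mult_def)
qed

lemma seq_mset_subset: "finite S \<Longrightarrow> T \<subseteq> S \<Longrightarrow> seq_mset T \<subseteq># seq_mset S"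
  unfolding seq_mset_def by (intro image_mset_subseteq_mono subset_imp_msubset_mset_set) auto

text \<open>
  Distinct pairs with equal first coordinate become equal elements, but every submultiset can still be
  realised by choosing enough of the pairs.
\<close>

lemma submultiset_of_seq:
  assumes "finite S" "U \<subseteq># seq_mset S"
  shows "\<exists>T\<subseteq>S. U = seq_mset T"
proof -
  obtain V where V: "V \<subseteq># mset_set S" "U = image_mset fst V"
    using assms(2) unfolding seq_mset_def
    by (metis image_mset_eq_plusD mset_subset_eq_add_left subset_mset.add_diff_inverse)
  have "count V x \<le> 1" for x
    using mset_subset_eq_count[OF V(1), of x] assms(1) by (cases "x \<in> S") auto
  then have "V = mset_set (set_mset V)"
    by (intro multiset_eqI) (metis One_nat_def count_eq_zero_iff count_mset_set(1,3) finite_set_mset le_Suc_eq le_zero_eq)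
  moreover have "set_mset V \<subseteq> S" using set_mset_mono[OF V(1)] assms(1) by simp
  ultimately show ?thesis using V(2) unfolding seq_mset_def by metis
qed

context fin_comm_group begin

lemma seq_sum_eq_mprod:
  assumes "indexed_seq G S"
  shows "seq_sum G S = mprod (seq_mset S)"
proof -
  have "finite S" using assms by (simp add: indexed_seq_def)
  then have "seq_sum G S = (\<Otimes>g\<in>carrier G - {\<one>}. g [^] count (seq_mset S) g)"
    unfolding seq_sum_def by (simp add: count_seq_mset)
  also have "\<dots> = mprod (seq_mset S)"
    unfolding mprod_def by (rule finprod_mono_neutral_cong_left) (use fin in auto)
  finally show ?thesis .
qed

lemma sum_count_eq_sum_mset:
  assumes "finite A" "set_mset M \<subseteq> A"
  shows "(\<Sum>x\<in>A. real (count M x) * f x) = (\<Sum>x\<in>#M. f x)"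
  using assms(2)
proof (induction M)
  case empty
  then show ?case by simp
next
  case (add y M)
  have "(\<Sum>x\<in>A. real (count (add_mset y M) x) * f x) = (\<Sum>x\<in>A. (if x = y then f x else 0) + real (count M x) * f x)"
    by (intro sum.cong) (auto simp: algebra_simps)
  also have "\<dots> = f y + (\<Sum>x\<in>A. real (count M x) * f x)"
    using add.prems assms(1) by (simp add: sum.distrib)
  finally show ?case using add by simp
qed

lemma cross_number_eq_cr:
  assumes "indexed_seq G S"
  shows "cross_number G S = cr (seq_mset S)"
proof -
  have f: "finite S" and S: "S \<subseteq> (carrier G - {\<one>}) \<times> UNIV" using assms by (auto simp: indexed_seq_def)
  have "cross_number G S = (\<Sum>g\<in>carrier G - {\<one>}. real (count (seq_mset S) g) * (1 / real (ord g)))"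
    unfolding cross_number_def by (simp add: count_seq_mset[OF f])
  also have "\<dots> = cr (seq_mset S)"
    unfolding cr_def by (rule sum_count_eq_sum_mset) (use fin f S in \<open>auto simp: seq_mset_def\<close>)
  finally show ?thesis .
qed

lemma zero_sum_free_iff_zsf:
  assumes S: "indexed_seq G S"
  shows "zero_sum_free G S \<longleftrightarrow> zsf (seq_mset S)"
proof -
  have f: "finite S" and Sc: "S \<subseteq> (carrier G - {\<one>}) \<times> UNIV" using S by (auto simp: indexed_seq_def)
  have sub: "indexed_seq G T" if "T \<subseteq> S" for T
    using that f Sc unfolding indexed_seq_def by (auto intro: finite_subset)
  have ne: "seq_mset T = {#} \<longleftrightarrow> T = {}" if "T \<subseteq> S" for T
    using finite_subset[OF that f] by (simp add: seq_mset_def mset_set_empty_iff)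
  have car: "set_mset (seq_mset S) \<subseteq> carrier G" using f Sc by (auto simp: seq_mset_def)
  show ?thesis
  proof
    assume z: "zero_sum_free G S"
    show "zsf (seq_mset S)"
      unfolding zsf_def
    proof (intro conjI allI impI car)
      fix U assume U: "U \<subseteq># seq_mset S" "U \<noteq> {#}"
      then obtain T where T: "T \<subseteq> S" "U = seq_mset T" using submultiset_of_seq[OF f] by blast
      then have "seq_sum G T \<noteq> \<one>" using z U(2) ne[OF T(1)] unfolding zero_sum_free_def by blast
      then show "mprod U \<noteq> \<one>" using seq_sum_eq_mprod[OF sub[OF T(1)]] T(2) by simp
    qed
  next
    assume z: "zsf (seq_mset S)"
    show "zero_sum_free G S"
      unfolding zero_sum_free_def
    proof (intro notI, elim exE conjE)
      fix T assume T: "T \<subseteq> S" "T \<noteq> {}" "seq_sum G T = \<one>"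
      then show False
        using zsf_mprod[OF z seq_mset_subset[OF f T(1)]] ne[OF T(1)] seq_sum_eq_mprod[OF sub[OF T(1)]] by simp
    qed
  qed
qed

lemma zsf_is_seq:
  assumes z: "zsf M"
  shows "\<exists>S. indexed_seq G S \<and> seq_mset S = M"
proof -
  define S where "S = (SIGMA g:set_mset M. {..<count M g})"
  have f: "finite S" unfolding S_def by auto
  have "\<one> \<notin># M" using zsf_ne_one[OF z] by blast
  then have i: "indexed_seq G S"
    unfolding indexed_seq_def using f zsf_carrier[OF z] by (auto simp: S_def)
  have "{t \<in> S. fst t = g} = {g} \<times> {..<count M g}" for g
    by (auto simp: S_def count_eq_zero_iff) (metis count_eq_zero_iff gr_implies_not0)
  then have "seq_mult S g = count M g" for g by (simp add: seq_mult_def card_cartesian_product)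
  then have "seq_mset S = M" by (intro multiset_eqI) (simp add: count_seq_mset[OF f])
  then show ?thesis using i by blast
qed

lemma cross_numbers_eq:
  "{cross_number G S | S. indexed_seq G S \<and> zero_sum_free G S} = cr ` {M. zsf M}"
proof (intro subset_antisym subsetI)
  fix x assume "x \<in> {cross_number G S | S. indexed_seq G S \<and> zero_sum_free G S}"
  then show "x \<in> cr ` {M. zsf M}" using cross_number_eq_cr zero_sum_free_iff_zsf by auto
next
  fix x assume "x \<in> cr ` {M. zsf M}"
  then obtain M where M: "zsf M" "x = cr M" by blast
  obtain S where S: "indexed_seq G S" "seq_mset S = M" using zsf_is_seq[OF M(1)] by blast
  have "x = cross_number G S" using cross_number_eq_cr[OF S(1)] S(2) M(2) by simp
  moreover have "zero_sum_free G S" using zero_sum_free_iff_zsf[OF S(1)] S(2) M(1) by simp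
  ultimately show "x \<in> {cross_number G S | S. indexed_seq G S \<and> zero_sum_free G S}" using S(1) by blast
qed

lemma mprod_replicate: "x \<in> carrier G \<Longrightarrow> mprod (replicate_mset k x) = x [^] k"
  by (induction k) (auto simp: m_comm)

text \<open>
  \<open>Max\<close> is meaningful only for finite sets. A zero-sum free multiset contains each \<open>g\<close> fewer than
  \<open>ord g\<close> times.
\<close>

lemma finite_cross_numbers: "finite (cr ` {M. zsf M})"
proof (rule finite_surj)
  let ?n = "card (carrier G)"
  show "finite (\<Pi>\<^sub>E g\<in>carrier G. {..?n})" using fin by (intro finite_PiE) auto
  show "cr ` {M. zsf M} \<subseteq> (\<lambda>c. \<Sum>g\<in>carrier G. real (c g) * (1 / real (ord g))) ` (\<Pi>\<^sub>E g\<in>carrier G. {..?n})"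
  proof
    fix x assume "x \<in> cr ` {M. zsf M}"
    then obtain M where M: "zsf M" "x = cr M" by blast
    have le: "count M g \<le> ?n" if g: "g \<in> carrier G" for g
    proof (rule ccontr)
      assume "\<not> count M g \<le> ?n"
      then have "ord g \<le> count M g" using ord_le_group_order[OF fin g] unfolding Coset.order_def by linarith
      then have "replicate_mset (ord g) g \<subseteq># M" by (simp add: count_le_replicate_mset_subset_eq)
      moreover have "replicate_mset (ord g) g \<noteq> {#}"
        using ord_pos[OF g] by (metis replicate_mset_eq_empty_iff less_irrefl)
      ultimately have "mprod (replicate_mset (ord g) g) \<noteq> \<one>" by (rule zsf_mprod[OF M(1)])
      then show False using g by (simp add: mprod_replicate)
    qed
    have "x = (\<Sum>g\<in>carrier G. real (restrict (count M) (carrier G) g) * (1 / real (ord g)))"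
      using sum_count_eq_sum_mset[OF fin zsf_carrier[OF M(1)], of "\<lambda>g. 1 / real (ord g)"] M(2) by (simp add: cr_def)
    moreover have "restrict (count M) (carrier G) \<in> (\<Pi>\<^sub>E g\<in>carrier G. {..?n})" using le by auto
    ultimately show "x \<in> (\<lambda>c. \<Sum>g\<in>carrier G. real (c g) * (1 / real (ord g))) ` (\<Pi>\<^sub>E g\<in>carrier G. {..?n})"
      by blast
  qed
qed

lemma little_cross_number_eqI:
  assumes "\<And>M. zsf M \<Longrightarrow> cr M \<le> k" "zsf M" "cr M = k"
  shows "little_cross_number G = k"
  unfolding little_cross_number_def cross_numbers_eq
  by (rule Max_eqI[OF finite_cross_numbers]) (use assms in auto)

end

context cyclic_decomposition begin

definition extremal :: "'a multiset" where
  "extremal = (\<Sum>i<r. replicate_mset (n i - 1) (u i))"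

lemma h_mprod:
  assumes "set_mset M \<subseteq> carrier G" "i < r"
  shows "h (mprod M) i = (\<Sum>x\<in>#M. h x i) mod int (n i)"
  using assms(1)
proof (induction M)
  case empty
  then show ?case using h_one assms(2) by simp
next
  case (add x M)
  then have "h (mprod (add_mset x M)) i = (h x i + (\<Sum>x\<in>#M. h x i) mod int (n i)) mod int (n i)"
    using assms(2) by (simp add: h_mult)
  then show ?case by (simp add: mod_add_right_eq)
qed

lemma u_inj: "i < r \<Longrightarrow> j < r \<Longrightarrow> u i = u j \<Longrightarrow> i = j"
  using u(2)[of i i] u(2)[of j i] by (metis zero_neq_one)

lemma in_extremal: "x \<in># extremal \<Longrightarrow> \<exists>i<r. x = u i"
  unfolding extremal_def by (auto simp: set_mset_sum in_replicate_mset)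

lemma count_extremal:
  assumes "i < r"
  shows "count extremal (u i) = n i - 1"
proof -
  have "count extremal (u i) = (\<Sum>j<r. if j = i then n i - 1 else 0)"
    unfolding extremal_def count_sum using assms u_inj by (intro sum.cong) auto
  then show ?thesis using assms by simp
qed

text \<open>
  The \<open>i\<close>-th coordinate of a subproduct is the number of copies of \<open>u i\<close> used, which is less than
  \<open>n i\<close>.
\<close>

lemma zsf_extremal: "zsf extremal"
  unfolding zsf_def
proof (intro conjI allI impI)
  show "set_mset extremal \<subseteq> carrier G" using in_extremal u(1) by blast
  fix T assume T: "T \<subseteq># extremal" "T \<noteq> {#}"
  have Tu: "\<exists>i<r. x = u i" if "x \<in># T" for x using in_extremal mset_subset_eqD[OF T(1) that] by blast
  have Tc: "set_mset T \<subseteq> carrier G" using Tu u(1) by blast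
  show "mprod T \<noteq> \<one>"
  proof
    assume one: "mprod T = \<one>"
    have "count T (u i) = 0" if i: "i < r" for i
    proof -
      have "(\<Sum>x\<in>#T. h x i) = (\<Sum>x\<in>#T. if x = u i then 1 else 0)"
        using Tu u(2) u_inj i by (intro arg_cong[where f = sum_mset] image_mset_cong) (metis (full_types))
      also have "\<dots> = int (count T (u i))" by (induction T) auto
      finally have "int (count T (u i)) mod int (n i) = 0"
        using h_mprod[OF Tc i] one h_one[OF i] by simp
      then have "n i dvd count T (u i)" by (metis int_dvd_int_iff mod_0_imp_dvd)
      moreover have "count T (u i) < n i"
        using mset_subset_eq_count[OF T(1), of "u i"] count_extremal[OF i] n_gt_1[OF i] by linarith
      ultimately show ?thesis by (meson dvd_imp_le gr0I not_less)
    qed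
    then have "x \<notin># T" for x using Tu by (metis count_eq_zero_iff)
    then show False using T(2) by (metis multiset_nonemptyE)
  qed
qed

lemma cr_extremal: "cr extremal = (\<Sum>i<r. 1 - 1 / real (n i))"
proof -
  have rep: "cr (replicate_mset k x) = real k / real (ord x)" for k x
    by (induction k) (auto simp: add_divide_distrib)
  have sum: "cr (\<Sum>i<m. F i) = (\<Sum>i<m. cr (F i))" for F :: "nat \<Rightarrow> 'a multiset" and m
    by (induction m) auto
  have "cr extremal = (\<Sum>i<r. real (n i - 1) / real (ord (u i)))"
    unfolding extremal_def sum rep ..
  also have "\<dots> = (\<Sum>i<r. 1 - 1 / real (n i))"
  proof (rule sum.cong)
    fix i assume "i \<in> {..<r}"
    then have i: "i < r" by simp
    have "real (m - 1) / real m = 1 - 1 / real m" if "1 < m" for m :: nat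
      using that by (simp add: of_nat_diff diff_divide_distrib)
    then show "real (n i - 1) / real (ord (u i)) = 1 - 1 / real (n i)"
      using n_gt_1[OF i] unfolding ord_u[OF i] by blast
  qed simp
  finally show ?thesis .
qed

lemma little_cross_number_eq:
  assumes "wide (group_exp G)"
    and "\<And>s Q. is_p_component G s Q \<Longrightarrow> s \<noteq> largest_prime (group_exp G) \<Longrightarrow> cyclic_group (G\<lparr>carrier := Q\<rparr>)"
  shows "little_cross_number G = (\<Sum>i<r. 1 - 1 / real (n i))"
  by (rule little_cross_number_eqI[OF cross_number_le[OF assms] zsf_extremal cr_extremal])

end

context fin_comm_group begin

lemma pow_mod_ord: "x \<in> carrier G \<Longrightarrow> x [^] (k mod ord x) = x [^] (k::nat)"
proof -
  assume x: "x \<in> carrier G"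
  have "x [^] k = x [^] (ord x * (k div ord x) + k mod ord x)" by (simp only: mult_div_mod_eq)
  also have "\<dots> = (x [^] ord x) [^] (k div ord x) \<otimes> x [^] (k mod ord x)"
    by (simp only: nat_pow_pow[OF x] nat_pow_mult[OF x])
  also have "\<dots> = x [^] (k mod ord x)" using x by simp
  finally show ?thesis by simp
qed

lemma exists_cyclic_decomposition:
  "\<exists>r p \<alpha> h. cyclic_decomposition G r p \<alpha> h"
proof -
  have "mclosed (carrier G)" by (simp add: mclosed_def)
  from exists_prime_power_basis[OF this] obtain r g where
    ind: "independent r g" and g: "\<And>i. i < r \<Longrightarrow> g i \<in> carrier G"
    and pp: "\<forall>i<r. \<exists>p k. prime p \<and> k \<ge> 1 \<and> ord (g i) = p ^ k"
    and gen: "\<And>x. x \<in> carrier G \<Longrightarrow> \<exists>c::nat \<Rightarrow> nat. x = (\<Otimes>i\<in>{..<r}. g i [^] c i)"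
    by blast
  obtain p \<alpha> where pa: "\<And>i. i < r \<Longrightarrow> prime (p i) \<and> \<alpha> i \<ge> 1 \<and> ord (g i) = p i ^ \<alpha> i"
    using pp by metis
  let ?A = "product_group {..<r} (\<lambda>i. integer_mod_group (p i ^ \<alpha> i))"
  define f where "f c = (\<Otimes>i\<in>{..<r}. g i [^] nat (c i))" for c :: "nat \<Rightarrow> int"
  have fclosed: "f c \<in> carrier G" for c unfolding f_def using g by (intro finprod_closed) auto
  have carr: "carrier (integer_mod_group (p i ^ \<alpha> i)) = {0..<int (ord (g i))}" if "i < r" for i
    using pa[OF that] prime_gt_0_nat[of "p i"] by (simp add: carrier_integer_mod_group)
  have rng: "0 \<le> c i \<and> c i < int (ord (g i))" if "c \<in> carrier ?A" "i < r" for c i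
  proof -
    have "c i \<in> carrier (integer_mod_group (p i ^ \<alpha> i))"
      by (rule PiE_mem[of c "{..<r}"]) (use that in simp_all)
    then show ?thesis unfolding carr[OF that(2)] by simp
  qed
  have "f \<in> hom ?A G"
  proof (rule homI)
    fix c d assume c: "c \<in> carrier ?A" and d: "d \<in> carrier ?A"
    have "f (c \<otimes>\<^bsub>?A\<^esub> d) = (\<Otimes>i\<in>{..<r}. g i [^] nat (c i) \<otimes> g i [^] nat (d i))"
      unfolding f_def
    proof (rule finprod_cong')
      fix i assume "i \<in> {..<r}"
      then have i: "i < r" by simp
      have "(c \<otimes>\<^bsub>?A\<^esub> d) i = (c i + d i) mod int (ord (g i))" using i pa by simp
      then have "nat ((c \<otimes>\<^bsub>?A\<^esub> d) i) = (nat (c i) + nat (d i)) mod ord (g i)"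
        using rng[OF c i] rng[OF d i] by (simp add: nat_mod_distrib nat_add_distrib)
      then show "g i [^] nat ((c \<otimes>\<^bsub>?A\<^esub> d) i) = g i [^] nat (c i) \<otimes> g i [^] nat (d i)"
        using pow_mod_ord[OF g[OF i]] g[OF i] by (simp add: nat_pow_mult)
    qed (use g in auto)
    also have "\<dots> = f c \<otimes> f d" unfolding f_def by (rule finprod_multf) (use g in auto)
    finally show "f (c \<otimes>\<^bsub>?A\<^esub> d) = f c \<otimes> f d" .
  qed (rule fclosed)
  moreover have "inj_on f (carrier ?A)"
  proof (rule inj_onI)
    fix c d assume c: "c \<in> carrier ?A" and d: "d \<in> carrier ?A" and eq: "f c = f d"
    (* exponents are natural numbers, so d is subtracted modulo the order; e i lies strictly between 0 and 2 ord (g i) *)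
    define e where "e i = nat (c i) + (ord (g i) - nat (d i))" for i
    let ?E = "\<Otimes>i\<in>{..<r}. g i [^] e i"
    have Ec: "?E \<in> carrier G" using g by (intro finprod_closed) auto
    have "?E \<otimes> f d = (\<Otimes>i\<in>{..<r}. g i [^] e i \<otimes> g i [^] nat (d i))"
      unfolding f_def by (rule finprod_multf[symmetric]) (use g in auto)
    also have "\<dots> = f c"
      unfolding f_def
    proof (rule finprod_cong')
      fix i assume "i \<in> {..<r}"
      then have i: "i < r" by simp
      have "e i + nat (d i) = nat (c i) + ord (g i)" using rng[OF d i] unfolding e_def by linarith
      then have "g i [^] e i \<otimes> g i [^] nat (d i) = g i [^] (nat (c i) + ord (g i))"
        using g[OF i] by (simp add: nat_pow_mult)
      then show "g i [^] e i \<otimes> g i [^] nat (d i) = g i [^] nat (c i)"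
        using g[OF i] by (simp add: nat_pow_mult[symmetric])
    qed (use g in auto)
    finally have "?E \<otimes> f d = \<one> \<otimes> f d" using eq fclosed[of d] by simp
    then have "?E = \<one>" using right_cancel[OF fclosed Ec one_closed] by blast
    then have dv: "\<forall>i<r. ord (g i) dvd e i" using ind unfolding independent_def by blast
    show "c = d"
    proof (rule PiE_ext)
      show "c \<in> (\<Pi>\<^sub>E i\<in>{..<r}. {0..<int (ord (g i))})" "d \<in> (\<Pi>\<^sub>E i\<in>{..<r}. {0..<int (ord (g i))})"
        using c d carr by (auto simp: PiE_iff)
      fix i assume "i \<in> {..<r}"
      then have i: "i < r" by simp
      obtain q where q: "e i = ord (g i) * q" using dv i by (blast elim: dvdE)
      have lt: "0 < e i" "e i < ord (g i) * 2" using rng[OF c i] rng[OF d i] unfolding e_def by linarith+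
      then have "0 < q" "q < 2" unfolding q by auto
      then have "q = 1" by simp
      then have "e i = ord (g i)" using q by simp
      then show "c i = d i" using rng[OF c i] rng[OF d i] unfolding e_def by linarith
    qed
  qed
  moreover have "f ` carrier ?A = carrier G"
  proof (intro subset_antisym subsetI)
    fix x assume "x \<in> carrier G"
    then obtain c :: "nat \<Rightarrow> nat" where c: "x = (\<Otimes>i\<in>{..<r}. g i [^] c i)" using gen by blast
    let ?c = "\<lambda>i\<in>{..<r}. int (c i mod ord (g i))"
    have "x = f ?c"
      unfolding c f_def by (rule finprod_cong') (use g pow_mod_ord in auto)
    moreover have "?c \<in> carrier ?A"
      using carr ord_pos[OF g] by auto
    ultimately show "x \<in> f ` carrier ?A" by blast
  qed (use fclosed in auto)
  ultimately have "f \<in> iso ?A G" unfolding iso_def bij_betw_def by blast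
  moreover have "group ?A" by simp
  ultimately have "inv_into (carrier ?A) f \<in> iso G ?A" by (intro group.iso_set_sym)
  then have "cyclic_decomposition G r p \<alpha> (inv_into (carrier ?A) f)"
    by unfold_locales (use pa in auto)
  then show ?thesis by blast
qed

text \<open>
  Every decomposition gives the value \<open>little_cross_number G\<close>, so \<open>k_star\<close> is well defined and equal
  to it.
\<close>

lemma little_cross_number_eq_k_star:
  assumes "wide (group_exp G)"
    and "\<And>s Q. is_p_component G s Q \<Longrightarrow> s \<noteq> largest_prime (group_exp G) \<Longrightarrow> cyclic_group (G\<lparr>carrier := Q\<rparr>)"
  shows "little_cross_number G = k_star G"
proof -
  have val: "x = little_cross_number G"
    if pa: "\<forall>i<r::nat. prime (p i) \<and> \<alpha> i \<ge> 1"
      and iso: "G \<cong> product_group {..<r} (\<lambda>i. integer_mod_group (p i ^ \<alpha> i))"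
      and x: "x = (\<Sum>i<r. 1 - 1 / real (p i) ^ \<alpha> i)" for x r p \<alpha>
  proof -
    obtain h where "h \<in> iso G (product_group {..<r} (\<lambda>i. integer_mod_group (p i ^ \<alpha> i)))"
      using iso unfolding is_iso_def by blast
    then interpret cyclic_decomposition G r p \<alpha> h by unfold_locales (use pa in auto)
    show ?thesis using little_cross_number_eq[OF assms] x by simp
  qed
  obtain r p \<alpha> h where "cyclic_decomposition G r p \<alpha> h" using exists_cyclic_decomposition by blast
  then interpret D: cyclic_decomposition G r p \<alpha> h .
  have "k_star G = little_cross_number G"
    unfolding k_star_def
  proof (rule the_equality)
    show "\<exists>(r::nat) (p::nat \<Rightarrow> nat) (\<alpha>::nat \<Rightarrow> nat). (\<forall>i<r. prime (p i) \<and> \<alpha> i \<ge> 1) \<and>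
        G \<cong> product_group {..<r} (\<lambda>i. integer_mod_group (p i ^ \<alpha> i)) \<and>
        little_cross_number G = (\<Sum>i<r. 1 - 1 / real (p i) ^ \<alpha> i)"
    proof (intro exI conjI allI impI)
      show "G \<cong> product_group {..<r} (\<lambda>i. integer_mod_group (p i ^ \<alpha> i))"
        using D.h_iso unfolding is_iso_def by blast
      show "little_cross_number G = (\<Sum>i<r. 1 - 1 / real (p i) ^ \<alpha> i)"
        using D.little_cross_number_eq[OF assms] by simp
    qed (use D.prime_p D.\<alpha>_pos in auto)
  qed (use val in blast)
  then show ?thesis by simp
qed

end

theorem corollary8:
  fixes G :: "('a, 'b) monoid_scheme"
  assumes "comm_group G"
    and "finite (carrier G)"
    and "wide (group_exp G)"
    and "\<And>p P. is_p_component G p P \<Longrightarrow> p \<noteq> largest_prime (group_exp G) \<Longrightarrow>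
           cyclic_group (G\<lparr>carrier := P\<rparr>)"
  shows "little_cross_number G = k_star G"
proof -
  interpret comm_group G by (rule assms(1))
  interpret fin_comm_group G by unfold_locales (rule assms(2))
  show ?thesis by (rule little_cross_number_eq_k_star[OF assms(3,4)])
qed

end
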